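(* Let $f,\mathcal P,\xi,\beta,r,\gamma$ be as in the setting described in the context, and let $\mathcal L_\xi$ be the associated transfer operator. If $\beta>\frac{1}{r+1}$, then for each $\alpha$ with $$1>\alpha>\max\left\{\gamma,\ 1-\beta,\ \frac{1-\beta}{1-\beta(1-r)}\right\},$$ the spectral radius of $\mathcal L_\xi$, when acting on $\mathcal B_\alpha$, is bounded from above by $|\xi f'|_\infty$, while its essential spectral radius is bounded from above by $\min\{|\xi f'|_\infty,\ 8\,|\xi (f')^{\alpha}|_\infty\}$.
   Context: **Setting.** All $L^p$ spaces are with respect to Lebesgue measure on $[0,1]$, and $|\cdot|_\infty$ is the $L^\infty$ norm. For real $x,t$, the power $x^t$ is understood as a complex number and $|\cdot|$ denotes both absolute value and complex modulus (so $|(f')^t|=|f'|^t$). Let $\mathcal P$ be a (possibly infinite) collection of pairwise disjoint open subintervals of $[0,1]$ whose union has full Lebesgue measure in $[0,1]$, and let $f$ be an (almost everywhere defined) map of $[0,1]$ into itself such that, for each $p\in\mathcal P$, $f\in\mathcal C^1(p,\mathbb R)$ and $f,\frac1{f'}\in\mathcal C^0(\bar p,\mathbb R)$ (that is, they extend continuously from $p$ to the closure $\bar p$). Assume $\inf_{p\in\mathcal P}\inf_{x\in p}|f'(x)|>1$. Let $\xi:[0,1]\to\mathbb C$ be a function (the weight) for which there exists $\beta\in(0,1]$ such that, for each $p\in\mathcal P$, $\xi\in C^\beta(\bar p,\mathbb C)$ (that is, $\xi|_p$ extends to a $\beta$-Hölder function on $\bar p$), with $\beta$-Hölder constant uniform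 in $p$. Assume also that $|f'|^r\in L^1$ for some $r\ge 0$, that $\xi\cdot f'\in L^\infty$, and that there exists $\gamma\in[0,1)$ such that $$\sum_{p\in\mathcal P}\sup_{z\in p}|\xi(z)f'(z)^\gamma|^{\frac1{1-\gamma}}<\infty .$$ **Transfer operator.** $\mathcal L_\xi h(x)=\sum_{y\in f^{-1}(x)}\xi(y)h(y)$. **Banach space.** For $\varphi\in\mathcal C^1([0,1],\mathbb C)$ and $\alpha\in(0,1)$ let $$|\varphi|_\alpha=\sup_{x\in[0,1]}|\varphi(x)|+\sup_{x\ne y\in[0,1]}\frac{|\varphi(x)-\varphi(y)|}{|x-y|^\alpha}.$$ For $h\in L^1([0,1])$ (complex valued) let $\|h\|_\alpha=\sup\{|\int_0^1 h\varphi'|:\ \varphi\in\mathcal C^1([0,1],\mathbb C),\ |\varphi|_\alpha\le1\}$. Then $\mathcal B_\alpha=\{h\in L^1([0,1]):\|h\|_\alpha<\infty\}$ with the norm $\|\cdot\|_\alpha$ (a Banach space). *)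

theory Defs
  imports "HOL-Analysis.Analysis" "HOL-Probability.Essential_Supremum"
begin

abbreviation leb01 :: "real measure" where
  "leb01 \<equiv> lebesgue_on {0..1}"

definition Linf_norm :: "(real \<Rightarrow> complex) \<Rightarrow> ennreal" where
  "Linf_norm g = esssup leb01 (\<lambda>x. ennreal (norm (g x)))"

definition extends_continuously :: "(real \<Rightarrow> real) \<Rightarrow> real set \<Rightarrow> bool" where
  "extends_continuously g p \<longleftrightarrow>
     (\<exists>G. continuous_on (closure p) G \<and> (\<forall>x\<in>p. G x = g x))"

text \<open>
  The map is defined on the union of \<open>P\<close> only: the values of the total function \<open>f\<close> (and of
  \<open>deriv f\<close>) off that union are never used, except on a Lebesgue null set.
\<close>

definition piecewise_expanding :: "real set set \<Rightarrow> (real \<Rightarrow> real) \<Rightarrow> bool" where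
  "piecewise_expanding P f \<longleftrightarrow>
     (\<forall>p\<in>P. \<exists>a b. 0 \<le> a \<and> a < b \<and> b \<le> 1 \<and> p = {a<..<b}) \<and>
     disjoint P \<and>
     negligible ({0..1} - \<Union>P) \<and>
     f ` \<Union>P \<subseteq> {0..1} \<and>
     (\<forall>p\<in>P. f C1_differentiable_on p \<and>
             extends_continuously f p \<and>
             extends_continuously (\<lambda>x. 1 / deriv f x) p) \<and>
     (INF p\<in>P. INF x\<in>p. ereal \<bar>deriv f x\<bar>) > 1"

definition piecewise_Holder :: "real set set \<Rightarrow> real \<Rightarrow> (real \<Rightarrow> complex) \<Rightarrow> bool" where
  "piecewise_Holder P \<beta> \<xi> \<longleftrightarrow>
     (\<exists>C. \<forall>p\<in>P. \<exists>g. (\<forall>x\<in>p. g x = \<xi> x) \<and>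
        (\<forall>x\<in>closure p. \<forall>y\<in>closure p. norm (g x - g y) \<le> C * \<bar>x - y\<bar> powr \<beta>))"

text \<open>
  The sum over the (at most countable) set of preimages is unconditional. For integrable \<open>h\<close>
  it converges at almost every \<open>x\<close> when \<open>\<xi> f'\<close> is essentially bounded.
\<close>

definition transfer_op ::
  "real set set \<Rightarrow> (real \<Rightarrow> real) \<Rightarrow> (real \<Rightarrow> complex) \<Rightarrow> (real \<Rightarrow> complex) \<Rightarrow> real \<Rightarrow> complex" where
  "transfer_op P f \<xi> h x = (\<Sum>\<^sub>\<infinity>y\<in>{y \<in> \<Union>P. f y = x}. \<xi> y * h y)"

definition Holder_norm :: "real \<Rightarrow> (real \<Rightarrow> complex) \<Rightarrow> ennreal" where
  "Holder_norm \<alpha> \<phi> =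
     (SUP x\<in>{0..1}. ennreal (norm (\<phi> x))) +
     (SUP (x, y)\<in>{(x, y). x \<in> {0..1} \<and> y \<in> {0..1} \<and> x \<noteq> y}.
        ennreal (norm (\<phi> x - \<phi> y) / \<bar>x - y\<bar> powr \<alpha>))"

definition C1_on_01 :: "(real \<Rightarrow> complex) \<Rightarrow> (real \<Rightarrow> complex) \<Rightarrow> bool" where
  "C1_on_01 \<phi> \<phi>' \<longleftrightarrow>
     (\<forall>x\<in>{0..1}. (\<phi> has_vector_derivative \<phi>' x) (at x within {0..1})) \<and>
     continuous_on {0..1} \<phi>'"

definition B_norm :: "real \<Rightarrow> (real \<Rightarrow> complex) \<Rightarrow> ennreal" where
  "B_norm \<alpha> h =
     (SUP (\<phi>, \<phi>')\<in>{(\<phi>, \<phi>'). C1_on_01 \<phi> \<phi>' \<and> Holder_norm \<alpha> \<phi> \<le> 1}.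
        ennreal (norm (LINT x|leb01. h x * \<phi>' x)))"

text \<open>
  Elements of \<open>L\<^sup>1\<close> and of the spaces below are represented by functions; two functions represent
  the same element iff they are related by \<open>ae_eq\<close>, and all notions for operators are
  stated up to this relation.
\<close>

definition B_space :: "real \<Rightarrow> (real \<Rightarrow> complex) set" where
  "B_space \<alpha> = {h. integrable leb01 h \<and> B_norm \<alpha> h < \<infinity>}"

definition ae_eq :: "(real \<Rightarrow> complex) \<Rightarrow> (real \<Rightarrow> complex) \<Rightarrow> bool" where
  "ae_eq g h \<longleftrightarrow> (AE x in leb01. g x = h x)"

text \<open>
  Here \<open>X\<close> is a set of representatives closed under linear combinations, \<open>N\<close> a function whose
  values on \<open>X\<close> are those of a complete norm on \<open>X\<close> modulo \<open>ae_eq\<close>, and \<open>T\<close> is an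
  operator on representatives.
\<close>

type_synonym cfun = "real \<Rightarrow> complex"

definition bounded_operator_on ::
  "cfun set \<Rightarrow> (cfun \<Rightarrow> ennreal) \<Rightarrow> (cfun \<Rightarrow> cfun) \<Rightarrow> bool" where
  "bounded_operator_on X N T \<longleftrightarrow>
     (\<forall>h\<in>X. T h \<in> X) \<and>
     (\<forall>g\<in>X. \<forall>h\<in>X. ae_eq g h \<longrightarrow> ae_eq (T g) (T h)) \<and>
     (\<forall>g\<in>X. \<forall>h\<in>X. ae_eq (T (\<lambda>x. g x + h x)) (\<lambda>x. T g x + T h x)) \<and>
     (\<forall>c. \<forall>h\<in>X. ae_eq (T (\<lambda>x. c * h x)) (\<lambda>x. c * T h x)) \<and>
     (\<exists>C::real. \<forall>h\<in>X. N (T h) \<le> ennreal C * N h)"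

definition shifted :: "(cfun \<Rightarrow> cfun) \<Rightarrow> complex \<Rightarrow> cfun \<Rightarrow> cfun" where
  "shifted T z h = (\<lambda>x. z * h x - T h x)"

definition spectrum_on ::
  "cfun set \<Rightarrow> (cfun \<Rightarrow> ennreal) \<Rightarrow> (cfun \<Rightarrow> cfun) \<Rightarrow> complex set" where
  "spectrum_on X N T =
     {z. \<not> (\<exists>S. bounded_operator_on X N S \<and>
               (\<forall>h\<in>X. ae_eq (S (shifted T z h)) h \<and> ae_eq (shifted T z (S h)) h))}"

definition finite_dim_mod_ae :: "cfun set \<Rightarrow> cfun set \<Rightarrow> bool" where
  "finite_dim_mod_ae X Y \<longleftrightarrow>
     (\<exists>F\<subseteq>X. finite F \<and> (\<forall>h\<in>Y. \<exists>c. ae_eq h (\<lambda>x. \<Sum>u\<in>F. c u * u x)))"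

definition finite_codim_mod_ae :: "cfun set \<Rightarrow> cfun set \<Rightarrow> bool" where
  "finite_codim_mod_ae X Y \<longleftrightarrow>
     (\<exists>F\<subseteq>X. finite F \<and>
        (\<forall>g\<in>X. \<exists>h\<in>Y. \<exists>c. ae_eq g (\<lambda>x. h x + (\<Sum>u\<in>F. c u * u x))))"

text \<open>
  Closedness of the range is not required separately: for a bounded operator on a Banach space it
  follows from finite codimension of the range.
\<close>

definition Fredholm_on :: "cfun set \<Rightarrow> (cfun \<Rightarrow> cfun) \<Rightarrow> bool" where
  "Fredholm_on X A \<longleftrightarrow>
     finite_dim_mod_ae X {h \<in> X. ae_eq (A h) (\<lambda>x. 0)} \<and>
     finite_codim_mod_ae X (A ` X)"

definition essential_spectrum_on :: "cfun set \<Rightarrow> (cfun \<Rightarrow> cfun) \<Rightarrow> complex set" where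
  "essential_spectrum_on X T = {z. \<not> Fredholm_on X (shifted T z)}"

text \<open>The suprema are taken in the extended nonnegative reals, so that an unbounded set has
  radius \<open>\<infinity>\<close> and the empty set has radius \<open>0\<close>.\<close>

definition spectral_radius_on ::
  "cfun set \<Rightarrow> (cfun \<Rightarrow> ennreal) \<Rightarrow> (cfun \<Rightarrow> cfun) \<Rightarrow> ennreal" where
  "spectral_radius_on X N T = (SUP z\<in>spectrum_on X N T. ennreal (norm z))"

definition essential_spectral_radius_on ::
  "cfun set \<Rightarrow> (cfun \<Rightarrow> cfun) \<Rightarrow> ennreal" where
  "essential_spectral_radius_on X T = (SUP z\<in>essential_spectrum_on X T. ennreal (norm z))"

end

theory Submission
  imports Defs
begin

text \<open>
  Everything is done on the dual side. For bounded Borel \<psi> one has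
  \<integral> (L h) \<psi> = \<integral> h (K \<psi>) with the weighted Koopman operator
  K \<psi> = \<xi> |f'| (\<psi> \<circ> f), in the text below \<open>Koopman\<close>. The norm of the space tests h against derivatives of
  \<alpha>-Hoelder functions, and a density argument (\<open>pairing\<close>) extends this to all bounded
  measurable \<psi> whose primitive is \<alpha>-Hoelder: if every integral of \<psi> over an interval of length l
  is at most H l^\<alpha>, then |\<integral> h \<psi>| \<le> 2 H ||h||. So the operator is controlled by
  the effect of K on the Hoelder constant H of primitives.

  Let \<psi> have constant H. On a segment I inside one branch, the integral of K \<psi> is, up to
  sign, the Young integral of \<xi> against (primitive of \<psi>) \<circ> f; it makes sense because
  \<alpha> + \<beta> > 1. If \<xi> is nearly constant on I relative to its size, the integral is at most
  (1 + small) H (sup |\<xi>| |f'|^\<alpha>) |I|^\<alpha>. Otherwise I is bisected until this is so; on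
  the resulting pieces \<xi> is of the order of its oscillation, hence |f'| \<le> M / |\<xi>| is
  bounded by a negative power of the length, and the integrability of |f'|^r, through the two
  lower bounds on \<alpha> and \<beta> that involve r, makes the sum over all pieces small with I
  (\<open>segment_bound\<close>). Summing over branches by Hoelder's inequality with exponent
  1 / (1 - \<alpha>), which is what the summability hypothesis is for, shows that K is bounded for
  these constants and that all but finitely many branches contribute arbitrarily little.

  Iterating, for every \<kappa> > Q = sup |\<xi>| |f'|^\<alpha> and every n there are finitely many
  disjoint intervals on each of which K^n \<psi> has constant \<kappa>^n H, while off them its
  constant is as small as desired (\<open>iterate_decomposition\<close>). Let E h replace h by its averages on these
  intervals and by 0 elsewhere; E has finite rank and is bounded from L^1. Subtracting averages
  makes the primitive of K^n \<psi> vanish at the ends of the intervals, so that the local bounds can be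
  glued at the cost of a factor 4 (\<open>averaging_Holder\<close>); with the factor 2 from the pairing,
  ||L^n (1 - E) h|| \<le> (8 \<kappa>^n + small) ||h|| (\<open>Lasota_Yorke_decomposition\<close>).

  The case n = 1 bounds the essential spectral radius by 8 Q: for |z| > 8 Q the operator
  z - L (1 - E) is invertible by a Neumann series and L E has finite rank. For the spectral radius
  let M be the essential supremum of |\<xi> f'|; then L has norm at most M on L^1, and Q may be
  replaced by M, as |f'| \<ge> 1. For large n the factor 8 is absorbed, so ||L^k|| grows no faster than
  \<rho>^k for every \<rho> > M (\<open>Transfer_power_growth\<close>), and z - L is inverted by a Neumann
  series whenever |z| > M.
\<close>

section \<open>Inequalities between powers\<close>

lemma weighted_am_gm:
  fixes x y m :: real
  assumes "0 \<le> x" "0 \<le> y" "0 < m" "m < 1"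
  shows "x powr (1 - m) * y powr m \<le> (1 - m) * x + m * y"
proof (cases "x = 0 \<or> y = 0")
  case False
  then show ?thesis using Youngs_inequality_0[of "1 - m" m x y] assms by simp
qed (use assms in auto)

text \<open>
  Hoelder's inequality for the exponents 1 / (1 - m) and 1 / m, obtained by applying the weighted
  AM-GM inequality to the summands after normalising both sums to 1.
\<close>

lemma sum_powr_Holder:
  fixes a b :: "'i \<Rightarrow> real"
  assumes "finite I" and a: "\<And>i. i \<in> I \<Longrightarrow> 0 \<le> a i" and b: "\<And>i. i \<in> I \<Longrightarrow> 0 \<le> b i"
    and m: "0 < m" "m < 1"
  shows "(\<Sum>i\<in>I. a i powr (1 - m) * b i powr m) \<le> (\<Sum>i\<in>I. a i) powr (1 - m) * (\<Sum>i\<in>I. b i) powr m"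
proof -
  define A B where "A = (\<Sum>i\<in>I. a i)" and "B = (\<Sum>i\<in>I. b i)"
  have AB: "A \<ge> 0" "B \<ge> 0" unfolding A_def B_def by (auto intro: sum_nonneg a b)
  show ?thesis
  proof (cases "A = 0 \<or> B = 0")
    case True
    have "a i powr (1 - m) * b i powr m = 0" if "i \<in> I" for i
      using True
    proof
      assume "A = 0"
      then have "a i = 0" using that assms(1) a unfolding A_def by (simp add: sum_nonneg_eq_0_iff)
      then show ?thesis by simp
    next
      assume "B = 0"
      then have "b i = 0" using that assms(1) b unfolding B_def by (simp add: sum_nonneg_eq_0_iff)
      then show ?thesis by simp
    qed
    then have "(\<Sum>i\<in>I. a i powr (1 - m) * b i powr m) = 0" by (intro sum.neutral) blast
    then show ?thesis by simp
  next
    case False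
    then have AB: "A > 0" "B > 0" using AB by auto
    have "(\<Sum>i\<in>I. a i powr (1 - m) * b i powr m)
        = A powr (1 - m) * B powr m * (\<Sum>i\<in>I. (a i / A) powr (1 - m) * (b i / B) powr m)"
      unfolding sum_distrib_left
      by (rule sum.cong) (use AB a b in \<open>auto simp: powr_divide field_simps\<close>)
    also have "\<dots> \<le> A powr (1 - m) * B powr m * (\<Sum>i\<in>I. (1 - m) * (a i / A) + m * (b i / B))"
      by (intro mult_left_mono sum_mono weighted_am_gm) (use AB a b m in auto)
    also have "(\<Sum>i\<in>I. (1 - m) * (a i / A) + m * (b i / B)) = (1 - m) * (A / A) + m * (B / B)"
      unfolding sum.distrib sum_distrib_left[symmetric] sum_divide_distrib[symmetric] A_def B_def ..
    also have "\<dots> = 1" using AB by simp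
    finally show ?thesis unfolding A_def B_def by simp
  qed
qed

lemma powr_Holder_2:
  fixes a b a' b' m :: real
  assumes "0 \<le> a" "0 \<le> b" "0 \<le> a'" "0 \<le> b'" and m: "0 < m" "m < 1"
  shows "a powr (1 - m) * b powr m + a' powr (1 - m) * b' powr m
    \<le> (a + a') powr (1 - m) * (b + b') powr m"
  using sum_powr_Holder[of "UNIV :: bool set" "\<lambda>i. if i then a else a'" "\<lambda>i. if i then b else b'" m]
    assms by (simp add: UNIV_bool algebra_simps)

text \<open>
  Hoelder's inequality with the harmless factor 2: from y \<le> \<tau> + \<tau>^(1-q) y^q one
  gets a bound with a free parameter \<tau>, which is chosen to balance the two terms.
\<close>

lemma integral_le_power_mean:
  fixes g :: "real \<Rightarrow> real"
  assumes g: "g integrable_on {a..b}" "(\<lambda>x. g x powr q) integrable_on {a..b}"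
    and pos: "\<And>x. x \<in> {a..b} \<Longrightarrow> 0 \<le> g x" and "a \<le> b" "1 \<le> q"
  shows "integral {a..b} g \<le> 2 * (b - a) powr (1 - 1 / q) * (integral {a..b} (\<lambda>x. g x powr q)) powr (1 / q)"
proof -
  define \<rho> where "\<rho> = integral {a..b} (\<lambda>x. g x powr q)"
  have \<rho>0: "\<rho> \<ge> 0" unfolding \<rho>_def by (intro integral_nonneg g) auto
  have pw: "y \<le> \<tau> + \<tau> powr (1 - q) * y powr q" if "\<tau> > 0" "y \<ge> 0" for y \<tau> :: real
  proof (cases "y \<le> \<tau>")
    case True then show ?thesis by (simp add: add_increasing2)
  next
    case False
    then have "y powr (1 - q) \<le> \<tau> powr (1 - q)"
      using that assms by (intro powr_mono2') auto
    then have "y powr (1 - q) * y powr q \<le> \<tau> powr (1 - q) * y powr q"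
      by (intro mult_right_mono) auto
    moreover have "y powr (1 - q) * y powr q = y" using False that by (simp add: powr_add[symmetric])
    ultimately show ?thesis using that by simp
  qed
  have key: "integral {a..b} g \<le> \<tau> * (b - a) + \<tau> powr (1 - q) * \<rho>" if "\<tau> > 0" for \<tau>
  proof -
    have "integral {a..b} g \<le> integral {a..b} (\<lambda>x. \<tau> + \<tau> powr (1 - q) * g x powr q)"
      by (intro integral_le g integrable_add integrable_on_mult_right integrable_const_ivl pw that pos)
    also have "\<dots> = \<tau> * (b - a) + \<tau> powr (1 - q) * \<rho>"
      unfolding \<rho>_def using assms
      by (subst integral_add) (auto intro!: g integrable_on_mult_right)
    finally show ?thesis .
  qed
  consider "b - a = 0" | "b - a > 0" "\<rho> = 0" | "b - a > 0" "\<rho> > 0" using \<rho>0 assms(4) by linarith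
  then show ?thesis
  proof cases
    case 1 then show ?thesis by simp
  next
    case 2
    have "integral {a..b} g \<le> 0"
    proof (rule field_le_epsilon)
      fix e :: real assume "e > 0"
      then show "integral {a..b} g \<le> 0 + e" using key[of "e / (b - a)"] 2 by simp
    qed
    then show ?thesis using 2 unfolding \<rho>_def by simp
  next
    case 3
    \<comment> \<open>the value for which both terms of the bound agree\<close>
    define \<tau> where "\<tau> = (\<rho> / (b - a)) powr (1 / q)"
    have t: "\<tau> > 0" using 3 by (simp add: \<tau>_def)
    have l: "(b - a) powr (1 - 1 / q) = (b - a) / (b - a) powr (1 / q)"
      using 3 by (simp add: powr_diff)
    have "\<tau> * (b - a) = (b - a) powr (1 - 1 / q) * \<rho> powr (1 / q)"
      unfolding \<tau>_def l using 3 by (simp add: powr_divide)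
    moreover have "\<tau> powr (1 - q) * \<rho> = (b - a) powr (1 - 1 / q) * \<rho> powr (1 / q)"
    proof -
      have "\<tau> powr (1 - q) = (\<rho> / (b - a)) powr (1 / q - 1)"
        unfolding \<tau>_def powr_powr using assms by (simp add: field_simps)
      also have "\<dots> = \<rho> powr (1 / q) * (b - a) powr (1 - 1 / q) / \<rho>"
        using 3 by (simp add: powr_divide powr_diff field_simps)
      finally show ?thesis using 3 by simp
    qed
    ultimately show ?thesis using key[OF t] unfolding \<rho>_def by simp
  qed
qed


text \<open>
  The geometric mean of two bounds on \<mu>: the share m R of the exponent \<alpha> is spent on the
  bound containing \<rho>, the rest on the one that is a pure power of the length l.
\<close>

lemma exponent_tradeoff_aux:
  fixes \<alpha> \<beta> l \<mu> \<rho> c R \<kappa> m :: real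
  assumes \<alpha>: "0 < \<alpha>" "\<alpha> < 1" and l: "0 < l" "l \<le> 1" and \<rho>: "0 < \<rho>" and \<mu>: "0 \<le> \<mu>" and c: "1 \<le> c" and R: "1 \<le> R"
    and m: "0 < m" "m * R \<le> \<alpha>"
    and 1: "\<mu> \<le> c * l powr (1 - \<beta>)"
    and 2: "\<mu> \<le> c * l powr \<kappa> * \<rho> powr (1 / R)"
    and ex: "1 - m \<le> \<beta> + (\<kappa> * (m * R) + (1 - \<beta>) * (\<alpha> - m * R))"
  shows "l powr \<beta> * \<mu> powr \<alpha> \<le> c * l powr (1 - m) * \<rho> powr m"
proof (cases "\<mu> = 0")
  case True
  then show ?thesis using c by simp
next
  case False
  then have \<mu>: "\<mu> > 0" using \<mu> by simp
  have "\<mu> powr \<alpha> = \<mu> powr (m * R) * \<mu> powr (\<alpha> - m * R)"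
    using \<mu> by (simp add: powr_add[symmetric])
  also have "\<dots> \<le> (c * l powr \<kappa> * \<rho> powr (1 / R)) powr (m * R) * (c * l powr (1 - \<beta>)) powr (\<alpha> - m * R)"
    by (intro mult_mono powr_mono2 1 2) (use \<mu> m R in auto)
  also have "\<dots> = c powr \<alpha> * l powr (\<kappa> * (m * R) + (1 - \<beta>) * (\<alpha> - m * R)) * \<rho> powr m"
  proof -
    have "c powr \<alpha> = c powr (m * R) * c powr (\<alpha> - m * R)"
      using c by (simp add: powr_add[symmetric])
    moreover have "(\<rho> powr (1 / R)) powr (m * R) = \<rho> powr m"
    proof -
      have "1 / R * (m * R) = m" using R by simp
      then show ?thesis by (simp only: powr_powr)
    qed
    ultimately show ?thesis
      using c l \<rho> by (simp add: powr_mult powr_powr powr_add)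
  qed
  also have "\<dots> \<le> c * l powr (\<kappa> * (m * R) + (1 - \<beta>) * (\<alpha> - m * R)) * \<rho> powr m"
  proof -
    have "c powr \<alpha> \<le> c powr 1" by (rule powr_mono) (use \<alpha> c in auto)
    then show ?thesis using c by (intro mult_right_mono) auto
  qed
  finally have "l powr \<beta> * \<mu> powr \<alpha>
      \<le> l powr \<beta> * (c * l powr (\<kappa> * (m * R) + (1 - \<beta>) * (\<alpha> - m * R)) * \<rho> powr m)"
    by (rule mult_left_mono) simp
  also have "\<dots> = c * l powr (\<beta> + (\<kappa> * (m * R) + (1 - \<beta>) * (\<alpha> - m * R))) * \<rho> powr m"
    using l by (simp add: powr_add)
  also have "\<dots> \<le> c * l powr (1 - m) * \<rho> powr m"
    by (intro mult_right_mono mult_left_mono powr_mono' ex) (use l c in auto)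
  finally show ?thesis .
qed

text \<open>
  The power of the r-mass that is gained in \<open>exponent_tradeoff\<close>. It must not exceed 1 - \<alpha>,
  so that Hoelder's inequality still leaves the power \<alpha> of the length, nor \<alpha> / max 1 r,
  which is all that the mass, raised to \<alpha>, can provide.
\<close>

definition gain_exponent :: "real \<Rightarrow> real \<Rightarrow> real" where
  "gain_exponent \<alpha> r = min (\<alpha> / max 1 r) (1 - \<alpha>)"

lemma gain_exponent_bounds:
  assumes "0 < \<alpha>" "\<alpha> < 1"
  shows "0 < gain_exponent \<alpha> r" "gain_exponent \<alpha> r \<le> 1 - \<alpha>" "gain_exponent \<alpha> r < 1"
  using assms unfolding gain_exponent_def by (auto simp: min_def)

text \<open>
  On a piece of length l where |f'| is at most c l^(-\<beta>), write \<mu> for the integral of |f'| and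
  \<rho> for that of |f'|^r. The Young estimate there is of size l^\<beta> \<mu>^\<alpha>. The right-hand side
  below is concave and homogeneous of degree 1 in (l, \<rho>), hence superadditive, which is what allows
  summation over pieces. Of the three conditions relating \<alpha>, \<beta>, r, each supplies enough powers
  of l in one case: \<beta> (r + 1) \<ge> 1 if the gain exponent is 1 - \<alpha>, the one with
  1 - \<beta> (1 - r) if it is \<alpha> with r \<le> 1, and \<alpha> + \<beta> > 1 if it is \<alpha> / r.
\<close>

lemma exponent_tradeoff:
  fixes \<alpha> \<beta> l \<mu> \<rho> c r :: real
  defines "m \<equiv> gain_exponent \<alpha> r"
  assumes \<alpha>: "0 < \<alpha>" "\<alpha> < 1" and \<beta>: "0 < \<beta>" "1 < \<alpha> + \<beta>"
    and \<beta>r: "1 \<le> \<beta> * (r + 1)" and \<alpha>r: "1 - \<beta> \<le> \<alpha> * (1 - \<beta> * (1 - r))"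
    and l: "0 < l" "l \<le> 1" and \<rho>: "0 < \<rho>" and \<mu>: "0 \<le> \<mu>" and c: "1 \<le> c"
    and 1: "\<mu> \<le> c * l powr (1 - \<beta>)"
    and 2: "r \<le> 1 \<Longrightarrow> \<mu> \<le> c powr (1 - r) * l powr (- \<beta> * (1 - r)) * \<rho>" and r0: "0 \<le> r"
    and 3: "1 \<le> r \<Longrightarrow> \<mu> \<le> 2 * l powr (1 - 1 / r) * \<rho> powr (1 / r)"
  shows "l powr \<beta> * \<mu> powr \<alpha> \<le> (2 * c) * l powr (1 - m) * \<rho> powr m"
proof -
  define R where "R = max 1 r"
  \<comment> \<open>the exponent of l in the bound on the mass that involves the r-mass, uniformly in both cases\<close>
  define \<kappa> where "\<kappa> = (if r \<le> 1 then - \<beta> * (1 - r) else 1 - 1 / r)"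
  have R: "1 \<le> R" by (simp add: R_def)
  have m0: "0 < m" unfolding m_def by (rule gain_exponent_bounds[OF \<alpha>])
  have mR: "m * R \<le> \<alpha>"
  proof -
    have "m \<le> \<alpha> / R" unfolding m_def gain_exponent_def R_def by simp
    then show ?thesis using R by (simp add: field_simps)
  qed
  have m1: "\<mu> \<le> 2 * c * l powr (1 - \<beta>)"
  proof -
    have "0 \<le> c * l powr (1 - \<beta>)" using c by simp
    then show ?thesis using 1 by linarith
  qed
  have m2: "\<mu> \<le> 2 * c * l powr \<kappa> * \<rho> powr (1 / R)"
  proof (cases "r \<le> 1")
    case True
    have "c powr (1 - r) \<le> c powr 1" by (rule powr_mono) (use r0 c in auto)
    then have cc: "c powr (1 - r) \<le> 2 * c" using c by simp
    have "\<mu> \<le> c powr (1 - r) * (l powr (- \<beta> * (1 - r)) * \<rho>)" using 2[OF True] by (simp add: mult_ac)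
    also have "\<dots> \<le> 2 * c * (l powr (- \<beta> * (1 - r)) * \<rho>)"
      by (rule mult_right_mono[OF cc]) (use \<rho> in simp)
    finally show ?thesis using True \<rho> by (simp add: R_def \<kappa>_def mult_ac)
  next
    case False
    have "\<mu> \<le> 2 * (l powr (1 - 1 / r) * \<rho> powr (1 / r))" using 3 False by simp
    also have "\<dots> \<le> 2 * c * (l powr (1 - 1 / r) * \<rho> powr (1 / r))"
      by (rule mult_right_mono) (use c in auto)
    finally show ?thesis using False by (simp add: R_def \<kappa>_def mult_ac)
  qed
  have b: "0 \<le> (1 - \<alpha>) * (\<beta> * (r + 1) - 1)" by (intro mult_nonneg_nonneg) (use \<alpha> \<beta>r in auto)
  have ex: "1 - m \<le> \<beta> + (\<kappa> * (m * R) + (1 - \<beta>) * (\<alpha> - m * R))"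
  proof (cases "\<alpha> / R \<le> 1 - \<alpha>")
    case True
    then have m: "m = \<alpha> / R" by (simp add: m_def gain_exponent_def R_def)
    show ?thesis
    proof (cases "r \<le> 1")
      case t: True
      have R1: "R = 1" using t by (simp add: R_def)
      show ?thesis using t \<alpha>r unfolding m \<kappa>_def R1 by (simp add: algebra_simps)
    next
      case f: False
      then show ?thesis using \<beta> unfolding m \<kappa>_def R_def by (simp add: algebra_simps max_def)
    qed
  next
    case False
    then have m: "m = 1 - \<alpha>" by (simp add: m_def gain_exponent_def R_def)
    show ?thesis
    proof (cases "r \<le> 1")
      case t: True
      have R1: "R = 1" using t by (simp add: R_def)
      show ?thesis using b t unfolding m \<kappa>_def R1 by (simp add: algebra_simps)
    next
      case f: False
      then have R1: "R = r" by (simp add: R_def)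
      have "(1 - 1 / r) * ((1 - \<alpha>) * r) = (r - 1) * (1 - \<alpha>)" using f by (simp add: field_simps)
      then show ?thesis using b f unfolding m \<kappa>_def R1 by (simp add: algebra_simps)
    qed
  qed
  show ?thesis
    by (rule exponent_tradeoff_aux[OF \<alpha> l \<rho> \<mu> _ R m0 mR m1 m2 ex]) (use c in simp)
qed

section \<open>Young integrals along a segment of a branch\<close>

text \<open>
  The sum of the geometric series of ratio 2^(1 - \<alpha> - \<beta>) that arises when an interval is
  bisected repeatedly.
\<close>

definition young_const :: "real \<Rightarrow> real \<Rightarrow> real" where
  "young_const \<alpha> \<beta> = 2 powr (- \<beta>) / (1 - 2 powr (1 - \<alpha> - \<beta>))"

text \<open>
  The constant of \<open>terminal_interval\<close>. The parameter A is the threshold at which \<xi> counts as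
  nearly constant: the oscillation C l^\<beta> is at most a fraction 1 / A of its size.
\<close>

definition bad_const :: "real \<Rightarrow> real \<Rightarrow> real \<Rightarrow> real \<Rightarrow> real \<Rightarrow> real" where
  "bad_const \<alpha> \<beta> A C M
     = (2 * (A + 1) + young_const \<alpha> \<beta>) * C * (2 * max 1 (M / ((A - 1) * C)))"

text \<open>
  One segment [a, b] of a branch, seen abstractly: D is |f'|, w is the weight \<xi>, and F is
  |f'| (\<psi> \<circ> f), so that the integral of F over a subsegment is the integral of \<psi> over its
  image, whose length is the integral of D. This explains the form of the bound on F.
\<close>

locale segment =
  fixes \<alpha> \<beta> r A C M h B a b :: real and D :: "real \<Rightarrow> real" and w F :: "real \<Rightarrow> complex"
  assumes \<alpha>: "0 < \<alpha>" "\<alpha> < 1" and \<beta>: "0 < \<beta>" "\<beta> \<le> 1" "1 < \<alpha> + \<beta>" and r: "0 \<le> r"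
    and \<beta>r: "1 \<le> \<beta> * (r + 1)" and \<alpha>r: "1 - \<beta> \<le> \<alpha> * (1 - \<beta> * (1 - r))"
    and A: "1 < A" and C: "0 < C" and M: "0 \<le> M" and h: "0 \<le> h" and B: "0 \<le> B"
    and ab: "a \<le> b" "b - a \<le> 1"
    and D_cont: "continuous_on {a..b} D" and D1: "\<And>x. x \<in> {a..b} \<Longrightarrow> 1 \<le> D x"
    and D_mass: "integral {a..b} D \<le> 1"
    and w_Holder: "\<And>x y. x \<in> {a..b} \<Longrightarrow> y \<in> {a..b} \<Longrightarrow> norm (w x - w y) \<le> C * \<bar>x - y\<bar> powr \<beta>"
    and wD: "\<And>x. x \<in> {a..b} \<Longrightarrow> norm (w x) * D x \<le> M"
    and F_int: "F integrable_on {a..b}" and wF_int: "(\<lambda>x. w x * F x) integrable_on {a..b}"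
    and F_bound: "\<And>x. x \<in> {a..b} \<Longrightarrow> norm (F x) \<le> B * D x"
    and F_Holder: "\<And>s t. a \<le> s \<Longrightarrow> s \<le> t \<Longrightarrow> t \<le> b \<Longrightarrow>
       norm (integral {s..t} F) \<le> h * integral {s..t} D powr \<alpha>"
begin

abbreviation "mass s t \<equiv> integral {s..t} D"
abbreviation "rmass s t \<equiv> integral {s..t} (\<lambda>x. D x powr r)"
abbreviation "wint s t \<equiv> integral {s..t} (\<lambda>x. w x * F x)"

lemma sub: "a \<le> s \<Longrightarrow> t \<le> b \<Longrightarrow> {s..t} \<subseteq> {a..b}" by auto

lemma D_int: "a \<le> s \<Longrightarrow> t \<le> b \<Longrightarrow> D integrable_on {s..t}"
  by (intro integrable_continuous_interval continuous_on_subset[OF D_cont] sub)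

lemma Dr_int: "a \<le> s \<Longrightarrow> t \<le> b \<Longrightarrow> (\<lambda>x. D x powr r) integrable_on {s..t}"
proof (rule integrable_continuous_interval)
  assume "a \<le> s" "t \<le> b"
  then have "continuous_on {s..t} D" by (intro continuous_on_subset[OF D_cont sub])
  moreover have "D x \<noteq> 0" if "x \<in> {s..t}" for x
    using D1[of x] that \<open>a \<le> s\<close> \<open>t \<le> b\<close> by auto
  ultimately show "continuous_on {s..t} (\<lambda>x. D x powr r)" by (intro continuous_on_powr continuous_on_const) auto
qed

lemma F_int': "a \<le> s \<Longrightarrow> t \<le> b \<Longrightarrow> F integrable_on {s..t}"
  by (rule integrable_on_subinterval[OF F_int sub])

lemma wF_int': "a \<le> s \<Longrightarrow> t \<le> b \<Longrightarrow> (\<lambda>x. w x * F x) integrable_on {s..t}"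
  by (rule integrable_on_subinterval[OF wF_int sub])

lemma mass_ge: "a \<le> s \<Longrightarrow> s \<le> t \<Longrightarrow> t \<le> b \<Longrightarrow> t - s \<le> mass s t"
  using integral_le[of "\<lambda>_. 1" "{s..t}" D] D_int[of s t] D1 by auto

lemma mass_nonneg: "a \<le> s \<Longrightarrow> s \<le> t \<Longrightarrow> t \<le> b \<Longrightarrow> 0 \<le> mass s t"
  using mass_ge[of s t] by linarith

lemma mass_combine: "a \<le> s \<Longrightarrow> s \<le> u \<Longrightarrow> u \<le> t \<Longrightarrow> t \<le> b \<Longrightarrow> mass s u + mass u t = mass s t"
  by (rule Henstock_Kurzweil_Integration.integral_combine) (auto intro: D_int)

lemma rmass_combine: "a \<le> s \<Longrightarrow> s \<le> u \<Longrightarrow> u \<le> t \<Longrightarrow> t \<le> b \<Longrightarrow> rmass s u + rmass u t = rmass s t"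
  by (rule Henstock_Kurzweil_Integration.integral_combine) (auto intro: Dr_int)

lemma rmass_ge: "a \<le> s \<Longrightarrow> s \<le> t \<Longrightarrow> t \<le> b \<Longrightarrow> t - s \<le> rmass s t"
  using integral_le[of "\<lambda>_. 1" "{s..t}" "\<lambda>x. D x powr r"] Dr_int[of s t] D1 r by (auto simp: ge_one_powr_ge_zero)

lemma mass_le_1: "a \<le> s \<Longrightarrow> s \<le> t \<Longrightarrow> t \<le> b \<Longrightarrow> mass s t \<le> 1"
  using mass_combine[of a s b] mass_combine[of s t b] mass_nonneg[of a s] mass_nonneg[of t b] D_mass by simp

lemma wint_combine: "a \<le> s \<Longrightarrow> s \<le> u \<Longrightarrow> u \<le> t \<Longrightarrow> t \<le> b \<Longrightarrow> wint s u + wint u t = wint s t"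
  by (rule Henstock_Kurzweil_Integration.integral_combine) (auto intro: wF_int')

lemma F_combine: "a \<le> s \<Longrightarrow> s \<le> u \<Longrightarrow> u \<le> t \<Longrightarrow> t \<le> b \<Longrightarrow>
    integral {s..u} F + integral {u..t} F = integral {s..t} F"
  by (rule Henstock_Kurzweil_Integration.integral_combine) (auto intro: F_int')

lemma young_const_pos: "0 < young_const \<alpha> \<beta>"
proof -
  have "2 powr (1 - \<alpha> - \<beta>) < (2::real) powr 0" using \<beta> by (intro powr_less_mono) auto
  then show ?thesis unfolding young_const_def by simp
qed

text \<open>
  Bisecting an interval multiplies the error term by 2^(1 - \<alpha> - \<beta>) < 1 and adds one fixed
  contribution. Starting from a crude bound, n bisections leave the limit constant plus a
  geometrically small remainder.
\<close>

lemma young_aux: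
  assumes "a \<le> s" "s \<le> t" "t \<le> b"
  shows "norm (wint s t - w s * integral {s..t} F)
    \<le> (young_const \<alpha> \<beta> * C * h + (2 powr (1 - \<alpha> - \<beta>)) ^ n * C * B) * (t - s) powr \<beta> * mass s t powr \<alpha>"
  using assms
proof (induction n arbitrary: s t)
  case 0
  have i: "(\<lambda>x. w s * F x) integrable_on {s..t}"
    using F_int'[of s t] 0 by (intro integrable_on_mult_right) auto
  have "norm (wint s t - w s * integral {s..t} F) = norm (integral {s..t} (\<lambda>x. w x * F x - w s * F x))"
    using 0 i by (subst integral_diff) (auto intro: wF_int')
  also have "\<dots> \<le> integral {s..t} (\<lambda>x. (C * (t - s) powr \<beta> * B) * D x)"
  proof (rule integral_norm_bound_integral)
    show "(\<lambda>x. w x * F x - w s * F x) integrable_on {s..t}"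
      using 0 i by (intro integrable_diff) (auto intro: wF_int')
    show "(\<lambda>x. (C * (t - s) powr \<beta> * B) * D x) integrable_on {s..t}"
      using 0 by (intro integrable_on_mult_right D_int) auto
    fix x assume x: "x \<in> {s..t}"
    have "norm (w x * F x - w s * F x) = norm (w x - w s) * norm (F x)"
      by (simp add: left_diff_distrib[symmetric] norm_mult)
    also have "\<dots> \<le> (C * \<bar>x - s\<bar> powr \<beta>) * (B * D x)"
      by (intro mult_mono w_Holder F_bound) (use x 0 C in auto)
    also have "\<dots> \<le> (C * (t - s) powr \<beta>) * (B * D x)"
      using x 0 C B D1[of x] \<beta> by (intro mult_right_mono mult_left_mono powr_mono2) auto
    finally show "norm (w x * F x - w s * F x) \<le> (C * (t - s) powr \<beta> * B) * D x" by (simp add: mult_ac)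
  qed
  also have "\<dots> = C * B * (t - s) powr \<beta> * mass s t" by simp
  also have "\<dots> \<le> C * B * (t - s) powr \<beta> * mass s t powr \<alpha>"
  proof (rule mult_left_mono)
    have m: "0 \<le> mass s t" "mass s t \<le> 1" using mass_nonneg mass_le_1 0 by auto
    then show "mass s t \<le> mass s t powr \<alpha>" using \<alpha> powr_mono'[of \<alpha> 1 "mass s t"] by simp
  qed (use C B in auto)
  also have "\<dots> \<le> (young_const \<alpha> \<beta> * C * h + C * B) * (t - s) powr \<beta> * mass s t powr \<alpha>"
    by (intro mult_right_mono) (use young_const_pos C h in auto)
  finally show ?case by simp
next
  case (Suc n)
  define u where "u = (s + t) / 2"
  define T where "T = (2::real) powr (1 - \<alpha> - \<beta>)"
  define X where "X = young_const \<alpha> \<beta> * C * h + T ^ n * C * B"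
  have su: "s \<le> u" "u \<le> t" using Suc.prems by (auto simp: u_def)
  have l: "u - s = (t - s) / 2" "t - u = (t - s) / 2" by (auto simp: u_def field_simps)
  have X0: "0 \<le> X" unfolding X_def T_def using young_const_pos C h B by auto
  have T1: "T < 1" using \<beta> powr_less_mono[of "1 - \<alpha> - \<beta>" 0 "2::real"] by (simp add: T_def)
  have "wint s t - w s * integral {s..t} F
     = (wint s u - w s * integral {s..u} F) + (wint u t - w u * integral {u..t} F)
       + (w u - w s) * integral {u..t} F"
    using wint_combine[of s u t] F_combine[of s u t] su Suc.prems by (simp add: algebra_simps flip: distrib_left)
  then have "norm (wint s t - w s * integral {s..t} F)
     \<le> norm (wint s u - w s * integral {s..u} F) + norm (wint u t - w u * integral {u..t} F)
       + norm (w u - w s) * norm (integral {u..t} F)"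
    unfolding norm_mult[symmetric] by (simp only:) (intro norm_triangle_le add_right_mono norm_triangle_ineq order_refl)
  also have "\<dots> \<le> X * (u - s) powr \<beta> * mass s u powr \<alpha> + X * (t - u) powr \<beta> * mass u t powr \<alpha>
       + (C * \<bar>u - s\<bar> powr \<beta>) * (h * mass s t powr \<alpha>)"
  proof (intro add_mono mult_mono)
    show "norm (wint s u - w s * integral {s..u} F) \<le> X * (u - s) powr \<beta> * mass s u powr \<alpha>"
      unfolding X_def T_def by (rule Suc.IH) (use su Suc.prems in auto)
    show "norm (wint u t - w u * integral {u..t} F) \<le> X * (t - u) powr \<beta> * mass u t powr \<alpha>"
      unfolding X_def T_def by (rule Suc.IH) (use su Suc.prems in auto)
    show "norm (w u - w s) \<le> C * \<bar>u - s\<bar> powr \<beta>" by (rule w_Holder) (use su Suc.prems in auto)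
    have "norm (integral {u..t} F) \<le> h * mass u t powr \<alpha>" by (rule F_Holder) (use su Suc.prems in auto)
    also have "\<dots> \<le> h * mass s t powr \<alpha>"
      using mass_combine[of s u t] mass_nonneg[of s u] mass_nonneg[of u t] su Suc.prems h \<alpha>
      by (intro mult_left_mono powr_mono2) auto
    finally show "norm (integral {u..t} F) \<le> h * mass s t powr \<alpha>" .
  qed (use C in auto)
  also have "\<dots> = ((t - s) / 2) powr \<beta> * (X * (mass s u powr \<alpha> + mass u t powr \<alpha>) + C * h * mass s t powr \<alpha>)"
    using Suc.prems by (simp add: l algebra_simps)
  also have "\<dots> \<le> ((t - s) / 2) powr \<beta> * (X * (2 powr (1 - \<alpha>) * mass s t powr \<alpha>) + C * h * mass s t powr \<alpha>)"
  proof (intro mult_left_mono add_mono order_refl)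
    have "1 powr (1 - \<alpha>) * mass s u powr \<alpha> + 1 powr (1 - \<alpha>) * mass u t powr \<alpha>
        \<le> (1 + 1) powr (1 - \<alpha>) * (mass s u + mass u t) powr \<alpha>"
      by (rule powr_Holder_2) (use \<alpha> mass_nonneg su Suc.prems in auto)
    then show "mass s u powr \<alpha> + mass u t powr \<alpha> \<le> 2 powr (1 - \<alpha>) * mass s t powr \<alpha>"
      using mass_combine[of s u t] su Suc.prems by simp
  qed (use X0 C h in auto)
  also have "\<dots> = (X * (2 powr (- \<beta>) * 2 powr (1 - \<alpha>)) + C * h * 2 powr (- \<beta>)) * (t - s) powr \<beta> * mass s t powr \<alpha>"
    using Suc.prems by (simp add: powr_divide powr_minus algebra_simps divide_simps)
  also have "2 powr (- \<beta>) * 2 powr (1 - \<alpha>) = T" unfolding T_def by (simp add: powr_add[symmetric] algebra_simps)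
  also have "X * T + C * h * 2 powr (- \<beta>) = young_const \<alpha> \<beta> * C * h + T ^ Suc n * C * B"
  proof -
    have "young_const \<alpha> \<beta> * T + 2 powr (- \<beta>) = young_const \<alpha> \<beta>"
      using T1 unfolding young_const_def T_def[symmetric] by (simp add: field_simps)
    then have "C * h * (young_const \<alpha> \<beta> * T + 2 powr (- \<beta>)) = C * h * young_const \<alpha> \<beta>" by simp
    then show ?thesis unfolding X_def by (simp add: algebra_simps)
  qed
  finally show ?case unfolding T_def .
qed

text \<open>
  Young's estimate, with the variation of the primitive of F measured by the mass of D rather than
  by length, so that it stays useful where D is large.
\<close>

lemma young:
  assumes "a \<le> s" "s \<le> t" "t \<le> b"
  shows "norm (wint s t - w s * integral {s..t} F)
    \<le> young_const \<alpha> \<beta> * C * h * (t - s) powr \<beta> * mass s t powr \<alpha>"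
proof (rule LIMSEQ_le_const)
  have "2 powr (1 - \<alpha> - \<beta>) < (2::real) powr 0" using \<beta> by (intro powr_less_mono) auto
  then have "2 powr (1 - \<alpha> - \<beta>) < (1::real)" by simp
  then have "(\<lambda>n. (2 powr (1 - \<alpha> - \<beta>)) ^ n) \<longlonglongrightarrow> (0::real)" by (intro LIMSEQ_realpow_zero powr_ge_zero)
  then have "(\<lambda>n. (young_const \<alpha> \<beta> * C * h + (2 powr (1 - \<alpha> - \<beta>)) ^ n * C * B) * (t - s) powr \<beta> * mass s t powr \<alpha>)
     \<longlonglongrightarrow> (young_const \<alpha> \<beta> * C * h + 0 * C * B) * (t - s) powr \<beta> * mass s t powr \<alpha>"
    by (intro tendsto_mult tendsto_add tendsto_const)
  then show "(\<lambda>n. (young_const \<alpha> \<beta> * C * h + (2 powr (1 - \<alpha> - \<beta>)) ^ n * C * B) * (t - s) powr \<beta> * mass s t powr \<alpha>)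
     \<longlonglongrightarrow> young_const \<alpha> \<beta> * C * h * (t - s) powr \<beta> * mass s t powr \<alpha>" by simp
qed (use young_aux[OF assms] in blast)

lemma young_bound:
  assumes "a \<le> s" "s \<le> t" "t \<le> b"
  shows "norm (wint s t) \<le> h * (norm (w s) + young_const \<alpha> \<beta> * C * (t - s) powr \<beta>) * mass s t powr \<alpha>"
proof -
  have "norm (wint s t) \<le> norm (w s * integral {s..t} F) + norm (wint s t - w s * integral {s..t} F)"
    by (rule norm_triangle_sub)
  also have "\<dots> \<le> norm (w s) * (h * mass s t powr \<alpha>)
      + young_const \<alpha> \<beta> * C * h * (t - s) powr \<beta> * mass s t powr \<alpha>"
    unfolding norm_mult by (intro add_mono mult_left_mono F_Holder young assms) auto
  finally show ?thesis by (simp add: algebra_simps)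
qed

lemma w_variation:
  assumes "a \<le> s" "s \<le> t" "t \<le> b" "x \<in> {s..t}"
  shows "norm (w x) \<le> norm (w s) + C * (t - s) powr \<beta>" "norm (w s) - C * (t - s) powr \<beta> \<le> norm (w x)"
proof -
  have "norm (w x - w s) \<le> C * \<bar>x - s\<bar> powr \<beta>" by (rule w_Holder) (use assms in auto)
  also have "\<dots> \<le> C * (t - s) powr \<beta>" using assms C \<beta> by (intro mult_left_mono powr_mono2) auto
  finally have *: "norm (w x - w s) \<le> C * (t - s) powr \<beta>" .
  show "norm (w x) \<le> norm (w s) + C * (t - s) powr \<beta>" "norm (w s) - C * (t - s) powr \<beta> \<le> norm (w x)"
    using * norm_triangle_ineq2[of "w x" "w s"] norm_triangle_ineq2[of "w s" "w x"] norm_minus_commute[of "w x" "w s"]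
    by linarith+
qed

text \<open>
  If w oscillates by at most a fraction 1 / A of its size at s, then D^\<alpha> is at most
  Q / (|w s| (1 - 1 / A)) on the whole interval, and the Young error is a fraction of order 1 / A of the
  main term. As A grows the constant in front of Q tends to 1.
\<close>

lemma good_interval:
  assumes st: "a \<le> s" "s \<le> t" "t \<le> b" and good: "A * C * (t - s) powr \<beta> \<le> norm (w s)"
    and Q: "\<And>x. x \<in> {s..t} \<Longrightarrow> norm (w x) * D x powr \<alpha> \<le> Q"
  shows "norm (wint s t) \<le> h * ((1 + young_const \<alpha> \<beta> / A) / (1 - 1 / A) * Q * (t - s) powr \<alpha>)"
proof (cases "s = t")
  case True then show ?thesis by simp
next
  case False
  then have st': "s < t" using st by simp
  have ws: "0 < norm (w s)" using good A C st' by (smt (verit) mult_pos_pos powr_gt_zero)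
  have A': "0 < 1 - 1 / A" using A by simp
  define S where "S = Q / (norm (w s) * (1 - 1 / A))"
  have CA: "C * (t - s) powr \<beta> \<le> norm (w s) / A" using good A by (simp add: field_simps)
  have Q0: "0 \<le> Q" using Q[of s] st by (smt (verit) atLeastAtMost_iff mult_nonneg_nonneg norm_ge_zero powr_ge_zero)
  have S0: "0 \<le> S" unfolding S_def using Q0 ws A' by auto
  have DS: "D x \<le> S powr (1 / \<alpha>)" if x: "x \<in> {s..t}" for x
  proof -
    have "norm (w s) * (1 - 1 / A) \<le> norm (w x)"
      using w_variation(2)[OF st x] CA by (simp add: algebra_simps)
    then have "norm (w s) * (1 - 1 / A) * D x powr \<alpha> \<le> norm (w x) * D x powr \<alpha>"
      by (intro mult_right_mono) auto
    also have "\<dots> \<le> Q" by (rule Q[OF x])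
    finally have "D x powr \<alpha> * (norm (w s) * (1 - 1 / A)) \<le> Q" by (simp add: mult_ac)
    then have "D x powr \<alpha> \<le> S" unfolding S_def using mult_pos_pos[OF ws A'] by (simp only: pos_le_divide_eq)
    then have "(D x powr \<alpha>) powr (1 / \<alpha>) \<le> S powr (1 / \<alpha>)" using \<alpha> by (intro powr_mono2) auto
    moreover have "0 \<le> D x" using D1[of x] x st by auto
    ultimately show ?thesis using \<alpha> by (simp add: powr_powr)
  qed
  have "mass s t \<le> integral {s..t} (\<lambda>_. S powr (1 / \<alpha>))"
    by (intro integral_le D_int DS) (use st in auto)
  then have "mass s t \<le> (t - s) * S powr (1 / \<alpha>)" using st by simp
  then have "mass s t powr \<alpha> \<le> ((t - s) * S powr (1 / \<alpha>)) powr \<alpha>"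
    using \<alpha> mass_nonneg[OF st] by (intro powr_mono2) auto
  also have "\<dots> = (t - s) powr \<alpha> * S" using st' S0 \<alpha> by (simp add: powr_mult powr_powr)
  finally have mS: "mass s t powr \<alpha> \<le> (t - s) powr \<alpha> * S" .
  have "norm (wint s t) \<le> h * (norm (w s) + young_const \<alpha> \<beta> * C * (t - s) powr \<beta>) * mass s t powr \<alpha>"
    by (rule young_bound[OF st])
  also have "\<dots> \<le> h * (norm (w s) + young_const \<alpha> \<beta> * (norm (w s) / A)) * ((t - s) powr \<alpha> * S)"
  proof (rule mult_mono[OF mult_left_mono[OF add_left_mono] mS])
    show "young_const \<alpha> \<beta> * C * (t - s) powr \<beta> \<le> young_const \<alpha> \<beta> * (norm (w s) / A)"
      using mult_left_mono[OF CA, of "young_const \<alpha> \<beta>"] young_const_pos by (simp add: mult.assoc)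
  qed (use young_const_pos C h A in auto)
  also have "\<dots> = h * ((1 + young_const \<alpha> \<beta> / A) * (norm (w s) * S) * (t - s) powr \<alpha>)"
    by (simp add: algebra_simps)
  also have "norm (w s) * S = Q / (1 - 1 / A)" unfolding S_def using ws by (simp add: divide_simps)
  finally show ?thesis by (simp add: mult_ac)
qed

text \<open>
  An interval at which repeated bisection stops: w is nearly constant on it, but was not on the
  parent of twice the length. Hence |w| is comparable to l^\<beta>, and w D \<le> M turns this into
  D \<le> c l^(-\<beta>), the situation of \<open>exponent_tradeoff\<close>.
\<close>

lemma terminal_interval:
  assumes st: "a \<le> s" "s < t" "t \<le> b" and good: "A * C * (t - s) powr \<beta> \<le> norm (w s)"
    and small: "norm (w s) \<le> (A + 1) * C * (2 * (t - s)) powr \<beta>"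
  shows "norm (wint s t)
    \<le> h * (bad_const \<alpha> \<beta> A C M * (t - s) powr (1 - gain_exponent \<alpha> r) * rmass s t powr gain_exponent \<alpha> r)"
proof -
  define l where "l = t - s"
  define c where "c = max 1 (M / ((A - 1) * C))"
  have l: "0 < l" "l \<le> 1" using st ab by (auto simp: l_def)
  have c1: "1 \<le> c" by (simp add: c_def)
  have Dc: "D x \<le> c * l powr (- \<beta>)" if x: "x \<in> {s..t}" for x
  proof -
    have "norm (w s) - C * l powr \<beta> \<le> norm (w x)" unfolding l_def by (rule w_variation) (use st x in auto)
    then have "(A - 1) * C * l powr \<beta> \<le> norm (w x)" using good by (simp add: l_def algebra_simps)
    then have "(A - 1) * C * l powr \<beta> * D x \<le> norm (w x) * D x"
      using D1[of x] x st by (intro mult_right_mono) auto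
    also have "\<dots> \<le> M" by (rule wD) (use x st in auto)
    finally have "D x * ((A - 1) * C * l powr \<beta>) \<le> M" by (simp add: mult_ac)
    moreover have "0 < (A - 1) * C * l powr \<beta>" using A C l by simp
    ultimately have "D x \<le> M / ((A - 1) * C * l powr \<beta>)" by (simp add: pos_le_divide_eq)
    also have "\<dots> = M / ((A - 1) * C) * l powr (- \<beta>)" by (simp add: powr_minus divide_simps)
    also have "\<dots> \<le> c * l powr (- \<beta>)" by (intro mult_right_mono) (auto simp: c_def)
    finally show ?thesis .
  qed
  have st': "s \<le> t" using st by simp
  have mass1: "mass s t \<le> c * l powr (1 - \<beta>)"
  proof -
    have "mass s t \<le> integral {s..t} (\<lambda>_. c * l powr (- \<beta>))"
      by (intro integral_le D_int Dc) (use st in auto)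
    also have "\<dots> = c * (l powr (- \<beta>) * l powr 1)" using st l by (simp add: l_def mult_ac)
    also have "l powr (- \<beta>) * l powr 1 = l powr (1 - \<beta>)" unfolding powr_add[symmetric] by simp
    finally show ?thesis .
  qed
  have mass2: "mass s t \<le> c powr (1 - r) * l powr (- \<beta> * (1 - r)) * rmass s t" if r1: "r \<le> 1"
  proof -
    have "mass s t \<le> integral {s..t} (\<lambda>x. (c * l powr (- \<beta>)) powr (1 - r) * D x powr r)"
    proof (intro integral_le D_int integrable_on_mult_right Dr_int)
      fix x assume x: "x \<in> {s..t}"
      have D0: "0 < D x" using D1[of x] x st by auto
      have "D x = D x powr (1 - r) * D x powr r" using D0 by (simp add: powr_add[symmetric])
      also have "\<dots> \<le> (c * l powr (- \<beta>)) powr (1 - r) * D x powr r"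
        using Dc[OF x] D0 r1 by (intro mult_right_mono powr_mono2) auto
      finally show "D x \<le> (c * l powr (- \<beta>)) powr (1 - r) * D x powr r" .
    qed (use st in auto)
    also have "\<dots> = (c * l powr (- \<beta>)) powr (1 - r) * rmass s t" by simp
    also have "(c * l powr (- \<beta>)) powr (1 - r) = c powr (1 - r) * l powr (- \<beta> * (1 - r))"
      using c1 by (simp add: powr_mult powr_powr)
    finally show ?thesis .
  qed
  have mass3: "mass s t \<le> 2 * l powr (1 - 1 / r) * rmass s t powr (1 / r)" if r1: "1 \<le> r"
    unfolding l_def
    by (rule integral_le_power_mean[OF D_int Dr_int _ st' r1]) (use st D1 in \<open>auto intro: order_trans[OF zero_le_one]\<close>)
  have core: "l powr \<beta> * mass s t powr \<alpha>
      \<le> (2 * c) * l powr (1 - gain_exponent \<alpha> r) * rmass s t powr gain_exponent \<alpha> r"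
    by (rule exponent_tradeoff[OF \<alpha> \<beta>(1,3) \<beta>r \<alpha>r l _ _ c1 mass1 mass2 r mass3])
       (use rmass_ge[of s t] mass_nonneg[of s t] st in auto)
  have "norm (wint s t) \<le> h * (norm (w s) + young_const \<alpha> \<beta> * C * l powr \<beta>) * mass s t powr \<alpha>"
    unfolding l_def by (rule young_bound) (use st in auto)
  also have "\<dots> \<le> h * ((A + 1) * C * (2 * l powr \<beta>) + young_const \<alpha> \<beta> * C * l powr \<beta>) * mass s t powr \<alpha>"
  proof (intro mult_right_mono mult_left_mono add_mono order_refl)
    have "(2 * l) powr \<beta> \<le> 2 * l powr \<beta>"
      using l \<beta> powr_mono[of \<beta> 1 "2::real"] by (simp add: powr_mult)
    then have "(A + 1) * C * (2 * l) powr \<beta> \<le> (A + 1) * C * (2 * l powr \<beta>)"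
      using A C by (intro mult_left_mono) auto
    then show "norm (w s) \<le> (A + 1) * C * (2 * l powr \<beta>)" using small by (simp add: l_def)
  qed (use h C in auto)
  also have "\<dots> = h * ((2 * (A + 1) + young_const \<alpha> \<beta>) * C) * (l powr \<beta> * mass s t powr \<alpha>)"
    by (simp add: algebra_simps)
  also have "\<dots> \<le> h * ((2 * (A + 1) + young_const \<alpha> \<beta>) * C)
      * ((2 * c) * l powr (1 - gain_exponent \<alpha> r) * rmass s t powr gain_exponent \<alpha> r)"
    using h A C young_const_pos by (intro mult_left_mono core) auto
  finally show ?thesis unfolding bad_const_def c_def l_def by (simp add: mult_ac)
qed

lemma bad_const_nonneg: "0 \<le> bad_const \<alpha> \<beta> A C M"
  unfolding bad_const_def using young_const_pos C A by (intro mult_nonneg_nonneg) auto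

text \<open>
  Repeated bisection of an interval on which w is small compared with its oscillation. The bound for
  pieces where the process stops is superadditive; pieces that are still bad at depth n contribute
  at most (A + 1) C l^\<beta>, a bound for |w|, times B times their mass, in total O(2^(-\<beta> n)).
\<close>

lemma bad_interval_aux:
  assumes "a \<le> s" "s < t" "t \<le> b" "norm (w s) < A * C * (t - s) powr \<beta>"
  shows "norm (wint s t)
    \<le> h * (bad_const \<alpha> \<beta> A C M * (t - s) powr (1 - gain_exponent \<alpha> r) * rmass s t powr gain_exponent \<alpha> r)
      + (2 powr (- \<beta>)) ^ n * ((A + 1) * C * B) * (t - s) powr \<beta> * mass s t"
  using assms
proof (induction n arbitrary: s t)
  case 0
  have "norm (wint s t) \<le> integral {s..t} (\<lambda>x. ((A + 1) * C * (t - s) powr \<beta> * B) * D x)"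
  proof (rule integral_norm_bound_integral)
    show "(\<lambda>x. w x * F x) integrable_on {s..t}" using 0 by (intro wF_int') auto
    show "(\<lambda>x. ((A + 1) * C * (t - s) powr \<beta> * B) * D x) integrable_on {s..t}"
      using 0 by (intro integrable_on_mult_right D_int) auto
    fix x assume x: "x \<in> {s..t}"
    have "norm (w x) \<le> norm (w s) + C * (t - s) powr \<beta>" by (rule w_variation) (use 0 x in auto)
    also have "\<dots> \<le> (A + 1) * C * (t - s) powr \<beta>" using 0 by (simp add: algebra_simps)
    finally have "norm (w x) * norm (F x) \<le> ((A + 1) * C * (t - s) powr \<beta>) * (B * D x)"
      using F_bound[of x] x 0 A C by (intro mult_mono) auto
    then show "norm (w x * F x) \<le> ((A + 1) * C * (t - s) powr \<beta> * B) * D x" by (simp add: norm_mult mult_ac)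
  qed
  also have "\<dots> = 0 + ((A + 1) * C * B) * (t - s) powr \<beta> * mass s t" by simp
  also have "\<dots> \<le> h * (bad_const \<alpha> \<beta> A C M * (t - s) powr (1 - gain_exponent \<alpha> r) * rmass s t powr gain_exponent \<alpha> r)
      + ((A + 1) * C * B) * (t - s) powr \<beta> * mass s t"
    using h bad_const_nonneg by (intro add_right_mono) auto
  finally show ?case by simp
next
  case (Suc n)
  define m where "m = gain_exponent \<alpha> r"
  define u where "u = (s + t) / 2"
  define K where "K = bad_const \<alpha> \<beta> A C M"
  define R where "R = (2 powr (- \<beta>)) ^ n * ((A + 1) * C * B)"
  have su: "s < u" "u < t" using Suc.prems by (auto simp: u_def)
  have l: "u - s = (t - s) / 2" "t - u = (t - s) / 2" by (auto simp: u_def field_simps)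
  have m: "0 < m" "m < 1" unfolding m_def using gain_exponent_bounds[OF \<alpha>] by auto
  have K0: "0 \<le> K" using bad_const_nonneg by (simp add: K_def)
  have R0: "0 \<le> R" unfolding R_def using A C B by auto
  have small: "norm (w x) \<le> (A + 1) * C * (t - s) powr \<beta>" if "x \<in> {s..t}" for x
    using w_variation(1)[of s t x] Suc.prems that by (simp add: algebra_simps)
  have child: "norm (wint s' t') \<le> h * (K * (t' - s') powr (1 - m) * rmass s' t' powr m)
      + R * (t' - s') powr \<beta> * mass s' t'"
    if c: "s \<le> s'" "s' < t'" "t' \<le> t" "2 * (t' - s') = t - s" for s' t'
  proof (cases "A * C * (t' - s') powr \<beta> \<le> norm (w s')")
    case True
    have "norm (wint s' t') \<le> h * (K * (t' - s') powr (1 - m) * rmass s' t' powr m)"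
      unfolding K_def m_def
      by (rule terminal_interval) (use c Suc.prems True small[of s'] in auto)
    moreover have "0 \<le> R * (t' - s') powr \<beta> * mass s' t'"
      using R0 mass_nonneg[of s' t'] c Suc.prems by auto
    ultimately show ?thesis by linarith
  next
    case False
    then show ?thesis unfolding K_def m_def R_def by (intro Suc.IH) (use c Suc.prems in auto)
  qed
  have "norm (wint s t) \<le> norm (wint s u) + norm (wint u t)"
    using wint_combine[of s u t] su Suc.prems norm_triangle_ineq[of "wint s u" "wint u t"] by simp
  also have "\<dots> \<le> (h * (K * (u - s) powr (1 - m) * rmass s u powr m) + R * (u - s) powr \<beta> * mass s u)
      + (h * (K * (t - u) powr (1 - m) * rmass u t powr m) + R * (t - u) powr \<beta> * mass u t)"
    by (intro add_mono child) (use su l in auto)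
  also have "\<dots> = h * (K * ((u - s) powr (1 - m) * rmass s u powr m + (t - u) powr (1 - m) * rmass u t powr m))
      + R * ((t - s) / 2) powr \<beta> * (mass s u + mass u t)"
    unfolding l by (simp add: algebra_simps)
  also have "\<dots> \<le> h * (K * (((u - s) + (t - u)) powr (1 - m) * (rmass s u + rmass u t) powr m))
      + R * ((t - s) / 2) powr \<beta> * (mass s u + mass u t)"
    using su Suc.prems rmass_ge[of s u] rmass_ge[of u t] m h K0
    by (intro add_right_mono mult_left_mono powr_Holder_2) auto
  also have "rmass s u + rmass u t = rmass s t" using su Suc.prems by (intro rmass_combine) auto
  also have "mass s u + mass u t = mass s t" using su Suc.prems by (intro mass_combine) auto
  also have "(u - s) + (t - u) = t - s" by simp
  also have "R * ((t - s) / 2) powr \<beta> = (2 powr (- \<beta>)) ^ Suc n * ((A + 1) * C * B) * (t - s) powr \<beta>"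
    unfolding R_def using Suc.prems by (simp add: powr_divide powr_minus divide_simps)
  finally show ?case unfolding K_def m_def by (simp add: mult.assoc)
qed

text \<open>
  The main local estimate. The first term is the expected one; the second is small compared with
  (b - a)^\<alpha> when the interval is short, since the gain exponent is at most 1 - \<alpha> and the
  integral of D^r tends to 0.
\<close>

lemma segment_bound:
  assumes Q: "\<And>x. x \<in> {a..b} \<Longrightarrow> norm (w x) * D x powr \<alpha> \<le> Q"
  shows "norm (wint a b) \<le> h * ((1 + young_const \<alpha> \<beta> / A) / (1 - 1 / A) * Q * (b - a) powr \<alpha>
    + bad_const \<alpha> \<beta> A C M * (b - a) powr (1 - gain_exponent \<alpha> r) * rmass a b powr gain_exponent \<alpha> r)"
    (is "_ \<le> h * (?G + ?B)")
proof -
  have Q0: "0 \<le> Q" using Q[of a] ab by (smt (verit) atLeastAtMost_iff mult_nonneg_nonneg norm_ge_zero powr_ge_zero)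
  have G0: "0 \<le> ?G" using Q0 A young_const_pos by (intro mult_nonneg_nonneg divide_nonneg_nonneg add_nonneg_nonneg) auto
  have B0: "0 \<le> ?B" using bad_const_nonneg by auto
  consider "a = b" | "A * C * (b - a) powr \<beta> \<le> norm (w a)" | "a < b" "norm (w a) < A * C * (b - a) powr \<beta>"
    using ab by linarith
  then show ?thesis
  proof cases
    case 1 then show ?thesis by simp
  next
    case 2
    then have "norm (wint a b) \<le> h * ?G" by (intro good_interval) (use ab Q in auto)
    also have "\<dots> \<le> h * (?G + ?B)" using B0 h by (intro mult_left_mono) auto
    finally show ?thesis .
  next
    case 3
    have "2 powr (- \<beta>) < (1::real)" using \<beta> powr_less_mono[of "- \<beta>" 0 "2::real"] by simp
    then have "(\<lambda>n. (2 powr (- \<beta>)) ^ n) \<longlonglongrightarrow> (0::real)" by (intro LIMSEQ_realpow_zero powr_ge_zero)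
    then have "(\<lambda>n. h * ?B + (2 powr (- \<beta>)) ^ n * ((A + 1) * C * B) * (b - a) powr \<beta> * mass a b)
       \<longlonglongrightarrow> h * ?B + 0 * ((A + 1) * C * B) * (b - a) powr \<beta> * mass a b"
      by (intro tendsto_mult tendsto_add tendsto_const)
    then have "norm (wint a b) \<le> h * ?B + 0 * ((A + 1) * C * B) * (b - a) powr \<beta> * mass a b"
      by (rule LIMSEQ_le_const) (use bad_interval_aux[of a b] 3 in blast)
    also have "\<dots> \<le> h * (?G + ?B)" using mult_left_mono[OF _ h, of ?B "?G + ?B"] G0 by simp
    finally show ?thesis .
  qed
qed

end

section \<open>The norm and its pairing with bounded functions\<close>

text \<open>
  The primitive of \<psi> is \<alpha>-Hoelder with constant H along intervals contained in S; if S is a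
  union of disjoint open intervals, nothing is asserted across its gaps.
\<close>

definition primitive_Holder :: "real \<Rightarrow> real \<Rightarrow> real set \<Rightarrow> (real \<Rightarrow> complex) \<Rightarrow> bool" where
  "primitive_Holder \<alpha> H S \<psi> \<longleftrightarrow>
     (\<forall>u v. u \<le> v \<longrightarrow> {u..v} \<subseteq> S \<longrightarrow> norm (integral {u..v} \<psi>) \<le> H * (v - u) powr \<alpha>)"

definition bounded_borel :: "(real \<Rightarrow> complex) \<Rightarrow> bool" where
  "bounded_borel \<psi> \<longleftrightarrow> \<psi> \<in> borel_measurable borel \<and> (\<exists>B. \<forall>x. norm (\<psi> x) \<le> B)"

text \<open>
  Finite bounds of the norm as a real-valued relation, which also records integrability, so that no
  extended arithmetic is needed in estimates.
\<close>

definition bnorm_le :: "real \<Rightarrow> (real \<Rightarrow> complex) \<Rightarrow> real \<Rightarrow> bool" where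
  "bnorm_le \<alpha> h K \<longleftrightarrow> integrable leb01 h \<and> 0 \<le> K \<and>
     (\<forall>\<phi> \<phi>'. C1_on_01 \<phi> \<phi>' \<and> Holder_norm \<alpha> \<phi> \<le> 1 \<longrightarrow> norm (LINT x|leb01. h x * \<phi>' x) \<le> K)"

lemma bnorm_le_integrable: "bnorm_le \<alpha> h K \<Longrightarrow> integrable leb01 h"
  and bnorm_le_nonneg: "bnorm_le \<alpha> h K \<Longrightarrow> 0 \<le> K"
  and bnorm_le_test: "bnorm_le \<alpha> h K \<Longrightarrow> C1_on_01 \<phi> \<phi>' \<Longrightarrow> Holder_norm \<alpha> \<phi> \<le> 1
     \<Longrightarrow> norm (LINT x|leb01. h x * \<phi>' x) \<le> K"
  unfolding bnorm_le_def by blast+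

lemma bnorm_leI:
  assumes "integrable leb01 h" "0 \<le> K"
    and "\<And>\<phi> \<phi>'. C1_on_01 \<phi> \<phi>' \<Longrightarrow> Holder_norm \<alpha> \<phi> \<le> 1 \<Longrightarrow> norm (LINT x|leb01. h x * \<phi>' x) \<le> K"
  shows "bnorm_le \<alpha> h K"
  unfolding bnorm_le_def using assms by blast

lemma bnorm_le_iff: "bnorm_le \<alpha> h K \<longleftrightarrow> integrable leb01 h \<and> 0 \<le> K \<and> B_norm \<alpha> h \<le> ennreal K"
  unfolding bnorm_le_def B_norm_def SUP_le_iff by (auto simp: ennreal_le_iff)

lemma B_space_iff: "h \<in> B_space \<alpha> \<longleftrightarrow> (\<exists>K. bnorm_le \<alpha> h K)"
proof
  assume "h \<in> B_space \<alpha>"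
  then have "integrable leb01 h" "B_norm \<alpha> h < \<infinity>" by (auto simp: B_space_def)
  then have "bnorm_le \<alpha> h (enn2real (B_norm \<alpha> h))" by (auto simp: bnorm_le_iff)
  then show "\<exists>K. bnorm_le \<alpha> h K" by blast
next
  assume "\<exists>K. bnorm_le \<alpha> h K"
  then show "h \<in> B_space \<alpha>" by (auto simp: B_space_def bnorm_le_iff intro: le_less_trans)
qed

lemma bnorm_le_exact: "h \<in> B_space \<alpha> \<Longrightarrow> bnorm_le \<alpha> h (enn2real (B_norm \<alpha> h))"
  by (auto simp: bnorm_le_iff B_space_def)

lemma bnorm_le_mono: "bnorm_le \<alpha> h K \<Longrightarrow> K \<le> L \<Longrightarrow> bnorm_le \<alpha> h L"
  by (intro bnorm_leI) (auto dest: bnorm_le_integrable bnorm_le_nonneg bnorm_le_test intro: order_trans)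

lemma integrable_mult_bounded:
  assumes "integrable leb01 h" "\<psi> \<in> borel_measurable leb01" "\<And>x. x \<in> {0..1} \<Longrightarrow> norm (\<psi> x) \<le> B"
  shows "integrable leb01 (\<lambda>x. h x * (\<psi> x :: complex))"
proof (rule Bochner_Integration.integrable_bound)
  show "integrable leb01 (\<lambda>x. B * norm (h x))" using assms by auto
  show "(\<lambda>x. h x * \<psi> x) \<in> borel_measurable leb01" using assms by auto
  show "AE x in leb01. norm (h x * \<psi> x) \<le> norm (B * norm (h x))"
  proof (rule AE_I2)
    fix x assume "x \<in> space leb01"
    then have x: "x \<in> {0..1}" by simp
    have "norm (h x * \<psi> x) \<le> norm (h x) * B" unfolding norm_mult by (rule mult_left_mono) (use assms x in auto)
    also have "\<dots> \<le> norm (B * norm (h x))" by (simp add: mult.commute abs_mult mult_right_mono)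
    finally show "norm (h x * \<psi> x) \<le> norm (B * norm (h x))" .
  qed
qed

lemma C1_continuous: "C1_on_01 \<phi> \<phi>' \<Longrightarrow> continuous_on {0..1} \<phi>'"
  by (simp add: C1_on_01_def)

lemma C1_measurable: "C1_on_01 \<phi> \<phi>' \<Longrightarrow> \<phi>' \<in> borel_measurable leb01"
  by (rule continuous_imp_measurable_on_sets_lebesgue[OF C1_continuous]) auto

lemma C1_bounded:
  assumes "C1_on_01 \<phi> \<phi>'" obtains B where "0 \<le> B" "\<And>x. x \<in> {0..1} \<Longrightarrow> norm (\<phi>' x) \<le> B"
proof -
  have "compact (\<phi>' ` {0..1})" by (rule compact_continuous_image[OF C1_continuous[OF assms] compact_Icc])
  then have "bounded (\<phi>' ` {0..1})" by (rule compact_imp_bounded)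
  then obtain B where B: "\<forall>y\<in>\<phi>' ` {0..1}. norm y \<le> B" unfolding bounded_iff ..
  show ?thesis
  proof (rule that[of "max 0 B"])
    fix x :: real assume "x \<in> {0..1}"
    then have "norm (\<phi>' x) \<le> B" using B by blast
    then show "norm (\<phi>' x) \<le> max 0 B" by simp
  qed simp
qed

lemma C1_integrable:
  assumes "integrable leb01 h" "C1_on_01 \<phi> \<phi>'" shows "integrable leb01 (\<lambda>x. h x * \<phi>' x)"
proof -
  obtain B where "\<And>x. x \<in> {0..1} \<Longrightarrow> norm (\<phi>' x) \<le> B" using C1_bounded[OF assms(2)] by metis
  then show ?thesis by (rule integrable_mult_bounded[OF assms(1) C1_measurable[OF assms(2)]])
qed

lemma bnorm_le_add:
  assumes "bnorm_le \<alpha> g K" "bnorm_le \<alpha> h L" shows "bnorm_le \<alpha> (\<lambda>x. g x + h x) (K + L)"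
proof (rule bnorm_leI)
  show "integrable leb01 (\<lambda>x. g x + h x)"
    by (intro Bochner_Integration.integrable_add bnorm_le_integrable[OF assms(1)] bnorm_le_integrable[OF assms(2)])
  show "0 \<le> K + L" using assms[THEN bnorm_le_nonneg] by simp
  fix \<phi> \<phi>' assume a: "C1_on_01 \<phi> \<phi>'" "Holder_norm \<alpha> \<phi> \<le> 1"
  note i = assms[THEN bnorm_le_integrable, THEN C1_integrable, OF a(1)]
  have "(LINT x|leb01. (g x + h x) * \<phi>' x) = (LINT x|leb01. g x * \<phi>' x) + (LINT x|leb01. h x * \<phi>' x)"
    unfolding distrib_right by (rule Bochner_Integration.integral_add[OF i])
  also have "norm \<dots> \<le> K + L"
    by (intro norm_triangle_mono bnorm_le_test[OF assms(1) a] bnorm_le_test[OF assms(2) a])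
  finally show "norm (LINT x|leb01. (g x + h x) * \<phi>' x) \<le> K + L" .
qed

lemma bnorm_le_scale:
  assumes "bnorm_le \<alpha> h K" shows "bnorm_le \<alpha> (\<lambda>x. c * h x) (norm c * K)"
proof (rule bnorm_leI)
  show "integrable leb01 (\<lambda>x. c * h x)" using bnorm_le_integrable[OF assms] by simp
  show "0 \<le> norm c * K" using bnorm_le_nonneg[OF assms] by simp
  fix \<phi> \<phi>' assume a: "C1_on_01 \<phi> \<phi>'" "Holder_norm \<alpha> \<phi> \<le> 1"
  have "(LINT x|leb01. c * h x * \<phi>' x) = c * (LINT x|leb01. h x * \<phi>' x)"
    unfolding mult.assoc by simp
  then show "norm (LINT x|leb01. c * h x * \<phi>' x) \<le> norm c * K"
    using bnorm_le_test[OF assms a] by (simp add: norm_mult mult_left_mono)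
qed

lemma bnorm_le_diff:
  assumes "bnorm_le \<alpha> g K" "bnorm_le \<alpha> h L" shows "bnorm_le \<alpha> (\<lambda>x. g x - h x) (K + L)"
  using bnorm_le_add[OF assms(1) bnorm_le_scale[OF assms(2), of "-1"]] by simp

lemma bnorm_le_zero: "bnorm_le \<alpha> (\<lambda>x. 0) 0" by (simp add: bnorm_le_def)

lemma bnorm_le_sum:
  "finite I \<Longrightarrow> (\<And>i. i \<in> I \<Longrightarrow> bnorm_le \<alpha> (g i) (K i)) \<Longrightarrow> bnorm_le \<alpha> (\<lambda>x. \<Sum>i\<in>I. g i x) (\<Sum>i\<in>I. K i)"
  by (induction I rule: finite_induct) (auto intro: bnorm_le_zero bnorm_le_add)

lemma bnorm_le_ae:
  assumes "bnorm_le \<alpha> g K" "integrable leb01 h" "ae_eq g h" shows "bnorm_le \<alpha> h K"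
proof (rule bnorm_leI[OF assms(2) bnorm_le_nonneg[OF assms(1)]])
  fix \<phi> \<phi>' assume a: "C1_on_01 \<phi> \<phi>'" "Holder_norm \<alpha> \<phi> \<le> 1"
  have [measurable]: "\<phi>' \<in> borel_measurable leb01" "h \<in> borel_measurable leb01" "g \<in> borel_measurable leb01"
    using C1_measurable[OF a(1)] assms(2) bnorm_le_integrable[OF assms(1)] by auto
  have "(LINT x|leb01. h x * \<phi>' x) = (LINT x|leb01. g x * \<phi>' x)"
  proof (rule Bochner_Integration.integral_cong_AE)
    show "AE x in leb01. h x * \<phi>' x = g x * \<phi>' x" using assms(3) unfolding ae_eq_def by eventually_elim simp
  qed measurable
  then show "norm (LINT x|leb01. h x * \<phi>' x) \<le> K" using bnorm_le_test[OF assms(1) a] by simp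
qed

text \<open>
  The norm is lower semicontinuous under convergence in L^1, being a supremum of continuous
  functionals. This replaces completeness of the space in the Neumann series.
\<close>

lemma bnorm_le_L1_limit:
  assumes g: "\<And>n. bnorm_le \<alpha> (g n) K" and h: "integrable leb01 h"
    and lim: "(\<lambda>n. LINT x|leb01. norm (g n x - h x)) \<longlonglongrightarrow> 0"
  shows "bnorm_le \<alpha> h K"
proof (rule bnorm_leI[OF h bnorm_le_nonneg[OF g]])
  fix \<phi> \<phi>' assume a: "C1_on_01 \<phi> \<phi>'" "Holder_norm \<alpha> \<phi> \<le> 1"
  obtain B where B: "0 \<le> B" "\<And>x. x \<in> {0..1} \<Longrightarrow> norm (\<phi>' x) \<le> B" using C1_bounded[OF a(1)] by metis
  have gi: "integrable leb01 (g n)" for n by (rule bnorm_le_integrable[OF g])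
  have "norm (LINT x|leb01. h x * \<phi>' x) \<le> K + B * (LINT x|leb01. norm (g n x - h x))" for n
  proof -
    have i: "integrable leb01 (\<lambda>x. g n x * \<phi>' x)" "integrable leb01 (\<lambda>x. h x * \<phi>' x)"
      by (rule C1_integrable[OF gi a(1)]) (rule C1_integrable[OF h a(1)])
    have "norm ((LINT x|leb01. g n x * \<phi>' x) - (LINT x|leb01. h x * \<phi>' x))
       = norm (LINT x|leb01. g n x * \<phi>' x - h x * \<phi>' x)"
      by (simp only: Bochner_Integration.integral_diff[OF i])
    also have "\<dots> \<le> (LINT x|leb01. norm (g n x * \<phi>' x - h x * \<phi>' x))" by (rule integral_norm_bound)
    also have "\<dots> \<le> (LINT x|leb01. B * norm (g n x - h x))"
    proof (intro integral_mono)
      show "integrable leb01 (\<lambda>x. norm (g n x * \<phi>' x - h x * \<phi>' x))" using i by auto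
      show "integrable leb01 (\<lambda>x. B * norm (g n x - h x))" using gi h by auto
      fix x assume "x \<in> space leb01"
      then show "norm (g n x * \<phi>' x - h x * \<phi>' x) \<le> B * norm (g n x - h x)"
        unfolding left_diff_distrib[symmetric] norm_mult mult.commute[of B] using B(2)[of x] by (intro mult_left_mono) auto
    qed
    finally have "norm ((LINT x|leb01. g n x * \<phi>' x) - (LINT x|leb01. h x * \<phi>' x))
        \<le> B * (LINT x|leb01. norm (g n x - h x))" by simp
    moreover have "norm (LINT x|leb01. g n x * \<phi>' x) \<le> K" by (rule bnorm_le_test[OF g a])
    ultimately show ?thesis
      using norm_triangle_sub[of "LINT x|leb01. h x * \<phi>' x" "LINT x|leb01. g n x * \<phi>' x"]
      by (simp add: norm_minus_commute)
  qed
  moreover have "(\<lambda>n. K + B * (LINT x|leb01. norm (g n x - h x))) \<longlonglongrightarrow> K + B * 0"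
    by (intro tendsto_intros lim)
  ultimately show "norm (LINT x|leb01. h x * \<phi>' x) \<le> K"
    using LIMSEQ_le_const by fastforce
qed

lemma Holder_norm_le_1I:
  assumes "\<And>x. x \<in> {0..1} \<Longrightarrow> norm (\<phi> x) \<le> 1 / 2"
    and "\<And>x y. x \<in> {0..1} \<Longrightarrow> y \<in> {0..1} \<Longrightarrow> norm (\<phi> x - \<phi> y) \<le> 1 / 2 * \<bar>x - y\<bar> powr \<alpha>"
  shows "Holder_norm \<alpha> \<phi> \<le> 1"
proof -
  have "Holder_norm \<alpha> \<phi> \<le> ennreal (1 / 2) + ennreal (1 / 2)"
    unfolding Holder_norm_def
  proof (intro add_mono SUP_least)
    fix x :: real assume "x \<in> {0..1}"
    then show "ennreal (norm (\<phi> x)) \<le> ennreal (1 / 2)" using assms(1) by (intro ennreal_leI) auto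
  next
    fix z :: "real \<times> real" assume "z \<in> {(x, y). x \<in> {0..1} \<and> y \<in> {0..1} \<and> x \<noteq> y}"
    then obtain x y where z: "z = (x, y)" "x \<in> {0..1}" "y \<in> {0..1}" "x \<noteq> y" by auto
    then have "norm (\<phi> x - \<phi> y) / \<bar>x - y\<bar> powr \<alpha> \<le> 1 / 2"
      using assms(2)[of x y] by (simp add: divide_le_eq)
    then show "(case z of (x, y) \<Rightarrow> ennreal (norm (\<phi> x - \<phi> y) / \<bar>x - y\<bar> powr \<alpha>)) \<le> ennreal (1 / 2)"
      unfolding z by (simp only: prod.case) (rule ennreal_leI)
  qed
  also have "\<dots> = ennreal (1 / 2 + 1 / 2)" by (rule ennreal_plus[symmetric]) auto
  also have "\<dots> = 1" by simp
  finally show ?thesis .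
qed

lemma Holder_norm_le_1D:
  assumes "Holder_norm \<alpha> \<phi> \<le> 1" "x \<in> {0..1}" "y \<in> {0..1}"
  shows "norm (\<phi> x - \<phi> y) \<le> \<bar>x - y\<bar> powr \<alpha>"
proof (cases "x = y")
  case False
  have "ennreal (norm (\<phi> x - \<phi> y) / \<bar>x - y\<bar> powr \<alpha>)
     \<le> (SUP (x, y)\<in>{(x, y). x \<in> {0..1} \<and> y \<in> {0..1} \<and> x \<noteq> y}. ennreal (norm (\<phi> x - \<phi> y) / \<bar>x - y\<bar> powr \<alpha>))"
    by (rule SUP_upper2[of "(x, y)"]) (use assms False in auto)
  also have "\<dots> \<le> Holder_norm \<alpha> \<phi>" unfolding Holder_norm_def by simp
  also have "\<dots> \<le> 1" by fact
  finally show ?thesis using False by (simp add: divide_le_eq)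
qed auto

text \<open>
  The factor 2 arises because the test norm is the sum of the supremum and the Hoelder seminorm, both
  of which are at most s here.
\<close>

lemma C1_test_bound:
  assumes h: "bnorm_le \<alpha> h N" and C1: "C1_on_01 \<phi> \<phi>'" and s: "0 < s"
    and 1: "\<And>x. x \<in> {0..1} \<Longrightarrow> norm (\<phi> x) \<le> s"
    and 2: "\<And>x y. x \<in> {0..1} \<Longrightarrow> y \<in> {0..1} \<Longrightarrow> norm (\<phi> x - \<phi> y) \<le> s * \<bar>x - y\<bar> powr \<alpha>"
  shows "norm (LINT x|leb01. h x * \<phi>' x) \<le> 2 * s * N"
proof -
  define c where "c = complex_of_real (2 * s)"
  have c: "norm c = 2 * s" "c \<noteq> 0" using s by (auto simp: c_def)
  have "C1_on_01 (\<lambda>x. \<phi> x / c) (\<lambda>x. \<phi>' x / c)"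
    using C1 c unfolding C1_on_01_def by (auto intro!: has_vector_derivative_divide continuous_intros)
  moreover have "Holder_norm \<alpha> (\<lambda>x. \<phi> x / c) \<le> 1"
    by (rule Holder_norm_le_1I)
       (use 1 2 s in \<open>auto simp: norm_divide c diff_divide_distrib[symmetric] divide_le_eq mult.commute[of _ s]\<close>)
  ultimately have "norm (LINT x|leb01. h x * (\<phi>' x / c)) \<le> N" by (rule bnorm_le_test[OF h])
  also have "(LINT x|leb01. h x * (\<phi>' x / c)) = (LINT x|leb01. h x * \<phi>' x) / c" by simp
  finally show ?thesis using s by (simp add: norm_divide c divide_le_eq mult_ac)
qed


definition clip :: "real \<Rightarrow> complex \<Rightarrow> complex" where
  "clip B y = (B / max B (norm y)) *\<^sub>R y"

lemma clip_id: "0 < B \<Longrightarrow> norm y \<le> B \<Longrightarrow> clip B y = y" by (simp add: clip_def max_def)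

lemma norm_clip: "0 < B \<Longrightarrow> norm (clip B y) \<le> B"
  by (simp add: clip_def divide_le_eq max_def field_simps)

lemma continuous_on_clip: "0 < B \<Longrightarrow> continuous_on S (clip B)"
  unfolding clip_def by (intro continuous_intros) (auto simp: max_def)

lemma leb01_integral:
  fixes k :: "real \<Rightarrow> 'b::euclidean_space"
  assumes "integrable leb01 k"
  shows "0 \<le> u \<Longrightarrow> v \<le> 1 \<Longrightarrow> k integrable_on {u..v}" "integral {0..1} k = (LINT x|leb01. k x)"
proof -
  have *: "(k has_integral (LINT x|leb01. k x)) {0..1}"
    by (rule has_integral_integral_lebesgue_on[OF assms]) simp
  then show "integral {0..1} k = (LINT x|leb01. k x)" by (rule integral_unique)
  show "k integrable_on {u..v}" if "0 \<le> u" "v \<le> 1"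
    by (rule integrable_on_subinterval[OF has_integral_integrable[OF *]]) (use that in auto)
qed

lemma integrable_leb01_bounded:
  fixes \<psi> :: "real \<Rightarrow> 'b::{banach, second_countable_topology}"
  assumes "\<psi> \<in> borel_measurable leb01" "\<And>x. x \<in> {0..1} \<Longrightarrow> norm (\<psi> x) \<le> B"
  shows "integrable leb01 \<psi>"
proof -
  have "finite_measure leb01" by (rule finite_measure_lebesgue_on) simp
  then show ?thesis
    by (rule finite_measure.integrable_const_bound[where B=B]) (use assms in auto)
qed

text \<open>
  Lusin-type approximation; clipping keeps the bound without changing the limit.
\<close>

lemma continuous_approximation:
  assumes \<psi>: "\<psi> \<in> borel_measurable leb01" and B: "0 < B" "\<And>x. x \<in> {0..1} \<Longrightarrow> norm (\<psi> x) \<le> B"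
  obtains g :: "nat \<Rightarrow> real \<Rightarrow> complex" where "\<And>n. continuous_on UNIV (g n)" "\<And>n x. norm (g n x) \<le> B"
    "AE x in leb01. (\<lambda>n. g n x) \<longlonglongrightarrow> \<psi> x"
proof -
  have "\<psi> measurable_on {0..1}"
    using \<psi> by (simp add: measurable_on_iff_borel_measurable)
  then obtain N g where N: "negligible N" and g: "\<And>n. continuous_on UNIV (g n)"
    and lim: "\<And>x. x \<notin> N \<Longrightarrow> (\<lambda>n. g n x) \<longlonglongrightarrow> (if x \<in> {0..1} then \<psi> x else 0)"
    unfolding measurable_on_def by metis
  show thesis
  proof
    show "continuous_on UNIV (\<lambda>x. clip B (g n x))" for n
      by (rule continuous_on_compose2[OF continuous_on_clip[OF B(1), of UNIV] g]) auto
    show "norm (clip B (g n x)) \<le> B" for n x by (rule norm_clip[OF B(1)])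
    have "AE x in lebesgue. x \<notin> N" using N by (simp add: negligible_iff_null_sets AE_not_in)
    then have "AE x in leb01. x \<notin> N" by (auto simp: AE_restrict_space_iff elim: eventually_mono)
    moreover have "AE x in leb01. x \<in> {0..1}" by (rule AE_I2) simp
    ultimately show "AE x in leb01. (\<lambda>n. clip B (g n x)) \<longlonglongrightarrow> \<psi> x"
    proof eventually_elim
      case (elim x)
      have "(\<lambda>n. g n x) \<longlonglongrightarrow> \<psi> x" using lim[OF elim(1)] elim(2) by simp
      moreover have "isCont (clip B) (\<psi> x)"
        using continuous_on_clip[OF B(1), of UNIV] by (simp add: continuous_on_eq_continuous_at)
      ultimately have "(\<lambda>n. clip B (g n x)) \<longlonglongrightarrow> clip B (\<psi> x)"
        by (rule isCont_tendsto_compose[rotated])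
      then show ?case using clip_id[OF B(1) B(2)[OF elim(2)]] by simp
    qed
  qed
qed

text \<open>
  If continuous functions g n converge to \<psi> boundedly and almost everywhere, then g n - \<psi> tends
  to 0 in L^(1 / (1 - \<alpha>)), and by Hoelder's inequality the \<alpha>-Hoelder seminorm of the primitive
  of g n - \<psi> tends to 0. So the primitives of the g n are C^1 test functions of almost the same
  seminorm as that of \<psi>, while the integrals of h g n converge by dominated convergence.
\<close>

lemma pairing:
  assumes h: "bnorm_le \<alpha> h N" and \<alpha>: "0 < \<alpha>" "\<alpha> < 1" and H: "0 \<le> H"
    and \<psi>: "\<psi> \<in> borel_measurable leb01" and B: "0 < B" "\<And>x. x \<in> {0..1} \<Longrightarrow> norm (\<psi> x) \<le> B"
    and prim: "primitive_Holder \<alpha> H {0..1} \<psi>"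
  shows "norm (LINT x|leb01. h x * \<psi> x) \<le> 2 * H * N"
proof -
  obtain g where g: "\<And>n. continuous_on UNIV (g n)" "\<And>n x. norm (g n x) \<le> B"
    and lim: "AE x in leb01. (\<lambda>n. g n x) \<longlonglongrightarrow> \<psi> x"
    by (rule continuous_approximation[OF \<psi> B]) (assumption, rule that)
  define q where "q = 1 / (1 - \<alpha>)"
  have q: "1 < q" "1 - 1 / q = \<alpha>" "1 / q = 1 - \<alpha>" using \<alpha> by (auto simp: q_def)
  define d where "d n x = norm (g n x - \<psi> x)" for n x
  define \<delta> where "\<delta> n = (LINT x|leb01. d n x powr q)" for n
  have gm[measurable]: "g n \<in> borel_measurable leb01" for n
    by (rule continuous_imp_measurable_on_sets_lebesgue) (auto intro: continuous_on_subset[OF g(1)])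
  note \<psi>[measurable]
  have gi: "integrable leb01 (g n)" for n by (rule integrable_leb01_bounded[where B=B]) (use g in auto)
  have \<psi>i: "integrable leb01 \<psi>" by (rule integrable_leb01_bounded[where B=B]) (use B in auto)
  have dB: "0 \<le> d n x" "x \<in> {0..1} \<Longrightarrow> d n x \<le> 2 * B" for n x
    using norm_triangle_ineq4[of "g n x" "\<psi> x"] g(2)[of n x] B(2)[of x] by (auto simp: d_def)
  have di: "integrable leb01 (d n)" for n unfolding d_def using gi \<psi>i by auto
  have dqB: "d n x powr q \<le> (2 * B) powr q" if "x \<in> {0..1}" for n x
    by (rule powr_mono2) (use dB that q in auto)
  have dqi: "integrable leb01 (\<lambda>x. d n x powr q)" for n
  proof (rule integrable_leb01_bounded[where B="(2 * B) powr q"])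
    show "(\<lambda>x. d n x powr q) \<in> borel_measurable leb01" unfolding d_def by measurable
    show "norm (d n x powr q) \<le> (2 * B) powr q" if "x \<in> {0..1}" for x using dqB[OF that] by simp
  qed
  have "\<delta> \<longlonglongrightarrow> (LINT x|leb01. 0)" unfolding \<delta>_def
  proof (rule integral_dominated_convergence[where w="\<lambda>_. (2 * B) powr q"])
    show "(\<lambda>x. d n x powr q) \<in> borel_measurable leb01" for n unfolding d_def by measurable
    show "integrable leb01 (\<lambda>_. (2 * B) powr q)"
      by (rule integrable_leb01_bounded[where B="(2 * B) powr q"]) auto
    show "AE x in leb01. norm (d n x powr q) \<le> (2 * B) powr q" for n
      by (rule AE_I2) (use dqB in auto)
    show "AE x in leb01. (\<lambda>n. d n x powr q) \<longlonglongrightarrow> 0" using lim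
    proof eventually_elim
      case (elim x)
      then have "(\<lambda>n. d n x) \<longlonglongrightarrow> 0" unfolding d_def by (intro tendsto_norm_zero LIM_zero)
      then show ?case by (rule tendsto_zero_powrI) (use dB q in \<open>auto intro: tendsto_const\<close>)
    qed
  qed auto
  then have \<delta>0: "\<delta> \<longlonglongrightarrow> 0" by simp
  have \<delta>nn: "0 \<le> \<delta> n" for n unfolding \<delta>_def by simp
  \<comment> \<open>the last summand only ensures positivity, as needed for rescaling test functions\<close>
  define s where "s n = H + 2 * \<delta> n powr (1 - \<alpha>) + 1 / real (Suc n)" for n
  have s0: "0 < s n" for n unfolding s_def using H by (simp add: add_nonneg_pos)
  define \<Phi> where "\<Phi> n x = integral {0..x} (g n)" for n x
  have gint: "g n integrable_on {u..v}" for n u v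
    by (intro integrable_continuous_interval continuous_on_subset[OF g(1)]) auto
  have Hol: "norm (integral {u..v} (g n)) \<le> s n * (v - u) powr \<alpha>" if uv: "0 \<le> u" "u \<le> v" "v \<le> 1" for n u v
  proof -
    have \<psi>int: "\<psi> integrable_on {u..v}" and dint: "d n integrable_on {u..v}"
      and dqint: "(\<lambda>x. d n x powr q) integrable_on {u..v}"
      using leb01_integral(1)[OF \<psi>i] leb01_integral(1)[OF di] leb01_integral(1)[OF dqi] uv by auto
    have "norm (integral {u..v} (\<lambda>x. g n x - \<psi> x)) \<le> integral {u..v} (d n)"
      by (rule integral_norm_bound_integral[OF integrable_diff[OF gint \<psi>int] dint]) (simp add: d_def)
    also have "\<dots> \<le> 2 * (v - u) powr (1 - 1 / q) * (integral {u..v} (\<lambda>x. d n x powr q)) powr (1 / q)"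
      by (rule integral_le_power_mean[OF dint dqint]) (use dB uv q in auto)
    also have "\<dots> \<le> 2 * (v - u) powr (1 - 1 / q) * \<delta> n powr (1 / q)"
    proof (intro mult_left_mono powr_mono2)
      have "integral {u..v} (\<lambda>x. d n x powr q) \<le> integral {0..1} (\<lambda>x. d n x powr q)"
        by (rule integral_subset_le) (use uv dqint leb01_integral(1)[OF dqi] in auto)
      then show "integral {u..v} (\<lambda>x. d n x powr q) \<le> \<delta> n" by (simp add: \<delta>_def leb01_integral(2)[OF dqi])
      show "0 \<le> integral {u..v} (\<lambda>x. d n x powr q)" by (rule Henstock_Kurzweil_Integration.integral_nonneg[OF dqint]) simp
    qed (use q \<alpha> in auto)
    finally have 1: "norm (integral {u..v} (\<lambda>x. g n x - \<psi> x)) \<le> 2 * \<delta> n powr (1 - \<alpha>) * (v - u) powr \<alpha>"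
      unfolding q by (simp add: mult_ac)
    have 2: "norm (integral {u..v} \<psi>) \<le> H * (v - u) powr \<alpha>"
      using prim uv unfolding primitive_Holder_def by auto
    have "integral {u..v} (g n) = integral {u..v} (\<lambda>x. g n x - \<psi> x) + integral {u..v} \<psi>"
      using Henstock_Kurzweil_Integration.integral_diff[OF gint \<psi>int] by simp
    then have "norm (integral {u..v} (g n)) \<le> 2 * \<delta> n powr (1 - \<alpha>) * (v - u) powr \<alpha> + H * (v - u) powr \<alpha>"
      using norm_triangle_mono[OF 1 2] by simp
    also have "\<dots> \<le> s n * (v - u) powr \<alpha>" unfolding s_def by (simp add: algebra_simps)
    finally show ?thesis .
  qed
  have bound: "norm (LINT x|leb01. h x * g n x) \<le> 2 * s n * N" for n
  proof (rule C1_test_bound[OF h _ s0])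
    show "C1_on_01 (\<Phi> n) (g n)" unfolding C1_on_01_def \<Phi>_def
      by (intro conjI ballI integral_has_vector_derivative continuous_on_subset[OF g(1)]) auto
    show "norm (\<Phi> n x) \<le> s n" if "x \<in> {0..1}" for x
    proof -
      have "norm (\<Phi> n x) \<le> s n * (x - 0) powr \<alpha>" unfolding \<Phi>_def by (rule Hol) (use that in auto)
      also have "\<dots> \<le> s n * 1" using that \<alpha> s0[of n] by (intro mult_left_mono) (auto simp: powr_le1)
      finally show ?thesis by simp
    qed
    have *: "norm (\<Phi> n y - \<Phi> n x) \<le> s n * (y - x) powr \<alpha>" if "0 \<le> x" "x \<le> y" "y \<le> 1" for x y
    proof -
      have "\<Phi> n x + integral {x..y} (g n) = \<Phi> n y" unfolding \<Phi>_def
        by (rule Henstock_Kurzweil_Integration.integral_combine) (use that gint in auto)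
      then have "\<Phi> n y - \<Phi> n x = integral {x..y} (g n)" by (simp add: algebra_simps)
      then show ?thesis using Hol[OF that] by simp
    qed
    show "norm (\<Phi> n x - \<Phi> n y) \<le> s n * \<bar>x - y\<bar> powr \<alpha>" if "x \<in> {0..1}" "y \<in> {0..1}" for x y
      using *[of x y] *[of y x] that by (cases "x \<le> y") (auto simp: norm_minus_commute abs_if)
  qed
  have hi: "integrable leb01 h" by (rule bnorm_le_integrable[OF h])
  have "(\<lambda>n. LINT x|leb01. h x * g n x) \<longlonglongrightarrow> (LINT x|leb01. h x * \<psi> x)"
  proof (rule integral_dominated_convergence[where w="\<lambda>x. norm (h x) * B"])
    show "AE x in leb01. (\<lambda>n. h x * g n x) \<longlonglongrightarrow> h x * \<psi> x"
      using lim by eventually_elim (intro tendsto_intros)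
    show "AE x in leb01. norm (h x * g n x) \<le> norm (h x) * B" for n
      unfolding norm_mult by (intro AE_I2 mult_left_mono g) auto
  qed (use hi in auto)
  then have "(\<lambda>n. norm (LINT x|leb01. h x * g n x)) \<longlonglongrightarrow> norm (LINT x|leb01. h x * \<psi> x)"
    by (rule tendsto_norm)
  moreover have "(\<lambda>n. 2 * s n * N) \<longlonglongrightarrow> 2 * (H + 2 * 0 + 0) * N"
    unfolding s_def
    by (intro tendsto_mult tendsto_add tendsto_const tendsto_zero_powrI[OF \<delta>0 tendsto_const] LIMSEQ_Suc[OF lim_1_over_n])
       (use \<delta>nn \<alpha> in auto)
  ultimately show ?thesis using LIMSEQ_le bound by fastforce
qed

text \<open>
  Pair h with its conjugate sign: the primitive of a function bounded by 1 is Lipschitz, hence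
  \<alpha>-Hoelder on the unit interval, with constant 1.
\<close>

lemma L1_le_bnorm:
  assumes h: "bnorm_le \<alpha> h N" and \<alpha>: "0 < \<alpha>" "\<alpha> < 1"
  shows "(LINT x|leb01. norm (h x)) \<le> 2 * N"
proof -
  define \<psi> where "\<psi> x = cnj (h x) / of_real (norm (h x))" for x
  have hi: "integrable leb01 h" by (rule bnorm_le_integrable[OF h])
  have b: "norm (\<psi> x) \<le> 1" for x by (simp add: \<psi>_def norm_divide)
  have hm[measurable]: "h \<in> borel_measurable leb01" using hi by auto
  have cnj[measurable]: "cnj \<in> borel_measurable borel" by (intro borel_measurable_continuous_onI continuous_intros)
  have m: "\<psi> \<in> borel_measurable leb01" unfolding \<psi>_def by measurable
  have i: "integrable leb01 \<psi>" by (rule integrable_leb01_bounded[OF m, of 1]) (rule b)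
  have "primitive_Holder \<alpha> 1 {0..1} \<psi>" unfolding primitive_Holder_def
  proof (intro allI impI)
    fix u v :: real assume uv: "u \<le> v" "{u..v} \<subseteq> {0..1}"
    then have uv': "0 \<le> u" "v \<le> 1" by auto
    have "norm (integral {u..v} \<psi>) \<le> integral {u..v} (\<lambda>_. 1 :: real)"
      by (rule integral_norm_bound_integral) (use leb01_integral(1)[OF i] uv' b in auto)
    also have "\<dots> \<le> (v - u) powr 1" using uv by simp
    also have "\<dots> \<le> (v - u) powr \<alpha>" by (rule powr_mono') (use uv uv' \<alpha> in auto)
    finally show "norm (integral {u..v} \<psi>) \<le> 1 * (v - u) powr \<alpha>" by simp
  qed
  then have "norm (LINT x|leb01. h x * \<psi> x) \<le> 2 * 1 * N"
    by (intro pairing[OF h \<alpha> _ m, of _ 1]) (use b in auto)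
  also have "(\<lambda>x. h x * \<psi> x) = (\<lambda>x. complex_of_real (norm (h x)))"
  proof
    fix x show "h x * \<psi> x = complex_of_real (norm (h x))"
      using complex_norm_square[of "h x"] by (cases "h x = 0") (auto simp: \<psi>_def power2_eq_square divide_eq_eq)
  qed
  finally show ?thesis by simp
qed

section \<open>Hoelder bounds for primitives\<close>

lemma primitive_Holder_subset: "primitive_Holder \<alpha> H S \<psi> \<Longrightarrow> T \<subseteq> S \<Longrightarrow> primitive_Holder \<alpha> H T \<psi>"
  unfolding primitive_Holder_def by blast

lemma primitive_HolderD: "primitive_Holder \<alpha> H S \<psi> \<Longrightarrow> u \<le> v \<Longrightarrow> {u..v} \<subseteq> S \<Longrightarrow>
    norm (integral {u..v} \<psi>) \<le> H * (v - u) powr \<alpha>"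
  unfolding primitive_Holder_def by blast

lemma primitive_HolderI: "(\<And>u v. u \<le> v \<Longrightarrow> {u..v} \<subseteq> S \<Longrightarrow> norm (integral {u..v} \<psi>) \<le> H * (v - u) powr \<alpha>)
    \<Longrightarrow> primitive_Holder \<alpha> H S \<psi>"
  unfolding primitive_Holder_def by blast

lemma primitive_Holder_mono:
  assumes "primitive_Holder \<alpha> H S \<psi>" "H \<le> K" shows "primitive_Holder \<alpha> K S \<psi>"
proof (rule primitive_HolderI)
  fix u v :: real assume uv: "u \<le> v" "{u..v} \<subseteq> S"
  show "norm (integral {u..v} \<psi>) \<le> K * (v - u) powr \<alpha>"
    using primitive_HolderD[OF assms(1) uv] mult_right_mono[OF assms(2), of "(v - u) powr \<alpha>"] by simp
qed

lemma bounded_borel_measurable: "bounded_borel \<psi> \<Longrightarrow> \<psi> \<in> borel_measurable borel"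
  by (simp add: bounded_borel_def)

lemma bounded_borel_bound:
  assumes "bounded_borel \<psi>" obtains B where "0 < B" "\<And>x. norm (\<psi> x) \<le> B"
proof -
  obtain B where "\<And>x. norm (\<psi> x) \<le> B" using assms unfolding bounded_borel_def by blast
  then have "norm (\<psi> x) \<le> max 1 B" for x by (simp add: max.coboundedI2)
  then show thesis by (intro that[of "max 1 B"]) auto
qed

lemma bounded_borel_leb01: "bounded_borel \<psi> \<Longrightarrow> \<psi> \<in> borel_measurable leb01"
proof -
  assume "bounded_borel \<psi>"
  then have "\<psi> \<in> borel_measurable lborel" by (simp add: bounded_borel_measurable)
  then have "\<psi> \<in> borel_measurable lebesgue" by (rule measurable_completion)
  then show ?thesis by (rule measurable_restrict_space1)
qed

lemma bounded_borel_absolutely_integrable: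
  assumes "bounded_borel \<psi>" shows "\<psi> absolutely_integrable_on {u..v}"
proof -
  obtain B where B: "0 < B" "\<And>x. norm (\<psi> x) \<le> B" by (rule bounded_borel_bound[OF assms]) (rule that)
  have "\<psi> \<in> borel_measurable lborel" using assms by (simp add: bounded_borel_measurable)
  then have "\<psi> \<in> borel_measurable (lebesgue_on {u..v})"
    by (intro measurable_restrict_space1 measurable_completion)
  then show ?thesis
    by (rule measurable_bounded_by_integrable_imp_absolutely_integrable[where g="\<lambda>_. B"]) (use B in auto)
qed

lemma bounded_borel_integrable: "bounded_borel \<psi> \<Longrightarrow> \<psi> integrable_on {u..v}"
  by (rule set_lebesgue_integral_eq_integral(1)[OF bounded_borel_absolutely_integrable])

lemma bounded_borel_add: "bounded_borel \<psi> \<Longrightarrow> bounded_borel \<phi> \<Longrightarrow> bounded_borel (\<lambda>x. \<psi> x + \<phi> x)"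
  unfolding bounded_borel_def by (metis borel_measurable_add norm_triangle_mono)

lemma bounded_borel_restrict:
  assumes "bounded_borel \<psi>" "S \<in> sets borel" shows "bounded_borel (\<lambda>x. if x \<in> S then \<psi> x else 0)"
proof -
  obtain B where B: "0 < B" "\<And>x. norm (\<psi> x) \<le> B" by (rule bounded_borel_bound[OF assms(1)]) (rule that)
  have [measurable]: "\<psi> \<in> borel_measurable borel" "S \<in> sets borel" using assms by (auto simp: bounded_borel_measurable)
  have "norm (if x \<in> S then \<psi> x else 0) \<le> B" for x using B by auto
  then have "\<exists>B. \<forall>x. norm (if x \<in> S then \<psi> x else 0) \<le> B" by blast
  moreover have "(\<lambda>x. if x \<in> S then \<psi> x else 0) \<in> borel_measurable borel" by measurable
  ultimately show ?thesis unfolding bounded_borel_def by blast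
qed

text \<open>
  Stated with \<open>max\<close> and \<open>min\<close> so that it also covers an empty intersection.
\<close>

lemma integral_restrict_Ioo:
  fixes g :: "real \<Rightarrow> 'b::euclidean_space"
  shows "integral {u..v} (\<lambda>x. if x \<in> {c<..<d} then g x else 0) = integral {max c u..min d v} g"
proof -
  have "integral {u..v} (\<lambda>x. if x \<in> {c<..<d} then g x else 0)
      = integral {u<..<v} (\<lambda>x. if x \<in> {c<..<d} then g x else 0)" by (rule integral_open_interval_real)
  also have "\<dots> = integral ({c<..<d} \<inter> {u<..<v}) g" by (rule Henstock_Kurzweil_Integration.integral_restrict_Int)
  also have "{c<..<d} \<inter> {u<..<v} = {max c u<..<min d v}" by auto
  also have "integral \<dots> g = integral {max c u..min d v} g" by (rule integral_open_interval_real[symmetric])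
  finally show ?thesis .
qed

lemma integrable_restrict_Ioo:
  fixes g :: "real \<Rightarrow> 'b::euclidean_space"
  assumes "g integrable_on {u..v}"
  shows "(\<lambda>x. if x \<in> {c<..<d} then g x else 0) integrable_on {u..v}"
proof -
  have "g integrable_on {max c u..min d v}" by (rule integrable_on_subinterval[OF assms]) auto
  then have "g integrable_on {max c u<..<min d v}" by (simp add: integrable_on_Icc_iff_Ioo)
  moreover have "{c<..<d} \<inter> {u<..<v} = {max c u<..<min d v}" by auto
  ultimately have "(\<lambda>x. if x \<in> {c<..<d} then g x else 0) integrable_on {u<..<v}"
    by (simp only: integrable_restrict_Int)
  then show ?thesis by (simp only: integrable_on_Icc_iff_Ioo)
qed

lemma sum_cell_integrals_le:
  fixes k :: "real \<Rightarrow> real"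
  assumes F: "finite F" and dis: "disjoint_family_on (\<lambda>n. {c n<..<d n}) F"
    and k: "k integrable_on {u..v}" "\<And>x. 0 \<le> k x"
  shows "(\<Sum>n\<in>F. integral {max (c n) u..min (d n) v} k) \<le> integral {u..v} k"
proof -
  have "(\<Sum>n\<in>F. integral {max (c n) u..min (d n) v} k)
     = (\<Sum>n\<in>F. integral {u..v} (\<lambda>x. if x \<in> {c n<..<d n} then k x else 0))"
    by (simp only: integral_restrict_Ioo)
  also have "\<dots> = integral {u..v} (\<lambda>x. \<Sum>n\<in>F. if x \<in> {c n<..<d n} then k x else 0)"
    by (rule integral_sum[symmetric]) (use F k integrable_restrict_Ioo in auto)
  also have "\<dots> \<le> integral {u..v} k"
  proof (rule integral_le[OF _ k(1)])
    show "(\<lambda>x. \<Sum>n\<in>F. if x \<in> {c n<..<d n} then k x else 0) integrable_on {u..v}"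
      by (intro integrable_sum F integrable_restrict_Ioo k)
    fix x
    show "(\<Sum>n\<in>F. if x \<in> {c n<..<d n} then k x else 0) \<le> k x"
    proof (cases "\<exists>n\<in>F. x \<in> {c n<..<d n}")
      case True
      then obtain m where m: "m \<in> F" "x \<in> {c m<..<d m}" by blast
      have "(\<Sum>n\<in>F. if x \<in> {c n<..<d n} then k x else 0) = (\<Sum>n\<in>{m}. if x \<in> {c n<..<d n} then k x else 0)"
      proof (rule sum.mono_neutral_right)
        show "\<forall>i\<in>F - {m}. (if x \<in> {c i<..<d i} then k x else 0) = 0"
        proof
          fix i assume "i \<in> F - {m}"
          then have "{c i<..<d i} \<inter> {c m<..<d m} = {}" using dis m unfolding disjoint_family_on_def by blast
          then show "(if x \<in> {c i<..<d i} then k x else 0) = 0" using m(2) by auto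
        qed
      qed (use F m in auto)
      then show ?thesis using m(2) by simp
    next
      case False
      then have "(\<Sum>n\<in>F. if x \<in> {c n<..<d n} then k x else 0) = 0" by (intro sum.neutral) auto
      then show ?thesis using k(2) by simp
    qed
  qed
  finally show ?thesis .
qed

lemma sum_cell_lengths_le:
  assumes F: "finite F" and dis: "disjoint_family_on (\<lambda>n. {c n<..<d n}) F" and "u \<le> v"
  shows "(\<Sum>n\<in>F. max 0 (min (d n) v - max (c n) u)) \<le> v - (u::real)"
proof -
  have "max 0 (min (d n) v - max (c n) u) = integral {max (c n) u..min (d n) v} (\<lambda>_. 1)" for n
    by (cases "max (c n) u \<le> min (d n) v") auto
  then have "(\<Sum>n\<in>F. max 0 (min (d n) v - max (c n) u)) = (\<Sum>n\<in>F. integral {max (c n) u..min (d n) v} (\<lambda>_. 1))"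
    by simp
  also have "\<dots> \<le> integral {u..v} (\<lambda>_. 1)"
    by (rule sum_cell_integrals_le[OF F dis]) auto
  finally show ?thesis using assms(3) by simp
qed

text \<open>
  By continuity of indefinite integrals, a bound on compact subintervals of an open interval extends
  to its closure.
\<close>

lemma closed_cell_bound:
  fixes g :: "real \<Rightarrow> complex"
  assumes g: "g integrable_on {s..t}" and st: "s \<le> t"
    and bd: "\<And>s' t'. s < s' \<Longrightarrow> s' \<le> t' \<Longrightarrow> t' < t \<Longrightarrow> norm (integral {s'..t'} g) \<le> b * (t' - s') powr \<alpha>"
    and b: "0 \<le> b" and \<alpha>: "0 < \<alpha>"
  shows "norm (integral {s..t} g) \<le> b * (t - s) powr \<alpha>"
proof (cases "s = t")
  case False
  then have st: "s < t" using st by simp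
  define I where "I x = integral {s..x} g" for x
  define e where "e n = (t - s) / real (n + 3)" for n
  have e: "0 < e n" "3 * e n \<le> t - s" for n
  proof -
    show "0 < e n" using st by (simp add: e_def)
    have "(t - s) * 3 \<le> (t - s) * real (n + 3)" using st by (intro mult_left_mono) auto
    then have "(t - s) * 3 / real (n + 3) \<le> t - s" by (subst pos_divide_le_eq) auto
    then show "3 * e n \<le> t - s" by (simp add: e_def mult.commute)
  qed
  have e': "e n \<le> t - s" for n using e[of n] by linarith
  have "s \<le> t - e n" "s + e n \<le> t" for n using e'[of n] by linarith+
  note e = e this
  have e0: "e \<longlonglongrightarrow> 0" unfolding e_def by real_asymp
  have cI: "continuous_on {s..t} I" unfolding I_def by (rule indefinite_integral_continuous_1[OF g])
  have l1: "(\<lambda>n. I (t - e n)) \<longlonglongrightarrow> I t"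
    by (rule continuous_on_tendsto_compose[OF cI]) (use e st e0 in \<open>auto intro!: tendsto_eq_intros e0 always_eventually simp: less_imp_le\<close>)
  have l2: "(\<lambda>n. I (s + e n)) \<longlonglongrightarrow> I s"
    by (rule continuous_on_tendsto_compose[OF cI]) (use e st e0 in \<open>auto intro!: tendsto_eq_intros e0 always_eventually simp: less_imp_le\<close>)
  have "(\<lambda>n. norm (I (t - e n) - I (s + e n))) \<longlonglongrightarrow> norm (I t - I s)"
    by (intro tendsto_intros l1 l2)
  moreover have "norm (I (t - e n) - I (s + e n)) \<le> b * (t - s) powr \<alpha>" for n
  proof -
    have n: "s < s + e n" "s + e n \<le> t - e n" "t - e n < t" using e[of n] st by auto
    have "I (s + e n) + integral {s + e n..t - e n} g = I (t - e n)" unfolding I_def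
      by (rule Henstock_Kurzweil_Integration.integral_combine) (use n in \<open>auto intro: integrable_on_subinterval[OF g]\<close>)
    then have "I (t - e n) - I (s + e n) = integral {s + e n..t - e n} g" by (simp add: algebra_simps)
    also have "norm \<dots> \<le> b * ((t - e n) - (s + e n)) powr \<alpha>" by (rule bd[OF n])
    also have "\<dots> \<le> b * (t - s) powr \<alpha>" using n e[of n] b \<alpha> by (intro mult_left_mono powr_mono2) auto
    finally show ?thesis .
  qed
  ultimately have "norm (I t - I s) \<le> b * (t - s) powr \<alpha>" by (intro LIMSEQ_le_const2) auto
  then show ?thesis by (simp add: I_def)
qed simp

text \<open>
  Local constants b n on disjoint intervals give a global one. An interval [u, v] meets the n-th cell in
  length l n with \<Sum> l n \<le> v - u, and \<Sum> b n (l n)^\<alpha> is bounded by Hoelder's inequality with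
  the exponents 1 / (1 - \<alpha>) and 1 / \<alpha>.
\<close>

lemma primitive_Holder_glue_cells:
  fixes c d b :: "nat \<Rightarrow> real" and g :: "real \<Rightarrow> complex"
  assumes g: "bounded_borel g" and dis: "disjoint_family_on (\<lambda>n. {c n<..<d n}) I"
    and supp: "\<And>x. g x \<noteq> 0 \<Longrightarrow> \<exists>n\<in>I. x \<in> {c n<..<d n}"
    and b: "\<And>n. n \<in> I \<Longrightarrow> 0 \<le> b n"
    and cell: "\<And>n s t. n \<in> I \<Longrightarrow> c n < s \<Longrightarrow> s \<le> t \<Longrightarrow> t < d n \<Longrightarrow> norm (integral {s..t} g) \<le> b n * (t - s) powr \<alpha>"
    and S: "\<And>F. finite F \<Longrightarrow> F \<subseteq> I \<Longrightarrow> (\<Sum>n\<in>F. b n powr (1 / (1 - \<alpha>))) \<le> S"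
    and \<alpha>: "0 < \<alpha>" "\<alpha> < 1"
  shows "primitive_Holder \<alpha> (S powr (1 - \<alpha>)) T g"
proof (rule primitive_HolderI)
  fix u v :: real assume uv: "u \<le> v"
  obtain B where B: "0 < B" "\<And>x. norm (g x) \<le> B" by (rule bounded_borel_bound[OF g]) (rule that)
  define F where "F N = {n \<in> I. n < N}" for N
  define h where "h N x = (\<Sum>n\<in>F N. if x \<in> {c n<..<d n} then g x else 0)" for N x
  define l where "l n = max 0 (min (d n) v - max (c n) u)" for n
  have F: "finite (F N)" "F N \<subseteq> I" for N unfolding F_def by auto
  have disF: "disjoint_family_on (\<lambda>n. {c n<..<d n}) (F N)" for N
    using dis F(2) by (rule disjoint_family_on_mono[rotated])
  have single: "h N x = (if m < N then g x else 0)" if m: "m \<in> I" "x \<in> {c m<..<d m}" for m N x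
  proof -
    have z: "(if x \<in> {c n<..<d n} then g x else 0) = (if n = m then g x else 0)" if "n \<in> F N" for n
    proof (cases "n = m")
      case False
      then have "{c n<..<d n} \<inter> {c m<..<d m} = {}"
        using dis m that F(2)[of N] unfolding disjoint_family_on_def by blast
      then have "x \<notin> {c n<..<d n}" using m(2) by blast
      then show ?thesis using False by auto
    qed (use m in simp)
    have "h N x = (\<Sum>n\<in>F N. if n = m then g x else 0)" unfolding h_def by (rule sum.cong[OF refl z])
    also have "\<dots> = (if m \<in> F N then g x else 0)" using F(1) by simp
    finally show ?thesis using m by (simp add: F_def)
  qed
  have gi: "g integrable_on {s..t}" for s t by (rule bounded_borel_integrable[OF g])
  have hlim: "(\<lambda>N. h N x) \<longlonglongrightarrow> g x" and hb: "norm (h N x) \<le> B" for x N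
  proof -
    have "(\<lambda>N. h N x) \<longlonglongrightarrow> g x \<and> norm (h N x) \<le> B"
    proof (cases "\<exists>m\<in>I. x \<in> {c m<..<d m}")
      case True
      then obtain m where m: "m \<in> I" "x \<in> {c m<..<d m}" by blast
      have "eventually (\<lambda>N. h N x = g x) sequentially"
        using eventually_gt_at_top[of m] by eventually_elim (simp add: single[OF m])
      then show ?thesis using B single[OF m] by (auto intro: tendsto_eventually)
    next
      case False
      then have "g x = 0" using supp by blast
      then have "h N x = 0" "g x = 0" for N unfolding h_def by (auto intro!: sum.neutral)
      then show ?thesis using B by simp
    qed
    then show "(\<lambda>N. h N x) \<longlonglongrightarrow> g x" "norm (h N x) \<le> B" by auto
  qed
  have "(\<lambda>N. integral {u..v} (h N)) \<longlonglongrightarrow> integral {u..v} g"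
  proof (rule dominated_convergence(2)[where h="\<lambda>_. B"])
    show "h N integrable_on {u..v}" for N unfolding h_def
      by (intro integrable_sum F integrable_restrict_Ioo gi)
  qed (use hlim hb in auto)
  then have "(\<lambda>N. norm (integral {u..v} (h N))) \<longlonglongrightarrow> norm (integral {u..v} g)" by (rule tendsto_norm)
  moreover have "norm (integral {u..v} (h N)) \<le> S powr (1 - \<alpha>) * (v - u) powr \<alpha>" for N
  proof -
    have "integral {u..v} (h N) = (\<Sum>n\<in>F N. integral {max (c n) u..min (d n) v} g)"
      unfolding h_def integral_restrict_Ioo[symmetric]
      by (rule integral_sum) (intro F integrable_restrict_Ioo gi)+
    also have "norm \<dots> \<le> (\<Sum>n\<in>F N. norm (integral {max (c n) u..min (d n) v} g))" by (rule norm_sum)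
    also have "\<dots> \<le> (\<Sum>n\<in>F N. b n * l n powr \<alpha>)"
    proof (rule sum_mono)
      fix n assume n: "n \<in> F N"
      then have nI: "n \<in> I" using F(2) by blast
      show "norm (integral {max (c n) u..min (d n) v} g) \<le> b n * l n powr \<alpha>"
      proof (cases "max (c n) u \<le> min (d n) v")
        case True
        have "norm (integral {max (c n) u..min (d n) v} g) \<le> b n * (min (d n) v - max (c n) u) powr \<alpha>"
          by (rule closed_cell_bound[OF gi True _ b[OF nI] \<alpha>(1)]) (rule cell[OF nI], auto)
        then show ?thesis using True by (simp add: l_def)
      next
        case False
        then have "{max (c n) u..min (d n) v} = {}" by simp
        then show ?thesis using b[OF nI] by (simp only: integral_empty) simp
      qed
    qed
    also have "\<dots> = (\<Sum>n\<in>F N. (b n powr (1 / (1 - \<alpha>))) powr (1 - \<alpha>) * l n powr \<alpha>)"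
    proof (rule sum.cong[OF refl])
      fix n assume "n \<in> F N"
      then have "0 \<le> b n" using b F(2) by blast
      then show "b n * l n powr \<alpha> = (b n powr (1 / (1 - \<alpha>))) powr (1 - \<alpha>) * l n powr \<alpha>"
        using \<alpha> by (simp add: powr_powr)
    qed
    also have "\<dots> \<le> (\<Sum>n\<in>F N. b n powr (1 / (1 - \<alpha>))) powr (1 - \<alpha>) * (\<Sum>n\<in>F N. l n) powr \<alpha>"
      by (rule sum_powr_Holder) (use F \<alpha> in \<open>auto simp: l_def\<close>)
    also have "\<dots> \<le> S powr (1 - \<alpha>) * (v - u) powr \<alpha>"
      unfolding l_def using \<alpha>
      by (intro mult_mono powr_mono2 S F sum_cell_lengths_le disF uv sum_nonneg) auto
    finally show ?thesis .
  qed
  ultimately show "norm (integral {u..v} g) \<le> S powr (1 - \<alpha>) * (v - u) powr \<alpha>"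
    by (intro LIMSEQ_le_const2) auto
qed

section \<open>The weighted Koopman operator\<close>

text \<open>
  Weighted AM-GM up to a constant, including the boundary exponents 0 and 1.
\<close>

lemma powr_interpolate_le_add:
  fixes x y \<theta> :: real
  assumes "0 \<le> x" "0 \<le> y" "0 \<le> \<theta>" "\<theta> \<le> 1"
  shows "x powr (1 - \<theta>) * y powr \<theta> \<le> x + y"
proof (cases "x = 0 \<or> y = 0")
  case False
  then have p: "0 < max x y" using assms by auto
  have "x powr (1 - \<theta>) * y powr \<theta> \<le> max x y powr (1 - \<theta>) * max x y powr \<theta>"
    using assms by (intro mult_mono powr_mono2) auto
  also have "\<dots> = max x y" using p by (simp add: powr_add[symmetric])
  also have "\<dots> \<le> x + y" using assms by simp
  finally show ?thesis .
qed (use assms in auto)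

lemma powr_add_le:
  fixes x y q :: real
  assumes "0 \<le> x" "0 \<le> y" "0 \<le> q"
  shows "(x + y) powr q \<le> 2 powr q * (x powr q + y powr q)"
proof -
  have "(x + y) powr q \<le> (2 * max x y) powr q" using assms by (intro powr_mono2) auto
  also have "\<dots> = 2 powr q * max x y powr q" using assms by (simp add: powr_mult)
  also have "max x y powr q \<le> x powr q + y powr q" by (simp add: max_def)
  finally show ?thesis by simp
qed

lemma integral_small_on_short:
  fixes k :: "real \<Rightarrow> real"
  assumes k: "k integrable_on {a..b}" and e: "0 < e"
  obtains \<eta> where "0 < \<eta>" "\<And>s t. a \<le> s \<Longrightarrow> s \<le> t \<Longrightarrow> t \<le> b \<Longrightarrow> t - s < \<eta> \<Longrightarrow> integral {s..t} k < e"
proof -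
  define I where "I x = integral {a..x} k" for x
  have "uniformly_continuous_on {a..b} I" unfolding I_def
    by (intro compact_uniformly_continuous indefinite_integral_continuous_1 k) auto
  then obtain \<eta> where \<eta>: "0 < \<eta>" "\<And>x x'. x \<in> {a..b} \<Longrightarrow> x' \<in> {a..b} \<Longrightarrow> dist x' x < \<eta> \<Longrightarrow> dist (I x') (I x) < e"
    using e unfolding uniformly_continuous_on_def by metis
  show thesis
  proof (rule that[OF \<eta>(1)])
    fix s t assume st: "a \<le> s" "s \<le> t" "t \<le> b" "t - s < \<eta>"
    have "I s + integral {s..t} k = I t" unfolding I_def
      by (rule Henstock_Kurzweil_Integration.integral_combine) (use st in \<open>auto intro: integrable_on_subinterval[OF k]\<close>)
    moreover have "dist (I t) (I s) < e" by (rule \<eta>(2)) (use st in \<open>auto simp: dist_real_def\<close>)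
    ultimately show "integral {s..t} k < e" by (simp add: dist_real_def)
  qed
qed

lemma Holder_continuous_on:
  fixes g :: "real \<Rightarrow> complex"
  assumes \<beta>: "0 < \<beta>" and H: "\<And>x y. x \<in> S \<Longrightarrow> y \<in> S \<Longrightarrow> norm (g x - g y) \<le> C * \<bar>x - y\<bar> powr \<beta>"
  shows "continuous_on S g"
  unfolding continuous_on_def
proof
  fix x assume x: "x \<in> S"
  have "((\<lambda>y. C * \<bar>y - x\<bar> powr \<beta>) \<longlongrightarrow> C * \<bar>x - x\<bar> powr \<beta>) (at x within S)"
    by (intro tendsto_intros tendsto_powr') (use \<beta> in auto)
  then have "((\<lambda>y. C * \<bar>y - x\<bar> powr \<beta>) \<longlongrightarrow> 0) (at x within S)" by simp
  then have "((\<lambda>y. g y - g x) \<longlongrightarrow> 0) (at x within S)"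
    by (rule Lim_null_comparison[rotated]) (use H x in \<open>auto simp: eventually_at_filter\<close>)
  then show "(g \<longlongrightarrow> g x) (at x within S)" by (rule LIM_zero_cancel)
qed

text \<open>
  The branches of the map, enumerated as open intervals (c n, d n); empty intervals are allowed, so
  that a finite partition can be padded. M and Q bound |\<xi> f'| and |\<xi>| |f'|^\<alpha>, and Qn n bounds
  the latter on the n-th branch. Q is a free parameter because the two spectral bounds use two different
  values of it.
\<close>

locale branches =
  fixes c d Qn :: "nat \<Rightarrow> real" and f :: "real \<Rightarrow> real" and \<xi> :: "real \<Rightarrow> complex" and \<alpha> \<beta> r C M Q :: real
  assumes \<alpha>: "0 < \<alpha>" "\<alpha> < 1" and \<beta>: "0 < \<beta>" "\<beta> \<le> 1" "1 < \<alpha> + \<beta>" and r: "0 \<le> r"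
    and \<beta>r: "1 \<le> \<beta> * (r + 1)" and \<alpha>r: "1 - \<beta> \<le> \<alpha> * (1 - \<beta> * (1 - r))"
    and C: "0 < C" and M: "0 \<le> M" and Q: "0 \<le> Q"
    and cd: "\<And>n. 0 \<le> c n" "\<And>n. c n \<le> d n" "\<And>n. d n \<le> 1"
    and dis: "disjoint_family (\<lambda>n. {c n<..<d n})"
    and f_deriv: "\<And>x. x \<in> (\<Union>n. {c n<..<d n}) \<Longrightarrow> (f has_real_derivative deriv f x) (at x)"
    and f'_cont: "continuous_on (\<Union>n. {c n<..<d n}) (deriv f)"
    and f'_ge: "\<And>x. x \<in> (\<Union>n. {c n<..<d n}) \<Longrightarrow> 1 \<le> \<bar>deriv f x\<bar>"
    and f_range: "\<And>x. x \<in> (\<Union>n. {c n<..<d n}) \<Longrightarrow> f x \<in> {0..1}"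
    and \<xi>_Holder: "\<And>n x y. x \<in> {c n<..<d n} \<Longrightarrow> y \<in> {c n<..<d n} \<Longrightarrow> norm (\<xi> x - \<xi> y) \<le> C * \<bar>x - y\<bar> powr \<beta>"
    and \<xi>M: "\<And>x. x \<in> (\<Union>n. {c n<..<d n}) \<Longrightarrow> norm (\<xi> x) * \<bar>deriv f x\<bar> \<le> M"
    and \<xi>Q: "\<And>x. x \<in> (\<Union>n. {c n<..<d n}) \<Longrightarrow> norm (\<xi> x) * \<bar>deriv f x\<bar> powr \<alpha> \<le> Q"
    and \<xi>Qn: "\<And>n x. x \<in> {c n<..<d n} \<Longrightarrow> norm (\<xi> x) * \<bar>deriv f x\<bar> powr \<alpha> \<le> Qn n"
    and Qn0: "\<And>n. 0 \<le> Qn n" and Qn_sum: "summable (\<lambda>n. Qn n powr (1 / (1 - \<alpha>)))"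
    and f'_r: "integrable leb01 (\<lambda>x. \<bar>deriv f x\<bar> powr r)"
begin

definition \<Omega> where "\<Omega> = (\<Union>n. {c n<..<d n})"
abbreviation D where "D x \<equiv> \<bar>deriv f x\<bar>"
abbreviation Dr where "Dr x \<equiv> \<bar>deriv f x\<bar> powr r"
abbreviation m where "m \<equiv> gain_exponent \<alpha> r"

text \<open>
  The formal adjoint of the transfer operator. The modulus |f'| is used, so that orientation of the
  branches never enters.
\<close>

definition Koopman :: "(real \<Rightarrow> complex) \<Rightarrow> real \<Rightarrow> complex" where
  "Koopman \<psi> x = (if x \<in> \<Omega> then \<xi> x * of_real (D x) * \<psi> (f x) else 0)"

lemma \<Omega>I: "x \<in> {c n<..<d n} \<Longrightarrow> x \<in> \<Omega>" unfolding \<Omega>_def by blast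

lemma seg_\<Omega>: "c n < s \<Longrightarrow> t < d n \<Longrightarrow> x \<in> {s..t} \<Longrightarrow> x \<in> (\<Union>n. {c n<..<d n})"
  by (rule UN_I[of n]) auto

lemma seg_\<Omega>': "c n < s \<Longrightarrow> t < d n \<Longrightarrow> {s..t} \<subseteq> (\<Union>n. {c n<..<d n})"
  by (rule subsetI, rule seg_\<Omega>)

lemma open_\<Omega>: "open \<Omega>" unfolding \<Omega>_def by (intro open_UN ballI open_greaterThanLessThan)

lemma f_cont: "continuous_on \<Omega> f"
  unfolding \<Omega>_def by (intro continuous_at_imp_continuous_on ballI DERIV_isCont[OF f_deriv])

lemma \<xi>_cont: "continuous_on \<Omega> \<xi>"
  unfolding \<Omega>_def
proof (rule continuous_on_open_UN)
  show "continuous_on {c n<..<d n} \<xi>" for n by (rule Holder_continuous_on[OF \<beta>(1) \<xi>_Holder])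
qed auto

lemma Koopman_bound:
  assumes "\<And>x. norm (\<psi> x) \<le> B" shows "norm (Koopman \<psi> x) \<le> M * B"
proof (cases "x \<in> \<Omega>")
  case True
  have "norm (Koopman \<psi> x) = (norm (\<xi> x) * D x) * norm (\<psi> (f x))" using True by (simp add: Koopman_def norm_mult)
  also have "\<dots> \<le> M * B" by (intro mult_mono assms) (use \<xi>M True M in \<open>auto simp: \<Omega>_def\<close>)
  finally show ?thesis .
next
  case False
  have "0 \<le> B" using assms[of x] by (meson norm_ge_zero order_trans)
  then show ?thesis using False M by (simp add: Koopman_def)
qed

lemma Koopman_bounded_borel: assumes "bounded_borel \<psi>" shows "bounded_borel (Koopman \<psi>)"
proof -
  obtain B where B: "0 < B" "\<And>x. norm (\<psi> x) \<le> B" by (rule bounded_borel_bound[OF assms]) (rule that)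
  have [measurable]: "\<psi> \<in> borel_measurable borel" by (rule bounded_borel_measurable[OF assms])
  have \<Omega>b[measurable]: "\<Omega> \<in> sets borel" by (rule borel_open[OF open_\<Omega>])
  have [measurable]: "(\<lambda>x. indicator \<Omega> x *\<^sub>R f x) \<in> borel_measurable borel"
    by (rule borel_measurable_continuous_on_indicator[OF \<Omega>b f_cont])
  have [measurable]: "(\<lambda>x. indicator \<Omega> x *\<^sub>R (\<xi> x * of_real (D x))) \<in> borel_measurable borel"
    by (rule borel_measurable_continuous_on_indicator[OF \<Omega>b])
       (intro continuous_intros \<xi>_cont f'_cont[folded \<Omega>_def])
  have "Koopman \<psi> = (\<lambda>x. (indicator \<Omega> x *\<^sub>R (\<xi> x * of_real (D x))) * \<psi> (indicator \<Omega> x *\<^sub>R f x))"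
    by (auto simp: Koopman_def indicator_def)
  also have "\<dots> \<in> borel_measurable borel" by measurable
  finally have "Koopman \<psi> \<in> borel_measurable borel" .
  then show ?thesis using Koopman_bound[of \<psi>, OF B(2)] unfolding bounded_borel_def by blast
qed

lemma Koopman_add: "Koopman (\<lambda>x. \<psi> x + \<phi> x) x = Koopman \<psi> x + Koopman \<phi> x" by (simp add: Koopman_def algebra_simps)

lemma f_inj: "inj_on f {c n<..<d n}"
proof (rule inj_onI)
  have *: False if xy: "x \<in> {c n<..<d n}" "y \<in> {c n<..<d n}" "x < y" "f x = f y" for x y
  proof -
    have "\<exists>z>x. z < y \<and> f y - f x = (y - x) * deriv f z"
      by (rule MVT2[OF xy(3)]) (use xy in \<open>auto intro!: f_deriv UN_I[of n]\<close>)
    then obtain z where z: "x < z" "z < y" "f y - f x = (y - x) * deriv f z" by blast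
    have "1 \<le> D z" by (rule f'_ge[OF seg_\<Omega>[of n x y]]) (use z xy in auto)
    then show False using z xy by auto
  qed
  fix x y assume "x \<in> {c n<..<d n}" "y \<in> {c n<..<d n}" "f x = f y"
  then show "x = y" using *[of x y] *[of y x] by (metis linorder_neqE)
qed

lemma D_cont: "c n < s \<Longrightarrow> t < d n \<Longrightarrow> continuous_on {s..t} D"
  by (intro continuous_intros continuous_on_subset[OF f'_cont] seg_\<Omega>')

lemma change_of_variables:
  fixes g :: "real \<Rightarrow> 'b::euclidean_space"
  assumes st: "c n < s" "t < d n" and g: "g absolutely_integrable_on (f ` {s..t})"
  shows "(\<lambda>x. D x *\<^sub>R g (f x)) absolutely_integrable_on {s..t}"
    "integral {s..t} (\<lambda>x. D x *\<^sub>R g (f x)) = integral (f ` {s..t}) g"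
proof -
  have sub: "{s..t} \<subseteq> {c n<..<d n}" using st by auto
  have "(f has_field_derivative deriv f x) (at x within {s..t})" if "x \<in> {s..t}" for x
    by (rule has_field_derivative_at_within[OF f_deriv]) (use sub that in blast)
  then have "(\<lambda>x. D x *\<^sub>R g (f x)) absolutely_integrable_on {s..t} \<and> integral {s..t} (\<lambda>x. D x *\<^sub>R g (f x)) = b
      \<longleftrightarrow> g absolutely_integrable_on f ` {s..t} \<and> integral (f ` {s..t}) g = b" for b
    by (intro has_absolute_integral_change_of_variables_real inj_on_subset[OF f_inj sub]) auto
  then show "(\<lambda>x. D x *\<^sub>R g (f x)) absolutely_integrable_on {s..t}"
    "integral {s..t} (\<lambda>x. D x *\<^sub>R g (f x)) = integral (f ` {s..t}) g" using g by blast+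
qed

text \<open>
  The image of a segment is an interval whose length is the integral of |f'|; in particular that
  integral is at most 1.
\<close>

lemma image_segment:
  assumes st: "c n < s" "s \<le> t" "t < d n"
  obtains u v where "f ` {s..t} = {u..v}" "u \<le> v" "0 \<le> u" "v \<le> 1" "v - u = integral {s..t} D"
proof -
  have sub: "{s..t} \<subseteq> \<Omega>" unfolding \<Omega>_def by (rule seg_\<Omega>'[OF st(1,3)])
  have cont: "continuous_on {s..t} f" by (rule continuous_on_subset[OF f_cont sub])
  have "connected (f ` {s..t}) \<and> compact (f ` {s..t})"
    by (intro conjI connected_continuous_image compact_continuous_image cont) auto
  then obtain u v where uv: "f ` {s..t} = {u..v}" by (metis connected_compact_interval_1)
  have ne: "u \<le> v" using uv st(2) by (metis atLeastatMost_empty_iff2 image_is_empty)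
  have "{u..v} \<subseteq> {0..1}" unfolding uv[symmetric] by (rule image_subsetI, rule f_range[OF seg_\<Omega>[OF st(1,3)]])
  then have 01: "0 \<le> u" "v \<le> 1" using ne by auto
  have "integral {s..t} (\<lambda>x. D x *\<^sub>R (1::real)) = integral (f ` {s..t}) (\<lambda>_. 1)"
    by (rule change_of_variables(2)[OF st(1,3)]) (simp add: uv)
  then have "v - u = integral {s..t} D" using ne by (simp add: uv)
  then show thesis using that uv ne 01 by blast
qed

lemma Koopman_on_cell:
  assumes "x \<in> {c n<..<d n}" shows "Koopman \<psi> x = \<xi> x * (D x *\<^sub>R \<psi> (f x))"
  using \<Omega>I[OF assms] by (simp add: Koopman_def scaleR_conv_of_real mult_ac)

definition good_factor where "good_factor A = (1 + young_const \<alpha> \<beta> / A) / (1 - 1 / A)"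
definition power_mass where "power_mass s t = integral {s..t} Dr"

lemma Koopman_segment_bound:
  assumes st: "c n < s" "s \<le> t" "t < d n" and A: "1 < A" and \<psi>: "bounded_borel \<psi>"
    and h: "0 \<le> h" "primitive_Holder \<alpha> h (f ` {s..t}) \<psi>"
    and q: "\<And>x. x \<in> {s..t} \<Longrightarrow> norm (\<xi> x) * D x powr \<alpha> \<le> q"
  shows "norm (integral {s..t} (Koopman \<psi>))
    \<le> h * (good_factor A * q * (t - s) powr \<alpha> + bad_const \<alpha> \<beta> A C M * (t - s) powr (1 - m) * power_mass s t powr m)"
proof -
  obtain B where B: "0 < B" "\<And>x. norm (\<psi> x) \<le> B" by (rule bounded_borel_bound[OF \<psi>]) (rule that)
  have inI: "x \<in> {c n<..<d n}" if "x \<in> {s..t}" for x using that st by auto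
  have in\<Omega>: "x \<in> (\<Union>n. {c n<..<d n})" if "x \<in> {s..t}" for x using inI[OF that] by blast
  define F where "F x = D x *\<^sub>R \<psi> (f x)" for x
  have Ueq: "integral {s..t} (Koopman \<psi>) = integral {s..t} (\<lambda>x. \<xi> x * F x)"
    by (rule integral_cong) (use Koopman_on_cell inI in \<open>auto simp: F_def\<close>)
  have Fint: "F absolutely_integrable_on {s'..t'}" "integral {s'..t'} F = integral (f ` {s'..t'}) \<psi>"
    if st': "s \<le> s'" "s' \<le> t'" "t' \<le> t" for s' t'
  proof -
    have st'': "c n < s'" "t' < d n" using st st' by auto
    obtain u v where uv: "f ` {s'..t'} = {u..v}" by (rule image_segment[OF st''(1) st'(2) st''(2)]) (rule that)
    have "\<psi> absolutely_integrable_on (f ` {s'..t'})"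
      unfolding uv by (rule bounded_borel_absolutely_integrable[OF \<psi>])
    from change_of_variables[OF st'' this]
    show "F absolutely_integrable_on {s'..t'}" "integral {s'..t'} F = integral (f ` {s'..t'}) \<psi>"
      unfolding F_def by auto
  qed
  interpret segment \<alpha> \<beta> r A C M h B s t D \<xi> F
  proof
    show "continuous_on {s..t} D" by (rule D_cont[OF st(1,3)])
    show "1 \<le> D x" if "x \<in> {s..t}" for x by (rule f'_ge[OF in\<Omega>[OF that]])
    show "integral {s..t} D \<le> 1"
    proof -
      obtain u v where "f ` {s..t} = {u..v}" "u \<le> v" "0 \<le> u" "v \<le> 1" "v - u = integral {s..t} D"
        by (rule image_segment[OF st]) (rule that)
      then show ?thesis by linarith
    qed
    show "norm (\<xi> x - \<xi> y) \<le> C * \<bar>x - y\<bar> powr \<beta>" if "x \<in> {s..t}" "y \<in> {s..t}" for x y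
      by (rule \<xi>_Holder[OF inI[OF that(1)] inI[OF that(2)]])
    show "norm (\<xi> x) * D x \<le> M" if "x \<in> {s..t}" for x by (rule \<xi>M[OF in\<Omega>[OF that]])
    show "F integrable_on {s..t}"
      using Fint(1)[of s t] st by (simp add: set_lebesgue_integral_eq_integral(1))
    have "Koopman \<psi> integrable_on {s..t}" by (rule bounded_borel_integrable[OF Koopman_bounded_borel[OF \<psi>]])
    then show "(\<lambda>x. \<xi> x * F x) integrable_on {s..t}"
      by (rule integrable_eq) (use Koopman_on_cell inI in \<open>auto simp: F_def\<close>)
    show "norm (F x) \<le> B * D x" if "x \<in> {s..t}" for x
      unfolding F_def mult.commute[of B] using B(2)[of "f x"] by (simp add: mult_left_mono)
    show "norm (integral {s'..t'} F) \<le> h * integral {s'..t'} D powr \<alpha>"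
      if st': "s \<le> s'" "s' \<le> t'" "t' \<le> t" for s' t'
    proof -
      obtain u v where uv: "f ` {s'..t'} = {u..v}" "u \<le> v" "v - u = integral {s'..t'} D"
        by (rule image_segment[of n s' t']) (use st st' that in auto)
      have "{u..v} \<subseteq> f ` {s..t}" unfolding uv(1)[symmetric] using st' by auto
      from primitive_HolderD[OF h(2) uv(2) this]
      show ?thesis unfolding Fint(2)[OF st'] uv(1) uv(3) .
    qed
    show "t - s \<le> 1" using st cd(1)[of n] cd(3)[of n] by linarith
  qed (use \<alpha> \<beta> r \<beta>r \<alpha>r A C M h B st in auto)
  show ?thesis unfolding Ueq good_factor_def power_mass_def by (rule segment_bound[OF q])
qed

lemma Dr_int: "0 \<le> u \<Longrightarrow> v \<le> 1 \<Longrightarrow> Dr integrable_on {u..v}"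
  by (rule leb01_integral(1)[OF f'_r])

lemma power_mass_nonneg: "0 \<le> power_mass s t"
  unfolding power_mass_def by (cases "Dr integrable_on {s..t}")
    (auto intro: Henstock_Kurzweil_Integration.integral_nonneg simp: not_integrable_integral)

lemma m_bounds: "0 < m" "m \<le> 1 - \<alpha>" "m < 1" using gain_exponent_bounds[OF \<alpha>] by auto

lemma young_pos: "0 < young_const \<alpha> \<beta>"
proof -
  have "2 powr (1 - \<alpha> - \<beta>) < (2::real) powr 0" using \<beta> by (intro powr_less_mono) auto
  then show ?thesis unfolding young_const_def by simp
qed

lemma good_factor_nonneg: "1 < A \<Longrightarrow> 0 \<le> good_factor A"
  unfolding good_factor_def using young_pos by (intro divide_nonneg_nonneg add_nonneg_nonneg) auto

lemma bad_const_nonneg': "1 < A \<Longrightarrow> 0 \<le> bad_const \<alpha> \<beta> A C M"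
  unfolding bad_const_def using young_pos C by (intro mult_nonneg_nonneg) auto

text \<open>
  On sufficiently short segments K multiplies Hoelder constants by at most \<kappa>, for any
  \<kappa> > Q: choose the threshold A so large that the constant of the good case is close to Q, then
  the length so small that the other term is negligible. The length is uniform in the branch because
  the integral of |f'|^r is uniformly small on short intervals.
\<close>

lemma fine_bound:
  assumes \<kappa>: "Q < \<kappa>"
  obtains \<eta> where "0 < \<eta>"
    "\<And>n s t \<psi> h. c n < s \<Longrightarrow> s \<le> t \<Longrightarrow> t < d n \<Longrightarrow> t - s < \<eta> \<Longrightarrow> bounded_borel \<psi> \<Longrightarrow> 0 \<le> h \<Longrightarrow>
       primitive_Holder \<alpha> h (f ` {s..t}) \<psi> \<Longrightarrow> norm (integral {s..t} (Koopman \<psi>)) \<le> \<kappa> * h * (t - s) powr \<alpha>"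
proof -
  define \<epsilon> where "\<epsilon> = (\<kappa> - Q) / 2"
  have \<epsilon>: "0 < \<epsilon>" using \<kappa> by (simp add: \<epsilon>_def)
  have "((\<lambda>A. good_factor A * Q) \<longlongrightarrow> (1 + 0) / (1 - 0) * Q) at_top"
    unfolding good_factor_def
    by (intro tendsto_intros tendsto_divide_0[OF tendsto_const] filterlim_at_top_imp_at_infinity filterlim_ident) auto
  then have "eventually (\<lambda>A. good_factor A * Q < Q + \<epsilon>) at_top"
    by (rule order_tendstoD(2)) (use \<epsilon> in simp)
  then have "eventually (\<lambda>A. good_factor A * Q < Q + \<epsilon> \<and> 1 < A) at_top"
    using eventually_gt_at_top[of 1] by eventually_elim simp
  then obtain A where A: "good_factor A * Q < Q + \<epsilon>" "1 < A"
    using eventually_happens'[OF trivial_limit_at_top_linorder] by blast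
  define K where "K = bad_const \<alpha> \<beta> A C M"
  have K: "0 \<le> K" unfolding K_def by (rule bad_const_nonneg'[OF A(2)])
  \<comment> \<open>so that K times the m-th power of the r-mass stays below \<epsilon>\<close>
  define e where "e = (\<epsilon> / (K + 1)) powr (1 / m)"
  have e: "0 < e" "e powr m = \<epsilon> / (K + 1)" using \<epsilon> K m_bounds by (auto simp: e_def powr_powr)
  obtain \<eta> where \<eta>: "0 < \<eta>" "\<And>s t. 0 \<le> s \<Longrightarrow> s \<le> t \<Longrightarrow> t \<le> 1 \<Longrightarrow> t - s < \<eta> \<Longrightarrow> integral {s..t} Dr < e"
    by (rule integral_small_on_short[OF Dr_int[of 0 1] e(1)]) (use that in auto)
  show thesis
  proof (rule that[OF \<eta>(1)])
    fix n s t \<psi> h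
    assume st: "c n < s" "s \<le> t" "t < d n" "t - s < \<eta>" and \<psi>: "bounded_borel \<psi>"
      and h: "0 \<le> (h::real)" "primitive_Holder \<alpha> h (f ` {s..t}) \<psi>"
    have st01: "0 \<le> s" "t \<le> 1" "t - s \<le> 1" using st cd(1)[of n] cd(3)[of n] by auto
    have "power_mass s t \<le> e" unfolding power_mass_def using \<eta>(2)[of s t] st st01 by simp
    then have "power_mass s t powr m \<le> \<epsilon> / (K + 1)"
      unfolding e(2)[symmetric] using m_bounds power_mass_nonneg by (intro powr_mono2) auto
    then have "K * power_mass s t powr m \<le> K * (\<epsilon> / (K + 1))" using K by (rule mult_left_mono)
    also have "\<dots> \<le> \<epsilon>" using K \<epsilon> by (simp add: field_simps)
    finally have 1: "K * power_mass s t powr m \<le> \<epsilon>" .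
    have 2: "(t - s) powr (1 - m) \<le> (t - s) powr \<alpha>" using st st01 m_bounds by (intro powr_mono') auto
    have "norm (integral {s..t} (Koopman \<psi>)) \<le> h * (good_factor A * Q * (t - s) powr \<alpha> + K * (t - s) powr (1 - m) * power_mass s t powr m)"
      unfolding K_def by (rule Koopman_segment_bound[OF st(1-3) A(2) \<psi> h]) (rule \<xi>Q[OF seg_\<Omega>[OF st(1,3)]])
    also have "\<dots> = h * (good_factor A * Q * (t - s) powr \<alpha> + (t - s) powr (1 - m) * (K * power_mass s t powr m))"
      by (simp add: mult_ac)
    also have "\<dots> \<le> h * ((Q + \<epsilon>) * (t - s) powr \<alpha> + (t - s) powr \<alpha> * \<epsilon>)"
      using A 1 2 h K by (intro mult_left_mono add_mono mult_right_mono mult_mono) auto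
    also have "\<dots> = \<kappa> * h * (t - s) powr \<alpha>" by (simp add: \<epsilon>_def algebra_simps)
    finally show "norm (integral {s..t} (Koopman \<psi>)) \<le> \<kappa> * h * (t - s) powr \<alpha>" .
  qed
qed

text \<open>
  The Hoelder constant of K on a whole branch; every fixed threshold, here A = 2, yields summability of
  the power 1 / (1 - \<alpha>).
\<close>

definition cell_bound where
  "cell_bound n = good_factor 2 * Qn n + bad_const \<alpha> \<beta> 2 C M * ((d n - c n) powr (1 - m - \<alpha>) * power_mass (c n) (d n) powr m)"

lemma cell_bound_nonneg: "0 \<le> cell_bound n"
  unfolding cell_bound_def using good_factor_nonneg[of 2] bad_const_nonneg'[of 2] Qn0 by auto

lemma cell_estimate:
  assumes st: "c n < s" "s \<le> t" "t < d n" and \<psi>: "bounded_borel \<psi>"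
    and h: "0 \<le> h" "primitive_Holder \<alpha> h {0..1} \<psi>"
  shows "norm (integral {s..t} (Koopman \<psi>)) \<le> h * cell_bound n * (t - s) powr \<alpha>"
proof -
  let ?K = "bad_const \<alpha> \<beta> 2 C M"
  have K: "0 \<le> ?K" by (rule bad_const_nonneg') simp
  have st01: "0 \<le> s" "t \<le> 1" "t - s \<le> d n - c n" using st cd(1)[of n] cd(3)[of n] by auto
  have "f ` {s..t} \<subseteq> {0..1}" by (rule image_subsetI, rule f_range[OF seg_\<Omega>[OF st(1,3)]])
  then have h': "primitive_Holder \<alpha> h (f ` {s..t}) \<psi>" by (rule primitive_Holder_subset[OF h(2)])
  have power_mass: "power_mass s t \<le> power_mass (c n) (d n)" unfolding power_mass_def
    by (rule integral_subset_le) (use st cd[of n] Dr_int st01 in auto)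
  have "norm (integral {s..t} (Koopman \<psi>)) \<le> h * (good_factor 2 * Qn n * (t - s) powr \<alpha> + ?K * (t - s) powr (1 - m) * power_mass s t powr m)"
    by (rule Koopman_segment_bound[OF st _ \<psi> h(1) h']) (use st in \<open>auto intro!: \<xi>Qn\<close>)
  also have "(t - s) powr (1 - m) = (t - s) powr \<alpha> * (t - s) powr (1 - m - \<alpha>)"
    unfolding powr_add[symmetric] by simp
  also have "h * (good_factor 2 * Qn n * (t - s) powr \<alpha> + ?K * ((t - s) powr \<alpha> * (t - s) powr (1 - m - \<alpha>)) * power_mass s t powr m)
     \<le> h * (good_factor 2 * Qn n * (t - s) powr \<alpha> + ?K * ((t - s) powr \<alpha> * (d n - c n) powr (1 - m - \<alpha>)) * power_mass (c n) (d n) powr m)"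
    using h K m_bounds st st01 power_mass power_mass_nonneg
    by (intro mult_left_mono add_left_mono mult_mono powr_mono2) auto
  also have "\<dots> = h * cell_bound n * (t - s) powr \<alpha>" by (simp add: cell_bound_def algebra_simps)
  finally show ?thesis .
qed

text \<open>
  The power 1 / (1 - \<alpha>) of the second term of the cell bound is a weighted geometric mean of the
  length of the branch and the integral of |f'|^r over it, and both of these are summable because
  the branches are disjoint.
\<close>

lemma cell_bound_summable: "summable (\<lambda>n. cell_bound n powr (1 / (1 - \<alpha>)))"
proof -
  define q where "q = 1 / (1 - \<alpha>)"
  have q: "0 < q" using \<alpha> by (simp add: q_def)
  let ?K = "bad_const \<alpha> \<beta> 2 C M"
  let ?G = "good_factor 2"
  have K: "0 \<le> ?K" "0 \<le> ?G" using bad_const_nonneg' good_factor_nonneg by auto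
  define x where "x n = d n - c n" for n
  define y where "y n = power_mass (c n) (d n)" for n
  have x0: "0 \<le> x n" and y0: "0 \<le> y n" for n using cd(2)[of n] power_mass_nonneg by (auto simp: x_def y_def)
  have disF: "disjoint_family_on (\<lambda>n. {c n<..<d n}) F" for F
    using dis by (rule disjoint_family_on_mono[rotated]) simp
  have sx: "summable x"
  proof (rule summableI_nonneg_bounded[where x=1])
    fix k
    have "(\<Sum>n<k. x n) = (\<Sum>n<k. max 0 (min (d n) 1 - max (c n) 0))"
      unfolding max.absorb1[OF cd(1)] min.absorb1[OF cd(3)] using x0 by (simp add: x_def)
    also have "\<dots> \<le> 1 - 0" by (rule sum_cell_lengths_le) (use disF in auto)
    finally show "(\<Sum>n<k. x n) \<le> 1" by simp
  qed (rule x0)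
  have sy: "summable y"
  proof (rule summableI_nonneg_bounded[where x="integral {0..1} Dr"])
    fix k
    have "(\<Sum>n<k. y n) = (\<Sum>n<k. integral {max (c n) 0..min (d n) 1} Dr)"
      unfolding y_def power_mass_def max.absorb1[OF cd(1)] min.absorb1[OF cd(3)] ..
    also have "\<dots> \<le> integral {0..1} Dr" by (rule sum_cell_integrals_le) (use disF Dr_int in auto)
    finally show "(\<Sum>n<k. y n) \<le> integral {0..1} Dr" .
  qed (rule y0)
  have bd: "cell_bound n powr q \<le> 2 powr q * (?G powr q * Qn n powr q + ?K powr q * (x n + y n))" for n
  proof -
    have mq: "0 \<le> m * q" "m * q \<le> 1" "(1 - m - \<alpha>) * q = 1 - m * q"
      using m_bounds \<alpha> by (auto simp: q_def field_simps)
    have "cell_bound n powr q \<le> 2 powr q * ((?G * Qn n) powr q + (?K * (x n powr (1 - m - \<alpha>) * y n powr m)) powr q)"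
      unfolding cell_bound_def x_def[symmetric] y_def[symmetric]
      by (rule powr_add_le) (use K Qn0 q in auto)
    also have "(?K * (x n powr (1 - m - \<alpha>) * y n powr m)) powr q = ?K powr q * (x n powr (1 - m * q) * y n powr (m * q))"
      using K by (simp add: powr_mult powr_powr mq)
    also have "(?G * Qn n) powr q = ?G powr q * Qn n powr q" using K Qn0 by (simp add: powr_mult)
    also have "2 powr q * (?G powr q * Qn n powr q + ?K powr q * (x n powr (1 - m * q) * y n powr (m * q)))
        \<le> 2 powr q * (?G powr q * Qn n powr q + ?K powr q * (x n + y n))"
      by (intro mult_left_mono add_left_mono powr_interpolate_le_add x0 y0 mq) auto
    finally show ?thesis .
  qed
  have "summable (\<lambda>n. 2 powr q * (?G powr q * Qn n powr q + ?K powr q * (x n + y n)))"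
    using Qn_sum[folded q_def] sx sy by (intro summable_mult summable_add)
  then have "summable (\<lambda>n. cell_bound n powr q)"
    by (rule summable_comparison_test'[where N=0]) (simp only: real_norm_def abs_of_nonneg[OF powr_ge_zero] bd)
  then show ?thesis by (simp add: q_def)
qed

text \<open>
  The norm of K as an operator on bounded functions with respect to Hoelder constants of primitives.
\<close>

definition growth where "growth = (\<Sum>n. cell_bound n powr (1 / (1 - \<alpha>))) powr (1 - \<alpha>)"

lemma Koopman_restricted_Holder:
  assumes \<psi>: "bounded_borel \<psi>" and h: "0 \<le> h" "primitive_Holder \<alpha> h {0..1} \<psi>"
    and S: "\<And>F. finite F \<Longrightarrow> F \<subseteq> I \<Longrightarrow> (\<Sum>n\<in>F. cell_bound n powr (1 / (1 - \<alpha>))) \<le> S"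
  shows "primitive_Holder \<alpha> (h * S powr (1 - \<alpha>)) {0..1} (\<lambda>x. if x \<in> (\<Union>n\<in>I. {c n<..<d n}) then Koopman \<psi> x else 0)"
    (is "primitive_Holder _ _ _ ?g")
proof -
  have S0: "0 \<le> S" using S[of "{}"] by simp
  have "primitive_Holder \<alpha> ((h powr (1 / (1 - \<alpha>)) * S) powr (1 - \<alpha>)) {0..1} ?g"
  proof (rule primitive_Holder_glue_cells[where I=I and c=c and d=d and b="\<lambda>n. h * cell_bound n", OF _ _ _ _ _ _ \<alpha>])
    show "bounded_borel ?g" by (intro bounded_borel_restrict Koopman_bounded_borel \<psi> borel_open open_UN) auto
    show "disjoint_family_on (\<lambda>n. {c n<..<d n}) I" using dis by (rule disjoint_family_on_mono[rotated]) simp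
    show "\<exists>n\<in>I. x \<in> {c n<..<d n}" if "?g x \<noteq> 0" for x using that by (auto split: if_splits)
    show "0 \<le> h * cell_bound n" for n using h cell_bound_nonneg by simp
    show "norm (integral {s..t} ?g) \<le> h * cell_bound n * (t - s) powr \<alpha>"
      if "n \<in> I" "c n < s" "s \<le> t" "t < d n" for n s t
    proof -
      have "integral {s..t} ?g = integral {s..t} (Koopman \<psi>)" by (rule integral_cong) (use that in auto)
      then show ?thesis using cell_estimate[OF that(2-4) \<psi> h] by simp
    qed
    fix F assume F: "finite F" "F \<subseteq> I"
    have "(\<Sum>n\<in>F. (h * cell_bound n) powr (1 / (1 - \<alpha>))) = h powr (1 / (1 - \<alpha>)) * (\<Sum>n\<in>F. cell_bound n powr (1 / (1 - \<alpha>)))"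
      using h cell_bound_nonneg by (simp add: powr_mult sum_distrib_left)
    also have "\<dots> \<le> h powr (1 / (1 - \<alpha>)) * S" by (intro mult_left_mono S F) auto
    finally show "(\<Sum>n\<in>F. (h * cell_bound n) powr (1 / (1 - \<alpha>))) \<le> h powr (1 / (1 - \<alpha>)) * S" .
  qed
  moreover have "(h powr (1 / (1 - \<alpha>)) * S) powr (1 - \<alpha>) = h * S powr (1 - \<alpha>)"
    using h S0 \<alpha> by (simp add: powr_mult powr_powr)
  ultimately show ?thesis by simp
qed

lemma growth_nonneg: "0 \<le> growth" by (simp add: growth_def)

lemma Koopman_Holder:
  assumes \<psi>: "bounded_borel \<psi>" and h: "0 \<le> h" "primitive_Holder \<alpha> h {0..1} \<psi>"
  shows "primitive_Holder \<alpha> (growth * h) {0..1} (Koopman \<psi>)"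
proof -
  have "primitive_Holder \<alpha> (h * (\<Sum>n. cell_bound n powr (1 / (1 - \<alpha>))) powr (1 - \<alpha>)) {0..1}
     (\<lambda>x. if x \<in> (\<Union>n\<in>UNIV. {c n<..<d n}) then Koopman \<psi> x else 0)"
    by (rule Koopman_restricted_Holder[OF \<psi> h]) (intro sum_le_suminf cell_bound_summable, auto)
  moreover have "(\<lambda>x. if x \<in> (\<Union>n\<in>UNIV. {c n<..<d n}) then Koopman \<psi> x else 0) = Koopman \<psi>"
    unfolding \<Omega>_def[symmetric] by (auto simp: Koopman_def)
  ultimately show ?thesis by (simp add: growth_def mult.commute)
qed

lemma Koopman_tail:
  assumes \<tau>: "0 < \<tau>"
  obtains N where "\<And>\<psi> h. bounded_borel \<psi> \<Longrightarrow> 0 \<le> h \<Longrightarrow> primitive_Holder \<alpha> h {0..1} \<psi> \<Longrightarrow>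
    primitive_Holder \<alpha> (\<tau> * h) {0..1} (\<lambda>x. if x \<in> (\<Union>n\<in>{N..}. {c n<..<d n}) then Koopman \<psi> x else 0)"
proof -
  let ?a = "\<lambda>n. cell_bound n powr (1 / (1 - \<alpha>))"
  define S where "S = \<tau> powr (1 / (1 - \<alpha>))"
  have S: "0 < S" "S powr (1 - \<alpha>) = \<tau>" using \<tau> \<alpha> by (auto simp: S_def powr_powr)
  obtain N where N: "\<And>n. N \<le> n \<Longrightarrow> norm (\<Sum>i. ?a (i + n)) < S"
    by (rule exE[OF suminf_exist_split[OF S(1) cell_bound_summable]]) (rule that, drule spec, drule mp)
  have sh: "summable (\<lambda>i. ?a (i + N))" using cell_bound_summable by (rule summable_ignore_initial_segment)
  show thesis
  proof (rule that)
    fix \<psi> h assume \<psi>: "bounded_borel \<psi>" and h: "0 \<le> (h::real)" "primitive_Holder \<alpha> h {0..1} \<psi>"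
    have "primitive_Holder \<alpha> (h * S powr (1 - \<alpha>)) {0..1} (\<lambda>x. if x \<in> (\<Union>n\<in>{N..}. {c n<..<d n}) then Koopman \<psi> x else 0)"
    proof (rule Koopman_restricted_Holder[OF \<psi> h])
      fix F assume F: "finite F" "F \<subseteq> {N..}"
      have F': "n - N + N = n" if "n \<in> F" for n using that F(2) by auto
      have "inj_on (\<lambda>n. n - N) F" by (rule inj_onI) (metis F')
      then have "(\<Sum>i\<in>(\<lambda>n. n - N) ` F. ?a (i + N)) = (\<Sum>n\<in>F. ?a (n - N + N))"
        by (simp add: sum.reindex del: add_diff_cancel le_add_diff_inverse2)
      then have "(\<Sum>n\<in>F. ?a n) = (\<Sum>i\<in>(\<lambda>n. n - N) ` F. ?a (i + N))"
        using F' by (simp cong: sum.cong)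
      also have "\<dots> \<le> (\<Sum>i. ?a (i + N))" by (rule sum_le_suminf[OF sh]) (use F in auto)
      also have "\<dots> \<le> S" using N[of N] by simp
      finally show "(\<Sum>n\<in>F. ?a n) \<le> S" .
    qed
    then show "primitive_Holder \<alpha> (\<tau> * h) {0..1} (\<lambda>x. if x \<in> (\<Union>n\<in>{N..}. {c n<..<d n}) then Koopman \<psi> x else 0)"
      unfolding S(2) by (simp add: mult.commute)
  qed
qed

end

section \<open>Iterates of the Koopman operator\<close>

lemma open_order_convex_eq_Ioo:
  fixes S :: "real set"
  assumes S: "open S" "\<And>a b x. a \<in> S \<Longrightarrow> b \<in> S \<Longrightarrow> a \<le> x \<Longrightarrow> x \<le> b \<Longrightarrow> x \<in> S" "S \<subseteq> {0..1}"
  shows "\<exists>l r. 0 \<le> l \<and> l \<le> r \<and> r \<le> 1 \<and> S = {l<..<r}"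
proof (cases "S = {}")
  case True
  then show ?thesis by (intro exI[of _ 0]) auto
next
  case False
  have bdd: "bdd_below S" "bdd_above S" using S(3) by (auto intro: bdd_below_mono bdd_above_mono)
  define l r where "l = Inf S" and "r = Sup S"
  have 1: "x \<in> S" if "l < x" "x < r" for x
  proof -
    obtain a where a: "a \<in> S" "a < x" using cInf_lessD[OF False \<open>l < x\<close>[unfolded l_def]] by blast
    obtain b where b: "b \<in> S" "x < b" using less_cSupD[OF False \<open>x < r\<close>[unfolded r_def]] by blast
    show ?thesis by (rule S(2)[OF a(1) b(1)]) (use a b in auto)
  qed
  have 2: "l < x \<and> x < r" if x: "x \<in> S" for x
  proof -
    obtain e where e: "0 < e" "ball x e \<subseteq> S" using S(1) x openE by blast
    have "x - e / 2 \<in> S" "x + e / 2 \<in> S" using e by (auto simp: dist_real_def intro!: subsetD[OF e(2)])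
    then have "l \<le> x - e / 2" "x + e / 2 \<le> r" unfolding l_def r_def using bdd by (auto intro: cInf_lower cSup_upper)
    then show ?thesis using e(1) by linarith
  qed
  obtain x where x: "x \<in> S" using False by blast
  have "0 \<le> l" unfolding l_def by (rule cInf_greatest[OF False]) (use S(3) in auto)
  moreover have "r \<le> 1" unfolding r_def by (rule cSup_least[OF False]) (use S(3) in auto)
  moreover have "l \<le> r" using 2[OF x] by linarith
  moreover have "S = {l<..<r}" using 1 2 by auto
  ultimately show ?thesis by blast
qed

text \<open>
  Finite families of disjoint open subintervals of the unit interval; an empty interval may occur.
\<close>

definition cells :: "real set set \<Rightarrow> bool" where
  "cells \<J> \<longleftrightarrow> finite \<J> \<and> disjoint \<J> \<and> (\<forall>J\<in>\<J>. \<exists>l r. 0 \<le> l \<and> l \<le> r \<and> r \<le> 1 \<and> J = {l<..<r})"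

lemma cells_open: "cells \<J> \<Longrightarrow> open (\<Union>\<J>)"
  unfolding cells_def by (intro open_Union) auto

lemma primitive_Holder_add:
  assumes "bounded_borel \<psi>" "bounded_borel \<phi>" "primitive_Holder \<alpha> H S \<psi>" "primitive_Holder \<alpha> K S \<phi>"
  shows "primitive_Holder \<alpha> (H + K) S (\<lambda>x. \<psi> x + \<phi> x)"
proof (rule primitive_HolderI)
  fix u v :: real assume uv: "u \<le> v" "{u..v} \<subseteq> S"
  have "integral {u..v} (\<lambda>x. \<psi> x + \<phi> x) = integral {u..v} \<psi> + integral {u..v} \<phi>"
    by (rule Henstock_Kurzweil_Integration.integral_add) (auto intro: bounded_borel_integrable assms)
  then show "norm (integral {u..v} (\<lambda>x. \<psi> x + \<phi> x)) \<le> (H + K) * (v - u) powr \<alpha>"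
    using norm_triangle_mono[OF primitive_HolderD[OF assms(3) uv] primitive_HolderD[OF assms(4) uv]]
    by (simp add: algebra_simps)
qed

lemma primitive_Holder_neg: "primitive_Holder \<alpha> H S \<psi> \<Longrightarrow> primitive_Holder \<alpha> H S (\<lambda>x. - \<psi> x)"
  unfolding primitive_Holder_def by (simp add: Henstock_Kurzweil_Integration.integral_neg)

lemma primitive_Holder_cong:
  assumes "primitive_Holder \<alpha> H S \<psi>" "finite G" "\<And>x. x \<in> S - G \<Longrightarrow> \<phi> x = \<psi> x"
  shows "primitive_Holder \<alpha> H S \<phi>"
proof (rule primitive_HolderI)
  fix u v :: real assume uv: "u \<le> v" "{u..v} \<subseteq> S"
  have "integral {u..v} \<phi> = integral {u..v} \<psi>"
    by (rule integral_spike[OF negligible_finite[OF assms(2)]]) (use assms(3) uv in auto)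
  then show "norm (integral {u..v} \<phi>) \<le> H * (v - u) powr \<alpha>" using primitive_HolderD[OF assms(1) uv] by simp
qed

context branches
begin

lemma Koopman_iter_bounded_borel: "bounded_borel \<psi> \<Longrightarrow> bounded_borel ((Koopman ^^ n) \<psi>)"
  by (induction n) (auto intro: Koopman_bounded_borel)

lemma Koopman_iter_Holder:
  assumes "bounded_borel \<psi>" "primitive_Holder \<alpha> 1 {0..1} \<psi>"
  shows "primitive_Holder \<alpha> (growth ^ n) {0..1} ((Koopman ^^ n) \<psi>)"
proof (induction n)
  case (Suc n)
  have "primitive_Holder \<alpha> (growth * growth ^ n) {0..1} (Koopman ((Koopman ^^ n) \<psi>))"
    by (rule Koopman_Holder[OF Koopman_iter_bounded_borel[OF assms(1)] _ Suc]) (simp add: growth_nonneg)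
  then show ?case by simp
qed (use assms in simp)

text \<open>
  A branch is injective and continuous, hence monotone, so preimages of intervals are intervals.
\<close>

lemma cell_preimage:
  "\<exists>l' r'. 0 \<le> l' \<and> l' \<le> r' \<and> r' \<le> 1 \<and> {c k<..<d k} \<inter> f -` {l<..<u} \<inter> {x<..<y} = {l'<..<r'}"
proof (rule open_order_convex_eq_Ioo)
  have ck: "{c k<..<d k} \<subseteq> \<Omega>" by (auto intro: \<Omega>I)
  show "open ({c k<..<d k} \<inter> f -` {l<..<u} \<inter> {x<..<y})"
    by (intro open_Int continuous_open_preimage continuous_on_subset[OF f_cont ck]) auto
  show "{c k<..<d k} \<inter> f -` {l<..<u} \<inter> {x<..<y} \<subseteq> {0..1}" using cd(1)[of k] cd(3)[of k] by auto
  fix a b z assume a: "a \<in> {c k<..<d k} \<inter> f -` {l<..<u} \<inter> {x<..<y}"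
    and b: "b \<in> {c k<..<d k} \<inter> f -` {l<..<u} \<inter> {x<..<y}" and z: "a \<le> z" "z \<le> b"
  show "z \<in> {c k<..<d k} \<inter> f -` {l<..<u} \<inter> {x<..<y}"
  proof (cases "z = a \<or> z = b")
    case False
    then have "a < z" "z < b" using z by auto
    moreover have sub: "{a..b} \<subseteq> {c k<..<d k}" using a b by auto
    ultimately have "(f a < f z \<and> f z < f b) \<or> (f b < f z \<and> f z < f a)"
      by (intro continuous_inj_imp_mono continuous_on_subset[OF f_cont] inj_on_subset[OF f_inj sub])
         (use sub ck in auto)
    then show ?thesis using a b z by auto
  qed (use a b in auto)
qed

text \<open>
  Induction on n. Split K^n \<psi> into its part \<psi>1 on the cells and the small rest \<psi>2. The new
  cells are the sets of points of one of the first N branches that are mapped into a given old cell and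
  lie in a given short interval of a grid; there \<open>fine_bound\<close> applies to \<psi>1. Off the new cells
  remain K \<psi>2, which is small because K is bounded, and the part of K \<psi>1 on the branches from the
  N-th on, which is small by \<open>Koopman_tail\<close>. Every step thus uses only estimates for the map
  itself, never for its iterates.
\<close>

lemma iterate_decomposition:
  assumes \<kappa>: "Q < \<kappa>" and \<epsilon>: "0 < \<epsilon>"
  shows "\<exists>\<J>. cells \<J> \<and> (\<forall>\<psi>. bounded_borel \<psi> \<longrightarrow> primitive_Holder \<alpha> 1 {0..1} \<psi> \<longrightarrow>
    (\<forall>J\<in>\<J>. primitive_Holder \<alpha> (\<kappa> ^ n) J ((Koopman ^^ n) \<psi>)) \<and>
    primitive_Holder \<alpha> \<epsilon> {0..1} (\<lambda>x. if x \<in> \<Union>\<J> then 0 else (Koopman ^^ n) \<psi> x))"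
  using \<epsilon>
proof (induction n arbitrary: \<epsilon>)
  case 0
  show ?case
  proof (intro exI[of _ "{{0<..<1}}"] conjI allI impI ballI)
    have "\<exists>l r. 0 \<le> l \<and> l \<le> r \<and> r \<le> 1 \<and> {0<..<1::real} = {l<..<r}"
      by (rule exI[of _ 0], rule exI[of _ 1]) simp
    then show "cells {{0<..<1}}" unfolding cells_def by simp
    fix \<psi> assume \<psi>: "bounded_borel \<psi>" "primitive_Holder \<alpha> 1 {0..1} \<psi>"
    show "primitive_Holder \<alpha> (\<kappa> ^ 0) J ((Koopman ^^ 0) \<psi>)" if "J \<in> {{0<..<1}}" for J
      using that by (auto intro: primitive_Holder_subset[OF \<psi>(2)])
    have "primitive_Holder \<alpha> \<epsilon> {0..1} (\<lambda>x. 0 :: complex)" using 0 by (simp add: primitive_Holder_def)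
    then show "primitive_Holder \<alpha> \<epsilon> {0..1} (\<lambda>x. if x \<in> \<Union>{{0<..<1}} then 0 else (Koopman ^^ 0) \<psi> x)"
      by (rule primitive_Holder_cong[of _ _ _ _ "{0, 1}"]) auto
  qed
next
  case (Suc n)
  have \<kappa>0: "0 < \<kappa>" using \<kappa> Q by linarith
  define \<epsilon>' where "\<epsilon>' = \<epsilon> / (2 * (growth + 1))"
  have t0: "0 \<le> growth" by (rule growth_nonneg)
  have \<epsilon>': "0 < \<epsilon>'" "growth * \<epsilon>' \<le> \<epsilon> / 2" using Suc.prems t0 by (auto simp: \<epsilon>'_def field_simps)
  define T where "T = growth ^ n + \<epsilon>'"
  have T: "0 < T" using \<epsilon>' t0 by (simp add: T_def add_nonneg_pos)
  obtain \<J> where \<J>: "cells \<J>"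
    and IH1: "\<And>\<psi> J. bounded_borel \<psi> \<Longrightarrow> primitive_Holder \<alpha> 1 {0..1} \<psi> \<Longrightarrow> J \<in> \<J> \<Longrightarrow> primitive_Holder \<alpha> (\<kappa> ^ n) J ((Koopman ^^ n) \<psi>)"
    and IH2: "\<And>\<psi>. bounded_borel \<psi> \<Longrightarrow> primitive_Holder \<alpha> 1 {0..1} \<psi> \<Longrightarrow>
       primitive_Holder \<alpha> \<epsilon>' {0..1} (\<lambda>x. if x \<in> \<Union>\<J> then 0 else (Koopman ^^ n) \<psi> x)"
    using Suc.IH[OF \<epsilon>'(1)] by blast
  \<comment> \<open>T bounds the Hoelder constant of \<psi>1, so the tail contributes at most \<epsilon> / 2\<close>
  define \<tau> where "\<tau> = \<epsilon> / 2 / T"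
  have \<tau>: "0 < \<tau>" "\<tau> * T = \<epsilon> / 2" using Suc.prems T by (auto simp: \<tau>_def)
  obtain N where N: "\<And>\<psi> h. bounded_borel \<psi> \<Longrightarrow> 0 \<le> h \<Longrightarrow> primitive_Holder \<alpha> h {0..1} \<psi> \<Longrightarrow>
    primitive_Holder \<alpha> (\<tau> * h) {0..1} (\<lambda>x. if x \<in> (\<Union>n\<in>{N..}. {c n<..<d n}) then Koopman \<psi> x else 0)"
    by (rule Koopman_tail[OF \<tau>(1)]) (rule that)
  obtain \<eta> where \<eta>: "0 < \<eta>"
    "\<And>n s t \<psi> h. c n < s \<Longrightarrow> s \<le> t \<Longrightarrow> t < d n \<Longrightarrow> t - s < \<eta> \<Longrightarrow> bounded_borel \<psi> \<Longrightarrow> 0 \<le> h \<Longrightarrow>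
       primitive_Holder \<alpha> h (f ` {s..t}) \<psi> \<Longrightarrow> norm (integral {s..t} (Koopman \<psi>)) \<le> \<kappa> * h * (t - s) powr \<alpha>"
    by (rule fine_bound[OF \<kappa>]) (rule that)
  obtain g where g: "0 < g" "1 / real g < \<eta>"
    using reals_Archimedean[OF \<eta>(1)] by (metis inverse_eq_divide zero_less_Suc)
  define I where "I i = {real i / real g<..<real (i + 1) / real g}" for i
  \<comment> \<open>the grid points belong to no grid interval; they form a null set\<close>
  define G where "G = (\<lambda>i. real i / real g) ` {..g}"
  have fG: "finite G" by (simp add: G_def)
  have grid: "\<exists>i<g. x \<in> I i" if x: "x \<in> {0..1}" "x \<notin> G" for x
  proof -
    define i where "i = nat \<lfloor>x * real g\<rfloor>"
    have xg: "0 \<le> x * real g" using x by auto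
    have i: "real i \<le> x * real g" "x * real g < real i + 1" unfolding i_def using xg by linarith+
    have "1 = real g / real g" using g by simp
    then have "1 \<in> G" unfolding G_def by blast
    then have "x < 1" using x by (metis atLeastAtMost_iff order_le_less)
    then have "x * real g < real g" using g by simp
    then have ig: "i < g" using i by linarith
    have "x \<noteq> real i / real g" using x(2) ig by (auto simp: G_def)
    then have "real i \<noteq> x * real g" using g by auto
    then have "x \<in> I i" unfolding I_def using i g by (auto simp: field_simps)
    then show ?thesis using ig by blast
  qed
  define S where "S k J i = {c k<..<d k} \<inter> f -` J \<inter> I i" for k J i
  define \<J>' where "\<J>' = (\<lambda>(k, J, i). S k J i) ` ({..<N} \<times> \<J> \<times> {..<g})"
  have memS: "\<exists>k J i. A = S k J i \<and> J \<in> \<J>" if "A \<in> \<J>'" for A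
    using that unfolding \<J>'_def by auto
  have disI: "i = j" if "x \<in> I i" "x \<in> I j" for i j x
  proof -
    have "real i < x * real g" "x * real g < real i + 1" "real j < x * real g" "x * real g < real j + 1"
      using that g by (auto simp: I_def field_simps)
    then show ?thesis by linarith
  qed
  have cells': "cells \<J>'" unfolding cells_def
  proof (intro conjI ballI)
    show "finite \<J>'" unfolding \<J>'_def using \<J> by (auto simp: cells_def)
    show "disjoint \<J>'"
    proof (rule disjointI)
      fix A B assume mem: "A \<in> \<J>'" "B \<in> \<J>'" and AB: "A \<noteq> B"
      obtain k J i where A: "A = S k J i" "J \<in> \<J>" using memS[OF mem(1)] by blast
      obtain k' J' i' where B: "B = S k' J' i'" "J' \<in> \<J>" using memS[OF mem(2)] by blast
      show "A \<inter> B = {}"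
      proof (rule ccontr)
        assume "A \<inter> B \<noteq> {}"
        then obtain x where x: "x \<in> S k J i" "x \<in> S k' J' i'" using A B by blast
        have "k = k'" using x dis unfolding disjoint_family_on_def S_def by blast
        moreover have "J = J'" using x A(2) B(2) \<J> unfolding cells_def S_def disjoint_def by blast
        moreover have "i = i'" using x disI unfolding S_def by blast
        ultimately show False using AB A B by simp
      qed
    qed
    fix A assume "A \<in> \<J>'"
    then obtain k J i where A: "A = S k J i" "J \<in> \<J>" using memS by blast
    then obtain l r where J: "J = {l<..<r}" using \<J> unfolding cells_def by blast
    show "\<exists>l r. 0 \<le> l \<and> l \<le> r \<and> r \<le> 1 \<and> A = {l<..<r}"
      unfolding A S_def J I_def by (rule cell_preimage)
  qed
  have memJ': "x \<in> \<Union>\<J>' \<longleftrightarrow> (\<exists>k<N. x \<in> {c k<..<d k}) \<and> f x \<in> \<Union>\<J> \<and> (\<exists>i<g. x \<in> I i)" for x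
    unfolding \<J>'_def S_def by auto
  show ?case
  proof (intro exI[of _ \<J>'] conjI allI impI ballI cells')
    fix \<psi> assume \<psi>: "bounded_borel \<psi>" "primitive_Holder \<alpha> 1 {0..1} \<psi>"
    define \<psi>n where "\<psi>n = (Koopman ^^ n) \<psi>"
    have bn: "bounded_borel \<psi>n" unfolding \<psi>n_def by (rule Koopman_iter_bounded_borel[OF \<psi>(1)])
    have iter: "(Koopman ^^ Suc n) \<psi> = Koopman \<psi>n" by (simp add: \<psi>n_def)
    show "primitive_Holder \<alpha> (\<kappa> ^ Suc n) A ((Koopman ^^ Suc n) \<psi>)" if A': "A \<in> \<J>'" for A
    proof (rule primitive_HolderI)
      obtain k J i where A: "A = S k J i" "J \<in> \<J>" using memS[OF A'] by blast
      fix s t assume st: "s \<le> t" "{s..t} \<subseteq> A"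
      then have "s \<in> A" "t \<in> A" by auto
      then have k: "c k < s" "t < d k" and "s \<in> I i" "t \<in> I i" unfolding A S_def by auto
      then have "t - s < 1 / real g" unfolding I_def by (auto simp: add_divide_distrib)
      then have "t - s < \<eta>" using g by linarith
      moreover have "f ` {s..t} \<subseteq> J" using st(2) unfolding A S_def by auto
      then have "primitive_Holder \<alpha> (\<kappa> ^ n) (f ` {s..t}) \<psi>n"
        unfolding \<psi>n_def by (rule primitive_Holder_subset[OF IH1[OF \<psi> A(2)]])
      ultimately have "norm (integral {s..t} (Koopman \<psi>n)) \<le> \<kappa> * \<kappa> ^ n * (t - s) powr \<alpha>"
        using k st(1) bn \<kappa>0 by (intro \<eta>(2)) auto
      then show "norm (integral {s..t} ((Koopman ^^ Suc n) \<psi>)) \<le> \<kappa> ^ Suc n * (t - s) powr \<alpha>" unfolding iter by simp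
    qed
    define \<psi>1 where "\<psi>1 x = (if x \<in> \<Union>\<J> then \<psi>n x else 0)" for x
    define \<psi>2 where "\<psi>2 x = (if x \<in> \<Union>\<J> then 0 else \<psi>n x)" for x
    have "\<psi>2 = (\<lambda>x. if x \<in> - \<Union>\<J> then \<psi>n x else 0)" by (auto simp: \<psi>2_def)
    then have b2: "bounded_borel \<psi>2"
      using bounded_borel_restrict[OF bn, of "- \<Union>\<J>"] cells_open[OF \<J>] by auto
    have b1: "bounded_borel \<psi>1" unfolding \<psi>1_def
      by (rule bounded_borel_restrict[OF bn]) (use cells_open[OF \<J>] in auto)
    have h2: "primitive_Holder \<alpha> \<epsilon>' {0..1} \<psi>2" unfolding \<psi>2_def \<psi>n_def by (rule IH2[OF \<psi>])
    have "bounded_borel (\<lambda>x. - \<psi>2 x)" using b2 by (auto simp: bounded_borel_def)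
    then have "primitive_Holder \<alpha> (growth ^ n + \<epsilon>') {0..1} (\<lambda>x. \<psi>n x + - \<psi>2 x)"
      by (rule primitive_Holder_add[OF bn _ Koopman_iter_Holder[OF \<psi>, of n, folded \<psi>n_def] primitive_Holder_neg[OF h2]])
    moreover have "(\<lambda>x. \<psi>n x + - \<psi>2 x) = \<psi>1" by (auto simp: \<psi>1_def \<psi>2_def)
    ultimately have h1: "primitive_Holder \<alpha> T {0..1} \<psi>1" by (simp add: T_def)
    have split: "\<psi>n = (\<lambda>x. \<psi>1 x + \<psi>2 x)" by (auto simp: \<psi>1_def \<psi>2_def)
    let ?tail = "\<lambda>x. if x \<in> (\<Union>n\<in>{N..}. {c n<..<d n}) then Koopman \<psi>1 x else 0"
    have bt: "bounded_borel ?tail" by (intro bounded_borel_restrict Koopman_bounded_borel b1 borel_open open_UN) auto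
    have "primitive_Holder \<alpha> (growth * \<epsilon>' + \<tau> * T) {0..1} (\<lambda>x. Koopman \<psi>2 x + ?tail x)"
      using T \<epsilon>' by (intro primitive_Holder_add Koopman_bounded_borel b2 bt N[OF b1 _ h1] Koopman_Holder[OF b2 _ h2]) auto
    then have "primitive_Holder \<alpha> (growth * \<epsilon>' + \<tau> * T) {0..1} (\<lambda>x. if x \<in> \<Union>\<J>' then 0 else Koopman \<psi>n x)"
    proof (rule primitive_Holder_cong[OF _ fG])
      fix x assume x: "x \<in> {0..1} - G"
      show "(if x \<in> \<Union>\<J>' then 0 else Koopman \<psi>n x) = Koopman \<psi>2 x + ?tail x"
      proof (cases "x \<in> \<Union>\<J>'")
        case True
        then obtain k where k: "k < N" "x \<in> {c k<..<d k}" and fx: "f x \<in> \<Union>\<J>" unfolding memJ' by blast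
        have "x \<notin> (\<Union>n\<in>{N..}. {c n<..<d n})"
        proof
          assume "x \<in> (\<Union>n\<in>{N..}. {c n<..<d n})"
          then obtain j where j: "N \<le> j" "x \<in> {c j<..<d j}" by auto
          then have "j = k" using k dis unfolding disjoint_family_on_def by blast
          then show False using j k by simp
        qed
        moreover have "Koopman \<psi>2 x = 0" using fx by (simp add: Koopman_def \<psi>2_def)
        ultimately show ?thesis using True by auto
      next
        case False
        have "Koopman \<psi>1 x = ?tail x"
        proof (cases "x \<in> (\<Union>n\<in>{N..}. {c n<..<d n})")
          case notail: False
          have "Koopman \<psi>1 x = 0"
          proof (cases "x \<in> \<Omega>")
            case True
            then obtain k where k: "x \<in> {c k<..<d k}" unfolding \<Omega>_def by blast
            then have "k < N" using notail by (meson UN_I atLeast_iff not_le)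
            have "\<exists>i<g. x \<in> I i" by (rule grid) (use x in auto)
            then have "f x \<notin> \<Union>\<J>" using False k \<open>k < N\<close> memJ'[of x] by blast
            then show ?thesis by (simp add: Koopman_def \<psi>1_def)
          qed (simp add: Koopman_def)
          then show ?thesis using notail by simp
        qed simp
        then show ?thesis using False unfolding split by (simp only: Koopman_add if_False add.commute)
      qed
    qed
    then have "primitive_Holder \<alpha> \<epsilon> {0..1} (\<lambda>x. if x \<in> \<Union>\<J>' then 0 else Koopman \<psi>n x)"
      by (rule primitive_Holder_mono) (use \<epsilon>' \<tau> in simp)
    then show "primitive_Holder \<alpha> \<epsilon> {0..1} (\<lambda>x. if x \<in> \<Union>\<J>' then 0 else (Koopman ^^ Suc n) \<psi> x)"
      unfolding iter .
  qed
qed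

end

section \<open>Averaging over finitely many cells\<close>

text \<open>
  An empty cell has measure 0 and average 0 by the convention for division.
\<close>

definition cell_avg :: "real set \<Rightarrow> (real \<Rightarrow> complex) \<Rightarrow> complex" where
  "cell_avg J h = (LINT x|leb01. indicator J x * h x) / of_real (measure lborel J)"

definition averaging :: "real set set \<Rightarrow> (real \<Rightarrow> complex) \<Rightarrow> real \<Rightarrow> complex" where
  "averaging \<J> h x = (\<Sum>J\<in>\<J>. cell_avg J h * indicator J x)"

lemma cells_finite: "cells \<J> \<Longrightarrow> finite \<J>" by (simp add: cells_def)

lemma cells_obtain:
  assumes "cells \<J>" "J \<in> \<J>"
  obtains l r where "0 \<le> l" "l \<le> r" "r \<le> 1" "J = {l<..<r}"
  using assms unfolding cells_def by blast

lemma indicator_mult_integrable: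
  fixes h :: "real \<Rightarrow> complex"
  assumes "integrable leb01 h" shows "integrable leb01 (\<lambda>x. indicator {l<..<r} x * h x)"
    "integrable leb01 (\<lambda>x. h x * indicator {l<..<r} x)"
proof -
  have "\<exists>B. \<forall>x. norm (indicator {l<..<r} x :: complex) \<le> B" by (rule exI[of _ 1]) (simp add: indicator_def)
  then have "bounded_borel (indicator {l<..<r})" by (simp add: bounded_borel_def)
  then have m: "(indicator {l<..<r} :: real \<Rightarrow> complex) \<in> borel_measurable leb01" by (rule bounded_borel_leb01)
  show "integrable leb01 (\<lambda>x. h x * indicator {l<..<r} x)"
    by (rule integrable_mult_bounded[OF assms m, of 1]) (auto simp: indicator_def)
  then show "integrable leb01 (\<lambda>x. indicator {l<..<r} x * h x)" by (simp add: mult.commute)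
qed

lemma LINT_indicator:
  fixes h :: "real \<Rightarrow> complex"
  assumes h: "integrable leb01 h" and lr: "0 \<le> l" "r \<le> 1"
  shows "(LINT x|leb01. indicator {l<..<r} x * h x) = integral {l..r} h"
proof -
  have "(LINT x|leb01. indicator {l<..<r} x * h x) = integral {0..1} (\<lambda>x. indicator {l<..<r} x * h x)"
    by (rule leb01_integral(2)[OF indicator_mult_integrable(1)[OF h], symmetric])
  also have "\<dots> = integral {0..1} (\<lambda>x. if x \<in> {l<..<r} then h x else 0)"
    by (rule integral_cong) (auto simp: indicator_def)
  also have "\<dots> = integral {max l 0..min r 1} h" by (rule integral_restrict_Ioo)
  finally show ?thesis unfolding max.absorb1[OF lr(1)] min.absorb1[OF lr(2)] .
qed

lemma averaging_on_cell:
  assumes "cells \<J>" "J \<in> \<J>" "x \<in> J" shows "averaging \<J> h x = cell_avg J h"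
proof -
  have "averaging \<J> h x = (\<Sum>K\<in>\<J>. if K = J then cell_avg J h else 0)"
    unfolding averaging_def
  proof (rule sum.cong[OF refl])
    fix K assume K: "K \<in> \<J>"
    have "x \<notin> K" if "K \<noteq> J" using assms K that unfolding cells_def disjoint_def by blast
    then show "cell_avg K h * indicator K x = (if K = J then cell_avg J h else 0)"
      using assms(3) by (auto simp: indicator_def)
  qed
  also have "\<dots> = cell_avg J h" using assms cells_finite by simp
  finally show ?thesis .
qed

lemma averaging_off_cells: "x \<notin> \<Union>\<J> \<Longrightarrow> averaging \<J> h x = 0"
  unfolding averaging_def by (auto intro!: sum.neutral)

lemma averaging_integrable:
  assumes "cells \<J>" shows "integrable leb01 (averaging \<J> h)"
proof -
  have "integrable leb01 (\<lambda>x. cell_avg J h * indicator J x)" if K: "J \<in> \<J>" for J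
  proof -
    obtain l r where "J = {l<..<r}" by (rule cells_obtain[OF assms K]) (rule that)
    moreover have "integrable leb01 (\<lambda>_. cell_avg J h)"
      by (rule integrable_leb01_bounded[where B="norm (cell_avg J h)"]) auto
    ultimately show ?thesis using indicator_mult_integrable(2) by blast
  qed
  then show ?thesis unfolding averaging_def[abs_def] by (intro Bochner_Integration.integrable_sum)
qed

text \<open>
  The averaging operator is symmetric, which transfers it from h to the test function.
\<close>

lemma averaging_symmetric:
  assumes J: "cells \<J>" and h: "integrable leb01 h" and \<psi>: "bounded_borel \<psi>"
  shows "(LINT x|leb01. averaging \<J> h x * \<psi> x) = (LINT x|leb01. h x * averaging \<J> \<psi> x)"
proof -
  obtain B where B: "0 < B" "\<And>x. norm (\<psi> x) \<le> B" by (rule bounded_borel_bound[OF \<psi>]) (rule that)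
  have \<psi>i: "integrable leb01 \<psi>" by (rule integrable_leb01_bounded[OF bounded_borel_leb01[OF \<psi>] B(2)])
  have i: "integrable leb01 (\<lambda>x. indicator J x * \<psi> x)" "integrable leb01 (\<lambda>x. indicator J x * h x)" if K: "J \<in> \<J>" for J
  proof -
    obtain l r where "J = {l<..<r}" by (rule cells_obtain[OF J K]) (rule that)
    then show "integrable leb01 (\<lambda>x. indicator J x * \<psi> x)" "integrable leb01 (\<lambda>x. indicator J x * h x)"
      using indicator_mult_integrable(1)[OF \<psi>i] indicator_mult_integrable(1)[OF h] by auto
  qed
  have "(LINT x|leb01. averaging \<J> h x * \<psi> x) = (LINT x|leb01. (\<Sum>J\<in>\<J>. cell_avg J h * (indicator J x * \<psi> x)))"
    unfolding averaging_def by (simp add: sum_distrib_right mult.assoc)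
  also have "\<dots> = (\<Sum>J\<in>\<J>. cell_avg J h * (LINT x|leb01. indicator J x * \<psi> x))"
    by (subst Bochner_Integration.integral_sum) (use i in auto)
  also have "\<dots> = (\<Sum>J\<in>\<J>. cell_avg J \<psi> * (LINT x|leb01. indicator J x * h x))"
    by (simp add: cell_avg_def mult.commute)
  also have "\<dots> = (LINT x|leb01. (\<Sum>J\<in>\<J>. cell_avg J \<psi> * (indicator J x * h x)))"
    by (subst Bochner_Integration.integral_sum) (use i in auto)
  also have "\<dots> = (LINT x|leb01. h x * averaging \<J> \<psi> x)"
    unfolding averaging_def by (simp add: sum_distrib_left mult_ac)
  finally show ?thesis .
qed

lemma averaging_bounded_borel:
  assumes J: "cells \<J>" shows "bounded_borel (averaging \<J> \<psi>)"
proof -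
  have "averaging \<J> \<psi> \<in> borel_measurable borel"
    unfolding averaging_def[abs_def]
  proof (intro borel_measurable_sum)
    fix K assume K: "K \<in> \<J>"
    obtain l r where "K = {l<..<r}" by (rule cells_obtain[OF J K]) (rule that)
    then show "(\<lambda>x. cell_avg K \<psi> * indicator K x) \<in> borel_measurable borel" by simp
  qed
  moreover have "norm (averaging \<J> \<psi> x) \<le> (\<Sum>K\<in>\<J>. norm (cell_avg K \<psi>))" for x
    unfolding averaging_def
    by (rule order_trans[OF norm_sum]) (auto intro!: sum_mono simp: norm_mult indicator_def)
  ultimately show ?thesis unfolding bounded_borel_def by blast
qed

lemma centred_cell_bound:
  assumes \<psi>: "bounded_borel \<psi>" and lr: "0 \<le> l" "r \<le> 1" and \<alpha>: "0 < \<alpha>" "\<alpha> < 1" and b: "0 \<le> b"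
    and H: "primitive_Holder \<alpha> b {l<..<r} \<psi>" and st: "l \<le> s" "s \<le> t" "t \<le> r"
  shows "norm (integral {s..t} (\<lambda>x. \<psi> x - cell_avg {l<..<r} \<psi>)) \<le> 2 * b * (t - s) powr \<alpha>"
    and "integral {l..r} (\<lambda>x. \<psi> x - cell_avg {l<..<r} \<psi>) = 0"
proof -
  obtain B where B: "0 < B" "\<And>x. norm (\<psi> x) \<le> B" by (rule bounded_borel_bound[OF \<psi>]) (rule that)
  have \<psi>i: "integrable leb01 \<psi>" by (rule integrable_leb01_bounded[OF bounded_borel_leb01[OF \<psi>] B(2)])
  let ?a = "cell_avg {l<..<r} \<psi>"
  have a: "?a = integral {l..r} \<psi> / of_real (r - l)"
    unfolding cell_avg_def LINT_indicator[OF \<psi>i lr] using st by simp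
  have gi: "\<psi> integrable_on {u..v}" for u v by (rule bounded_borel_integrable[OF \<psi>])
  have int: "integral {u..v} (\<lambda>x. \<psi> x - ?a) = integral {u..v} \<psi> - of_real (v - u) * ?a" if "u \<le> v" for u v
    using that by (subst Henstock_Kurzweil_Integration.integral_diff[OF gi]) (auto simp: scaleR_conv_of_real)
  have cb: "norm (integral {u..v} \<psi>) \<le> b * (v - u) powr \<alpha>" if uv: "l \<le> u" "u \<le> v" "v \<le> r" for u v
    by (rule closed_cell_bound[OF gi uv(2) _ b \<alpha>(1)]) (rule primitive_HolderD[OF H], use uv in auto)
  show "integral {l..r} (\<lambda>x. \<psi> x - ?a) = 0"
    using st by (subst int) (auto simp: a)
  have "norm (of_real (t - s) * ?a) \<le> b * (t - s) powr \<alpha>"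
  proof (cases "s = t")
    case False
    then have p: "0 < t - s" "t - s \<le> r - l" using st by auto
    have "norm (of_real (t - s) * ?a) = (t - s) * (norm (integral {l..r} \<psi>) / (r - l))"
      unfolding a norm_mult norm_divide norm_of_real using p by simp
    also have "\<dots> \<le> (t - s) * (b * (r - l) powr \<alpha> / (r - l))"
      using p by (intro mult_left_mono divide_right_mono cb) (use st in auto)
    also have "\<dots> = b * ((t - s) * (r - l) powr (\<alpha> - 1))" using p by (simp add: powr_diff)
    also have "\<dots> \<le> b * ((t - s) * (t - s) powr (\<alpha> - 1))"
      using p b \<alpha> by (intro mult_left_mono powr_mono2') auto
    also have "(t - s) * (t - s) powr (\<alpha> - 1) = (t - s) powr \<alpha>" using p by (simp add: powr_diff)
    finally show ?thesis .
  qed simp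
  then show "norm (integral {s..t} (\<lambda>x. \<psi> x - ?a)) \<le> 2 * b * (t - s) powr \<alpha>"
    unfolding int[OF st(2)] using norm_triangle_ineq4[of "integral {s..t} \<psi>" "of_real (t - s) * ?a"] cb[OF st]
    by (simp add: algebra_simps)
qed

text \<open>
  The factor 4: subtracting the average of \<psi> on a cell doubles the Hoelder constant there and makes
  the integral over the whole cell vanish. So only the at most two cells containing an end point of
  [u, v] contribute, each at most 2 b (v - u)^\<alpha>.
\<close>

lemma averaging_Holder:
  assumes J: "cells \<J>" and \<psi>: "bounded_borel \<psi>" and \<alpha>: "0 < \<alpha>" "\<alpha> < 1" and b: "0 \<le> b"
    and cell: "\<And>K. K \<in> \<J> \<Longrightarrow> primitive_Holder \<alpha> b K \<psi>"
    and rest: "primitive_Holder \<alpha> \<epsilon> {0..1} (\<lambda>x. if x \<in> \<Union>\<J> then 0 else \<psi> x)"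
  shows "primitive_Holder \<alpha> (4 * b + \<epsilon>) {0..1} (\<lambda>x. \<psi> x - averaging \<J> \<psi> x)"
proof -
  obtain lo hi where lh: "\<And>K. K \<in> \<J> \<Longrightarrow> 0 \<le> lo K \<and> lo K \<le> hi K \<and> hi K \<le> 1 \<and> K = {lo K<..<hi K}"
    using J unfolding cells_def by metis
  have eqK: "K = {lo K<..<hi K}" if "K \<in> \<J>" for K using lh[OF that] by blast
  have lohi: "0 \<le> lo K \<and> lo K \<le> hi K \<and> hi K \<le> 1 \<and> (\<forall>x. x \<in> K \<longleftrightarrow> lo K < x \<and> x < hi K)" if "K \<in> \<J>" for K
    using lh[OF that] by (metis greaterThanLessThan_iff)
  have lohi01: "0 \<le> lo K" "hi K \<le> 1" "lo K \<le> hi K" if "K \<in> \<J>" for K using lh[OF that] by auto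
  have cell': "primitive_Holder \<alpha> b {lo K<..<hi K} \<psi>" if "K \<in> \<J>" for K
    using cell[OF that] eqK[OF that] by simp
  note finJ = cells_finite[OF J]
  define g where "g x = (if x \<in> \<Union>\<J> then \<psi> x - averaging \<J> \<psi> x else 0)" for x
  have opn: "\<Union>\<J> \<in> sets borel" using cells_open[OF J] by simp
  have bneg: "bounded_borel (\<lambda>x. \<psi> x + - averaging \<J> \<psi> x)"
    by (rule bounded_borel_add[OF \<psi>]) (use averaging_bounded_borel[OF J, of \<psi>] in \<open>auto simp: bounded_borel_def\<close>)
  then have bg: "bounded_borel g" unfolding g_def using bounded_borel_restrict[OF _ opn] by fastforce
  have gi: "g integrable_on {u..v}" for u v by (rule bounded_borel_integrable[OF bg])
  have gK: "integral {s..t} g = integral {s..t} (\<lambda>x. \<psi> x - cell_avg {lo K<..<hi K} \<psi>)"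
    if K: "K \<in> \<J>" and st: "lo K \<le> s" "t \<le> hi K" for K s t
  proof -
    have "integral {s<..<t} g = integral {s<..<t} (\<lambda>x. \<psi> x - cell_avg {lo K<..<hi K} \<psi>)"
    proof (rule integral_cong)
      fix x assume x: "x \<in> {s<..<t}"
      then have "x \<in> K" using lohi[OF K] st by auto
      then have "g x = \<psi> x - cell_avg K \<psi>" using K averaging_on_cell[OF J K] by (auto simp: g_def)
      then show "g x = \<psi> x - cell_avg {lo K<..<hi K} \<psi>" using eqK[OF K] by simp
    qed
    then show ?thesis by (simp only: integral_open_interval_real)
  qed
  have loc: "norm (integral {s..t} g) \<le> 2 * b * (t - s) powr \<alpha>"
    if K: "K \<in> \<J>" and st: "lo K \<le> s" "s \<le> t" "t \<le> hi K" for K s t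
    unfolding gK[OF K st(1,3)]
    by (rule centred_cell_bound(1)[OF \<psi> lohi01(1,2)[OF K] \<alpha> b cell'[OF K] st])
  have zero: "integral {lo K..hi K} g = 0" if K: "K \<in> \<J>" for K
    unfolding gK[OF K order_refl order_refl]
    by (rule centred_cell_bound(2)[OF \<psi> lohi01(1,2)[OF K] \<alpha> b cell'[OF K] order_refl order_refl lohi01(3)[OF K]])
  define G where "G x = integral {0..x} g" for x
  have Gsum: "G x = (\<Sum>K\<in>\<J>. if x \<in> K then integral {lo K..x} g else 0)" if x: "x \<in> {0..1}" for x
  proof -
    have "g y = (\<Sum>K\<in>\<J>. if y \<in> {lo K<..<hi K} then g y else 0)" for y
    proof (cases "y \<in> \<Union>\<J>")
      case True
      then obtain K where K: "K \<in> \<J>" "y \<in> K" by blast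
      have "(\<Sum>L\<in>\<J>. if y \<in> {lo L<..<hi L} then g y else 0) = (\<Sum>L\<in>\<J>. if L = K then g y else 0)"
      proof (rule sum.cong[OF refl])
        fix L assume L: "L \<in> \<J>"
        have "y \<in> L \<longleftrightarrow> L = K" using J K L unfolding cells_def disjoint_def by blast
        then show "(if y \<in> {lo L<..<hi L} then g y else 0) = (if L = K then g y else 0)" using lohi[OF L] by auto
      qed
      then show ?thesis using finJ K by simp
    next
      case False
      then have "g y = 0" by (simp add: g_def)
      then show ?thesis by (simp add: sum.neutral)
    qed
    then have "G x = integral {0..x} (\<lambda>y. \<Sum>K\<in>\<J>. if y \<in> {lo K<..<hi K} then g y else 0)"
      unfolding G_def by presburger
    also have "\<dots> = (\<Sum>K\<in>\<J>. integral {0..x} (\<lambda>y. if y \<in> {lo K<..<hi K} then g y else 0))"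
      by (rule integral_sum) (intro finJ integrable_restrict_Ioo gi)+
    also have "\<dots> = (\<Sum>K\<in>\<J>. if x \<in> K then integral {lo K..x} g else 0)"
    proof (rule sum.cong[OF refl])
      fix K assume K: "K \<in> \<J>"
      note lK = lohi[OF K]
      have e: "integral {0..x} (\<lambda>y. if y \<in> {lo K<..<hi K} then g y else 0) = integral {lo K..min (hi K) x} g"
        unfolding integral_restrict_Ioo using lK by (simp add: max.absorb1)
      consider "x \<le> lo K" | "lo K < x" "x < hi K" | "hi K \<le> x" by linarith
      then show "integral {0..x} (\<lambda>y. if y \<in> {lo K<..<hi K} then g y else 0) = (if x \<in> K then integral {lo K..x} g else 0)"
      proof cases
        case 1
        have "{lo K..min (hi K) x} = {} \<or> {lo K..min (hi K) x} = {lo K}" using 1 by auto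
        then have "integral {lo K..min (hi K) x} g = 0" by auto
        moreover have "x \<notin> K" using 1 lK by auto
        ultimately show ?thesis unfolding e by simp
      next
        case 2
        then have "x \<in> K" using lK by auto
        then show ?thesis unfolding e using 2 by (simp add: min.absorb2)
      next
        case 3
        then have "x \<notin> K" using lK by auto
        then show ?thesis unfolding e using 3 zero[OF K] by (simp add: min.absorb1)
      qed
    qed
    finally show ?thesis .
  qed
  \<comment> \<open>the primitive vanishes off the cells, because the integral over each full cell is 0\<close>
  have Gin: "G x = integral {lo K..x} g" if K: "K \<in> \<J>" "x \<in> K" for K x
  proof -
    have x01: "x \<in> {0..1}" using lohi[OF K(1)] K(2) by auto
    have "G x = (\<Sum>L\<in>\<J>. if L = K then integral {lo K..x} g else 0)"
      unfolding Gsum[OF x01]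
    proof (rule sum.cong[OF refl])
      fix L assume L: "L \<in> \<J>"
      have "x \<in> L \<longleftrightarrow> L = K" using J K L unfolding cells_def disjoint_def by blast
      then show "(if x \<in> L then integral {lo L..x} g else 0) = (if L = K then integral {lo K..x} g else 0)" by auto
    qed
    then show ?thesis using finJ K by simp
  qed
  have Gout: "G x = 0" if "x \<in> {0..1}" "x \<notin> \<Union>\<J>" for x
    unfolding Gsum[OF that(1)] using that(2) by (auto intro!: sum.neutral)
  have gH: "primitive_Holder \<alpha> (4 * b) {0..1} g"
  proof (rule primitive_HolderI)
    fix u v :: real assume uv: "u \<le> v" "{u..v} \<subseteq> {0..1}"
    then have uv01: "u \<in> {0..1}" "v \<in> {0..1}" by auto
    have "G u + integral {u..v} g = G v" unfolding G_def
      by (rule Henstock_Kurzweil_Integration.integral_combine) (use uv01 uv gi in auto)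
    then have I: "integral {u..v} g = G v - G u" by (simp add: algebra_simps)
    show "norm (integral {u..v} g) \<le> 4 * b * (v - u) powr \<alpha>"
    proof (cases "\<exists>K\<in>\<J>. u \<in> K \<and> v \<in> K")
      case True
      then obtain K where K: "K \<in> \<J>" "u \<in> K" "v \<in> K" by blast
      have "norm (integral {u..v} g) \<le> 2 * b * (v - u) powr \<alpha>"
        by (rule loc[OF K(1) _ uv(1)]) (use lohi[OF K(1)] K in auto)
      also have "\<dots> \<le> 4 * b * (v - u) powr \<alpha>" using b by (intro mult_right_mono) auto
      finally show ?thesis .
    next
      case False
      have mono: "2 * b * x powr \<alpha> \<le> 2 * b * (v - u) powr \<alpha>" if "0 \<le> x" "x \<le> v - u" for x
        using that b \<alpha> by (intro mult_left_mono powr_mono2) auto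
      have "norm (G v) \<le> 2 * b * (v - u) powr \<alpha>"
      proof (cases "v \<in> \<Union>\<J>")
        case True
        then obtain K where K: "K \<in> \<J>" "v \<in> K" by blast
        then have "u \<notin> K" using False by blast
        then have k: "lo K < v" "v < hi K" "u \<le> lo K" using lohi[OF K(1)] K(2) uv by auto
        have "norm (G v) \<le> 2 * b * (v - lo K) powr \<alpha>" unfolding Gin[OF K] by (rule loc[OF K(1)]) (use k in auto)
        also have "\<dots> \<le> 2 * b * (v - u) powr \<alpha>" by (rule mono) (use k in auto)
        finally show ?thesis .
      qed (use Gout uv01 b in auto)
      moreover have "norm (G u) \<le> 2 * b * (v - u) powr \<alpha>"
      proof (cases "u \<in> \<Union>\<J>")
        case True
        then obtain K where K: "K \<in> \<J>" "u \<in> K" by blast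
        then have "v \<notin> K" using False by blast
        then have k: "lo K < u" "u < hi K" "hi K \<le> v" using lohi[OF K(1)] K(2) uv by auto
        have "integral {lo K..u} g + integral {u..hi K} g = integral {lo K..hi K} g"
          by (rule Henstock_Kurzweil_Integration.integral_combine) (use k gi in auto)
        then have "G u = - integral {u..hi K} g" unfolding Gin[OF K] zero[OF K(1)] by (simp add: add_eq_0_iff)
        then have "norm (G u) = norm (integral {u..hi K} g)" by simp
        also have "\<dots> \<le> 2 * b * (hi K - u) powr \<alpha>" by (rule loc[OF K(1)]) (use k in auto)
        also have "\<dots> \<le> 2 * b * (v - u) powr \<alpha>" by (rule mono) (use k in auto)
        finally show ?thesis .
      qed (use Gout uv01 b in auto)
      ultimately show ?thesis unfolding I using norm_triangle_ineq4[of "G v" "G u"] by linarith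
    qed
  qed
  have "(\<lambda>x. if x \<in> \<Union>\<J> then 0 else \<psi> x) = (\<lambda>x. if x \<in> - \<Union>\<J> then \<psi> x else 0)" by auto
  then have b2: "bounded_borel (\<lambda>x. if x \<in> \<Union>\<J> then 0 else \<psi> x)"
    using bounded_borel_restrict[OF \<psi>, of "- \<Union>\<J>"] opn by auto
  have "primitive_Holder \<alpha> (4 * b + \<epsilon>) {0..1} (\<lambda>x. g x + (if x \<in> \<Union>\<J> then 0 else \<psi> x))"
    by (rule primitive_Holder_add[OF bg b2 gH rest])
  moreover have "(\<lambda>x. g x + (if x \<in> \<Union>\<J> then 0 else \<psi> x)) = (\<lambda>x. \<psi> x - averaging \<J> \<psi> x)"
  proof
    fix x show "g x + (if x \<in> \<Union>\<J> then 0 else \<psi> x) = \<psi> x - averaging \<J> \<psi> x"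
      using averaging_off_cells[of x \<J> \<psi>] by (cases "x \<in> \<Union>\<J>") (simp_all add: g_def)
  qed
  ultimately show ?thesis by simp
qed

section \<open>The transfer operator on integrable functions\<close>

lemma AE_summable_of_summable_integrals:
  fixes g :: "nat \<Rightarrow> 'a \<Rightarrow> 'b::{banach, second_countable_topology}"
  assumes g: "\<And>n. integrable N (g n)" and s: "summable (\<lambda>n. LINT x|N. norm (g n x))"
  shows "AE x in N. summable (\<lambda>n. norm (g n x))"
proof -
  have gm[measurable]: "g n \<in> borel_measurable N" for n using g by auto
  have "(\<integral>\<^sup>+x. (\<Sum>n. ennreal (norm (g n x))) \<partial>N) = (\<Sum>n. \<integral>\<^sup>+x. ennreal (norm (g n x)) \<partial>N)"
    by (rule nn_integral_suminf) measurable
  also have "\<dots> = (\<Sum>n. ennreal (LINT x|N. norm (g n x)))"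
    by (simp add: nn_integral_eq_integral g)
  also have "\<dots> \<noteq> \<infinity>" using s by (simp add: suminf_ennreal2)
  finally have fin: "(\<integral>\<^sup>+x. (\<Sum>n. ennreal (norm (g n x))) \<partial>N) \<noteq> \<infinity>" .
  have "AE x in N. (\<Sum>n. ennreal (norm (g n x))) \<noteq> \<infinity>"
    by (rule nn_integral_noteq_infinite[OF _ fin]) measurable
  then show ?thesis by eventually_elim (auto intro: summable_suminf_not_top)
qed

text \<open>
  Absolutely convergent series in L^1 converge almost everywhere and in norm.
\<close>

lemma integral_norm_series_le:
  fixes g :: "nat \<Rightarrow> 'a \<Rightarrow> 'b::{banach, second_countable_topology}"
  assumes g: "\<And>n. integrable N (g n)" and s: "summable (\<lambda>n. LINT x|N. norm (g n x))"
  shows "integrable N (\<lambda>x. \<Sum>n. g n x)"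
    and "(LINT x|N. norm (\<Sum>n. g n x)) \<le> (\<Sum>n. LINT x|N. norm (g n x))"
proof -
  note ae = AE_summable_of_summable_integrals[OF g s]
  show i: "integrable N (\<lambda>x. \<Sum>n. g n x)" by (rule integrable_suminf[OF g ae s])
  have ae': "AE x in N. summable (\<lambda>n. norm (norm (g n x)))" using ae by simp
  have s': "summable (\<lambda>n. LINT x|N. norm (norm (g n x)))" using s by simp
  have ni: "integrable N (\<lambda>x. norm (g n x))" for n by (rule integrable_norm[OF g])
  have "(LINT x|N. norm (\<Sum>n. g n x)) \<le> (LINT x|N. (\<Sum>n. norm (g n x)))"
    by (rule integral_mono_AE[OF integrable_norm[OF i] integrable_suminf[OF ni ae' s']])
       (use ae in \<open>eventually_elim, auto intro: summable_norm\<close>)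
  also have "\<dots> = (\<Sum>n. LINT x|N. norm (g n x))" by (rule integral_suminf[OF ni ae' s'])
  finally show "(LINT x|N. norm (\<Sum>n. g n x)) \<le> (\<Sum>n. LINT x|N. norm (g n x))" .
qed

lemma integrable_leb01_lebesgue:
  fixes k :: "real \<Rightarrow> 'b::euclidean_space"
  shows "integrable leb01 k \<longleftrightarrow> k absolutely_integrable_on {0..1}"
  unfolding set_integrable_def by (rule integrable_restrict_space) simp

lemma borel_measurable_leb01_AE:
  fixes v w :: "real \<Rightarrow> 'b::euclidean_space"
  assumes v: "v \<in> borel_measurable leb01" and e: "AE x in leb01. v x = w x"
  shows "w \<in> borel_measurable leb01"
proof -
  have S: "{0..1::real} \<inter> space lebesgue \<in> sets lebesgue" by simp
  have "(\<lambda>x. indicator {0..1} x *\<^sub>R v x) \<in> borel_measurable lebesgue"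
    using v borel_measurable_restrict_space_iff[OF S] by blast
  moreover have "AE x in lebesgue. indicator {0..1} x *\<^sub>R v x = indicator {0..1} x *\<^sub>R w x"
    using e by (subst (asm) AE_restrict_space_iff[OF S]) (auto simp: indicator_def elim: eventually_mono)
  ultimately have "(\<lambda>x. indicator {0..1} x *\<^sub>R w x) \<in> borel_measurable lebesgue"
    by (rule borel_measurable_AE)
  then show ?thesis using borel_measurable_restrict_space_iff[OF S] by blast
qed

context branches
begin

definition Transfer :: "(real \<Rightarrow> complex) \<Rightarrow> real \<Rightarrow> complex" where
  "Transfer h x = (\<Sum>\<^sub>\<infinity>y\<in>{y \<in> \<Omega>. f y = x}. \<xi> y * h y)"

abbreviation cell where "cell n \<equiv> {c n<..<d n}"

definition branch :: "nat \<Rightarrow> real \<Rightarrow> real" where "branch n = the_inv_into (cell n) f"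

lemma branch_f: "y \<in> cell n \<Longrightarrow> branch n (f y) = y"
  unfolding branch_def by (rule the_inv_into_f_f[OF f_inj])

text \<open>
  The contribution of the n-th branch to the transfer operator.
\<close>

definition part :: "nat \<Rightarrow> (real \<Rightarrow> complex) \<Rightarrow> real \<Rightarrow> complex" where
  "part n h x = (if x \<in> f ` cell n then \<xi> (branch n x) * h (branch n x) else 0)"

text \<open>
  Change of variables along one branch, phrased for functions on the unit interval that vanish off the
  image of the branch.
\<close>

lemma branch_change_of_variables:
  fixes G k :: "real \<Rightarrow> 'b::euclidean_space"
  assumes k: "integrable leb01 k" and kG: "\<And>y. y \<in> cell n \<Longrightarrow> k y = D y *\<^sub>R G (f y)"
  shows "integrable leb01 (\<lambda>x. if x \<in> f ` cell n then G x else 0)"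
    and "(LINT x|leb01. (if x \<in> f ` cell n then G x else 0)) = (LINT x|leb01. indicator (cell n) x *\<^sub>R k x)"
proof -
  let ?F = "\<lambda>x. if x \<in> f ` cell n then G x else 0"
  have sub: "cell n \<subseteq> {0..1}" using cd(1)[of n] cd(3)[of n] by auto
  have k1: "k absolutely_integrable_on {0..1}" using k by (simp only: integrable_leb01_lebesgue)
  have kc: "k absolutely_integrable_on cell n" by (rule set_integrable_subset[OF k1 _ sub]) auto
  have DG: "(\<lambda>y. D y *\<^sub>R G (f y)) absolutely_integrable_on cell n"
    using kc by (rule set_integrable_cong[THEN iffD1, rotated 3]) (use kG in auto)
  have der: "(f has_field_derivative deriv f x) (at x within cell n)" if "x \<in> cell n" for x
    by (rule has_field_derivative_at_within[OF f_deriv]) (use that in blast)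
  have cov: "(\<lambda>x. D x *\<^sub>R G (f x)) absolutely_integrable_on cell n \<and> integral (cell n) (\<lambda>x. D x *\<^sub>R G (f x)) = b
      \<longleftrightarrow> G absolutely_integrable_on f ` cell n \<and> integral (f ` cell n) G = b" for b
    by (rule has_absolute_integral_change_of_variables_real[OF _ der f_inj]) auto
  from cov[of "integral (cell n) (\<lambda>x. D x *\<^sub>R G (f x))"] DG
  have G: "G absolutely_integrable_on f ` cell n" "integral (f ` cell n) G = integral (cell n) (\<lambda>x. D x *\<^sub>R G (f x))"
    by blast+
  have im: "f ` cell n \<subseteq> {0..1}" by (rule image_subsetI, rule f_range) blast
  have F1: "(\<lambda>x. indicator {0..1} x *\<^sub>R ?F x) = (\<lambda>x. indicator (f ` cell n) x *\<^sub>R G x)"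
    using im by (auto simp: indicator_def fun_eq_iff)
  show Fi: "integrable leb01 ?F"
    unfolding integrable_leb01_lebesgue set_integrable_def F1 using G(1) unfolding set_integrable_def .
  have "(LINT x|leb01. ?F x) = (LINT x|lebesgue. indicator {0..1} x *\<^sub>R ?F x)"
    by (subst integral_restrict_space) auto
  also have "\<dots> = (LINT x:(f ` cell n)|lebesgue. G x)" unfolding F1 set_lebesgue_integral_def ..
  also have "\<dots> = integral (f ` cell n) G" by (rule set_lebesgue_integral_eq_integral(2)[OF G(1)])
  also have "\<dots> = integral (cell n) k" unfolding G(2) by (rule integral_cong) (use kG in auto)
  also have "\<dots> = (LINT x:(cell n)|lebesgue. k x)" by (rule set_lebesgue_integral_eq_integral(2)[OF kc, symmetric])
  also have "\<dots> = (LINT x|lebesgue. indicator {0..1} x *\<^sub>R (indicator (cell n) x *\<^sub>R k x))"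
    unfolding set_lebesgue_integral_def
    by (rule Bochner_Integration.integral_cong[OF refl]) (use sub in \<open>auto simp: indicator_def\<close>)
  also have "\<dots> = (LINT x|leb01. indicator (cell n) x *\<^sub>R k x)"
    by (subst integral_restrict_space) auto
  finally show "(LINT x|leb01. ?F x) = (LINT x|leb01. indicator (cell n) x *\<^sub>R k x)" .
qed

lemma indicator_cell_integrable:
  fixes k :: "real \<Rightarrow> 'b::euclidean_space"
  assumes "integrable leb01 k" shows "integrable leb01 (\<lambda>x. indicator (cell n) x *\<^sub>R k x)"
proof -
  have "(indicator (cell n) :: real \<Rightarrow> real) \<in> borel_measurable lborel" by simp
  then have [measurable]: "(indicator (cell n) :: real \<Rightarrow> real) \<in> borel_measurable leb01"
    by (intro measurable_restrict_space1 measurable_completion)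
  have [measurable]: "k \<in> borel_measurable leb01" using assms by auto
  show ?thesis
  proof (rule Bochner_Integration.integrable_bound[OF assms])
    show "(\<lambda>x. indicator (cell n) x *\<^sub>R k x) \<in> borel_measurable leb01" by measurable
    show "AE x in leb01. norm (indicator (cell n) x *\<^sub>R k x) \<le> norm (k x)" by (rule AE_I2) (simp add: indicator_def)
  qed
qed

lemma cell_series:
  fixes k :: "real \<Rightarrow> 'b::euclidean_space"
  assumes k: "\<And>x. x \<notin> \<Omega> \<Longrightarrow> k x = 0"
  shows "(\<lambda>n. indicator (cell n) x *\<^sub>R k x) sums k x" "summable (\<lambda>n. norm (indicator (cell n) x *\<^sub>R k x))"
proof -
  have "(\<lambda>n. indicator (cell n) x *\<^sub>R k x) sums k x \<and> summable (\<lambda>n. norm (indicator (cell n) x *\<^sub>R k x))"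
  proof (cases "x \<in> \<Omega>")
    case True
    then obtain m where m: "x \<in> cell m" unfolding \<Omega>_def by blast
    have e: "indicator (cell n) x = (if n = m then 1 else 0 :: real)" for n
    proof (cases "n = m")
      case False
      then have "cell n \<inter> cell m = {}" using dis unfolding disjoint_family_on_def by blast
      then have "x \<notin> cell n" using m by blast
      then show ?thesis using False by (simp add: indicator_def)
    qed (use m in \<open>simp add: indicator_def\<close>)
    have "(\<lambda>n. (if n = m then 1 else 0 :: real) *\<^sub>R k x) = (\<lambda>n. if n = m then k x else 0)" by auto
    then have "(\<lambda>n. indicator (cell n) x *\<^sub>R k x) = (\<lambda>n. if n = m then k x else 0)" by (simp only: e)
    moreover have "(\<lambda>n. norm (indicator (cell n) x *\<^sub>R k x)) = (\<lambda>n. if n = m then norm (k x) else 0)" by (auto simp: e)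
    ultimately show ?thesis using sums_single[of m "\<lambda>_. k x"] sums_single[of m "\<lambda>_. norm (k x)"]
      by (auto simp: sums_summable)
  next
    case False
    then show ?thesis using k[of x] by simp
  qed
  then show "(\<lambda>n. indicator (cell n) x *\<^sub>R k x) sums k x" "summable (\<lambda>n. norm (indicator (cell n) x *\<^sub>R k x))" by auto
qed

lemma cell_integral_sums:
  fixes k :: "real \<Rightarrow> 'b::euclidean_space"
  assumes ki: "integrable leb01 k" and k: "\<And>x. x \<notin> \<Omega> \<Longrightarrow> k x = 0"
  shows "(\<lambda>n. LINT x|leb01. indicator (cell n) x *\<^sub>R k x) sums (LINT x|leb01. k x)"
proof -
  have k_suminf: "(\<Sum>n. indicator (cell n) x *\<^sub>R k x) = k x" for x
    by (rule sums_unique[symmetric]) (rule cell_series(1)[OF k])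
  have ni: "integrable leb01 (\<lambda>x. norm (k x))" using ki by simp
  have "summable (\<lambda>n. LINT x|leb01. norm (indicator (cell n) x *\<^sub>R k x))"
  proof (rule summableI_nonneg_bounded[where x="LINT x|leb01. norm (k x)"])
    fix N
    have "(\<Sum>n<N. LINT x|leb01. norm (indicator (cell n) x *\<^sub>R k x))
       = (LINT x|leb01. (\<Sum>n<N. norm (indicator (cell n) x *\<^sub>R k x)))"
      by (rule Bochner_Integration.integral_sum[symmetric]) (intro integrable_norm indicator_cell_integrable ki)
    also have "\<dots> \<le> (LINT x|leb01. norm (k x))"
    proof (rule integral_mono[OF _ ni])
      show "integrable leb01 (\<lambda>x. \<Sum>n<N. norm (indicator (cell n) x *\<^sub>R k x))"
        by (intro Bochner_Integration.integrable_sum integrable_norm indicator_cell_integrable ki)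
      fix x
      have "(\<lambda>n. indicator (cell n) x *\<^sub>R norm (k x)) sums norm (k x)"
        by (rule cell_series(1)) (simp add: k)
      moreover have "norm (indicator (cell n) x *\<^sub>R k x) = indicator (cell n) x *\<^sub>R norm (k x)" for n
        by (simp add: indicator_def)
      ultimately have "(\<lambda>n. norm (indicator (cell n) x *\<^sub>R k x)) sums norm (k x)" by simp
      then show "(\<Sum>n<N. norm (indicator (cell n) x *\<^sub>R k x)) \<le> norm (k x)"
        using sum_le_suminf[of "\<lambda>n. norm (indicator (cell n) x *\<^sub>R k x)" "{..<N}"]
        by (simp add: sums_iff)
    qed
    finally show "(\<Sum>n<N. LINT x|leb01. norm (indicator (cell n) x *\<^sub>R k x)) \<le> (LINT x|leb01. norm (k x))" .
  qed simp
  then have "(\<lambda>n. LINT x|leb01. indicator (cell n) x *\<^sub>R k x) sums (LINT x|leb01. (\<Sum>n. indicator (cell n) x *\<^sub>R k x))"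
    by (intro sums_integral indicator_cell_integrable ki AE_I2 cell_series(2)[OF k])
  then show ?thesis by (simp only: k_suminf)
qed

lemma weight_integrable:
  assumes h: "integrable leb01 h" and \<psi>: "bounded_borel \<psi>"
  shows "integrable leb01 (\<lambda>x. h x * Koopman \<psi> x)"
proof -
  have b: "bounded_borel (Koopman \<psi>)" by (rule Koopman_bounded_borel[OF \<psi>])
  obtain B where B: "0 < B" "\<And>x. norm (Koopman \<psi> x) \<le> B" by (rule bounded_borel_bound[OF b]) (rule that)
  show ?thesis by (rule integrable_mult_bounded[OF h bounded_borel_leb01[OF b] B(2)])
qed

lemma part_integral:
  assumes h: "integrable leb01 h" and \<psi>: "bounded_borel \<psi>"
  shows "integrable leb01 (\<lambda>x. part n h x * \<psi> x)"
    "(LINT x|leb01. part n h x * \<psi> x) = (LINT x|leb01. indicator (cell n) x *\<^sub>R (h x * Koopman \<psi> x))"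
proof -
  have e: "(\<lambda>x. part n h x * \<psi> x) = (\<lambda>x. if x \<in> f ` cell n then \<xi> (branch n x) * h (branch n x) * \<psi> x else 0)"
    by (auto simp: part_def)
  have k: "h y * Koopman \<psi> y = D y *\<^sub>R (\<xi> (branch n (f y)) * h (branch n (f y)) * \<psi> (f y))" if "y \<in> cell n" for y
    unfolding Koopman_on_cell[OF that] branch_f[OF that] by (simp add: scaleR_conv_of_real mult_ac)
  show "integrable leb01 (\<lambda>x. part n h x * \<psi> x)"
    "(LINT x|leb01. part n h x * \<psi> x) = (LINT x|leb01. indicator (cell n) x *\<^sub>R (h x * Koopman \<psi> x))"
    unfolding e by (rule branch_change_of_variables[OF weight_integrable[OF h \<psi>] k], assumption)+
qed

lemma bounded_borel_one: "bounded_borel (\<lambda>_. 1)"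
  unfolding bounded_borel_def by (intro conjI exI[of _ 1]) auto

lemma part_integrable: assumes h: "integrable leb01 h" shows "integrable leb01 (part n h)"
  using part_integral(1)[OF h bounded_borel_one, of n] by simp

lemma part_norm_integral:
  assumes h: "integrable leb01 h"
  shows "(LINT x|leb01. norm (part n h x)) = (LINT x|leb01. indicator (cell n) x *\<^sub>R norm (h x * Koopman (\<lambda>_. 1) x))"
proof -
  have e: "(\<lambda>x. norm (part n h x)) = (\<lambda>x. if x \<in> f ` cell n then norm (\<xi> (branch n x) * h (branch n x)) else 0)"
    by (auto simp: part_def)
  have k: "norm (h y * Koopman (\<lambda>_. 1) y) = D y *\<^sub>R norm (\<xi> (branch n (f y)) * h (branch n (f y)))" if "y \<in> cell n" for y
    unfolding Koopman_on_cell[OF that] branch_f[OF that] by (simp add: norm_mult)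
  show ?thesis unfolding e
    by (rule branch_change_of_variables(2)[OF integrable_norm[OF weight_integrable[OF h bounded_borel_one]] k])
qed

lemma part_norm_sums:
  assumes h: "integrable leb01 h"
  shows "(\<lambda>n. LINT x|leb01. norm (part n h x)) sums (LINT x|leb01. norm (h x * Koopman (\<lambda>_. 1) x))"
  unfolding part_norm_integral[OF h]
  by (rule cell_integral_sums[OF integrable_norm[OF weight_integrable[OF h bounded_borel_one]]]) (simp add: Koopman_def)

lemma part_AE_summable:
  "integrable leb01 h \<Longrightarrow> AE x in leb01. summable (\<lambda>n. norm (part n h x))"
  by (rule AE_summable_of_summable_integrals[OF part_integrable sums_summable[OF part_norm_sums]])

text \<open>
  Each branch contains at most one preimage of x, so the unordered sum over preimages is the series over
  the branches where the latter converges absolutely.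
\<close>

lemma Transfer_eq_series:
  assumes s: "summable (\<lambda>n. norm (part n h x))"
  shows "Transfer h x = (\<Sum>n. part n h x)"
proof -
  define N where "N = {n. x \<in> f ` cell n}"
  have br: "branch n x \<in> cell n \<and> f (branch n x) = x" if nN: "n \<in> N" for n
  proof -
    obtain y where "y \<in> cell n" "x = f y" using nN unfolding N_def by blast
    then show ?thesis using branch_f by simp
  qed
  have bij: "bij_betw (\<lambda>n. branch n x) N {y \<in> \<Omega>. f y = x}" unfolding bij_betw_def
  proof
    show "inj_on (\<lambda>n. branch n x) N"
    proof (rule inj_onI)
      fix i j assume "i \<in> N" "j \<in> N" "branch i x = branch j x"
      then have "branch i x \<in> cell i" "branch i x \<in> cell j" using br by metis+
      then show "i = j" using dis unfolding disjoint_family_on_def by blast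
    qed
    show "(\<lambda>n. branch n x) ` N = {y \<in> \<Omega>. f y = x}"
    proof (intro equalityI subsetI)
      fix y assume "y \<in> (\<lambda>n. branch n x) ` N"
      then show "y \<in> {y \<in> \<Omega>. f y = x}" using br \<Omega>I by blast
    next
      fix y assume "y \<in> {y \<in> \<Omega>. f y = x}"
      then obtain n where n: "y \<in> cell n" "f y = x" unfolding \<Omega>_def by blast
      then have "n \<in> N" "y = branch n x" unfolding N_def using branch_f[OF n(1)] by auto
      then show "y \<in> (\<lambda>n. branch n x) ` N" by blast
    qed
  qed
  have "Transfer h x = (\<Sum>\<^sub>\<infinity>n\<in>N. \<xi> (branch n x) * h (branch n x))"
    unfolding Transfer_def by (rule infsum_reindex_bij_betw[OF bij, symmetric])
  also have "\<dots> = (\<Sum>\<^sub>\<infinity>n. part n h x)"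
    by (rule infsum_cong_neutral) (auto simp: part_def N_def)
  also have "\<dots> = (\<Sum>n. part n h x)"
    using norm_summable_imp_has_sum[OF s summable_sums[OF summable_norm_cancel[OF s]]] by (rule infsumI)
  finally show ?thesis .
qed

lemma Transfer_AE: "integrable leb01 h \<Longrightarrow> AE x in leb01. Transfer h x = (\<Sum>n. part n h x)"
  by (drule part_AE_summable, erule eventually_mono) (rule Transfer_eq_series)

lemma part_suminf:
  assumes h: "integrable leb01 h"
  shows "integrable leb01 (\<lambda>x. \<Sum>n. part n h x)"
    and "(LINT x|leb01. norm (\<Sum>n. part n h x)) \<le> (\<Sum>n. LINT x|leb01. norm (part n h x))"
  using integral_norm_series_le[OF part_integrable[OF h] sums_summable[OF part_norm_sums[OF h]]] by auto

lemma Transfer_integrable: assumes h: "integrable leb01 h" shows "integrable leb01 (Transfer h)"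
proof -
  have m: "(\<lambda>x. \<Sum>n. part n h x) \<in> borel_measurable leb01" using part_suminf(1)[OF h] by auto
  have e: "AE x in leb01. (\<Sum>n. part n h x) = Transfer h x" using Transfer_AE[OF h] by eventually_elim simp
  have "Transfer h \<in> borel_measurable leb01" by (rule borel_measurable_leb01_AE[OF m e])
  then show ?thesis using part_suminf(1)[OF h] e m by (subst integrable_cong_AE[of _ _ "\<lambda>x. \<Sum>n. part n h x"]) (auto elim: eventually_mono)
qed

lemma Transfer_measurable: "integrable leb01 h \<Longrightarrow> Transfer h \<in> borel_measurable leb01"
  by (rule borel_measurable_integrable[OF Transfer_integrable])

lemma Transfer_L1:
  assumes h: "integrable leb01 h"
  shows "(LINT x|leb01. norm (Transfer h x)) \<le> M * (LINT x|leb01. norm (h x))"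
proof -
  have [measurable]: "Transfer h \<in> borel_measurable leb01" "(\<lambda>x. \<Sum>n. part n h x) \<in> borel_measurable leb01"
    using Transfer_measurable[OF h] part_suminf(1)[OF h] by auto
  have "(LINT x|leb01. norm (Transfer h x)) = (LINT x|leb01. norm (\<Sum>n. part n h x))"
  proof (rule Bochner_Integration.integral_cong_AE)
    show "AE x in leb01. norm (Transfer h x) = norm (\<Sum>n. part n h x)" using Transfer_AE[OF h] by eventually_elim simp
  qed measurable
  also have "\<dots> \<le> (\<Sum>n. LINT x|leb01. norm (part n h x))" by (rule part_suminf(2)[OF h])
  also have "\<dots> = (LINT x|leb01. norm (h x * Koopman (\<lambda>_. 1) x))" by (rule sums_unique[OF part_norm_sums[OF h], symmetric])
  also have "\<dots> \<le> (LINT x|leb01. M * norm (h x))"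
  proof (rule integral_mono[OF integrable_norm[OF weight_integrable[OF h bounded_borel_one]]])
    show "integrable leb01 (\<lambda>x. M * norm (h x))" using h by simp
    fix x show "norm (h x * Koopman (\<lambda>_. 1) x) \<le> M * norm (h x)"
      using Koopman_bound[of "\<lambda>_. 1" 1 x] unfolding norm_mult mult.commute[of M] by (intro mult_left_mono) auto
  qed
  finally show ?thesis by simp
qed

text \<open>
  Change of variables on each branch; the interchange of sum and integral is justified by the bound
  M on |\<xi> f'|.
\<close>

lemma Transfer_duality:
  assumes h: "integrable leb01 h" and \<psi>: "bounded_borel \<psi>"
  shows "(LINT x|leb01. Transfer h x * \<psi> x) = (LINT x|leb01. h x * Koopman \<psi> x)"
proof -
  obtain B where B: "0 < B" "\<And>x. norm (\<psi> x) \<le> B" by (rule bounded_borel_bound[OF \<psi>]) (rule that)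
  have [measurable]: "Transfer h \<in> borel_measurable leb01" "(\<lambda>x. \<Sum>n. part n h x) \<in> borel_measurable leb01"
    "\<psi> \<in> borel_measurable leb01" "part n h \<in> borel_measurable leb01" for n
    using Transfer_measurable[OF h] part_suminf(1)[OF h] bounded_borel_leb01[OF \<psi>] part_integrable[OF h] by auto
  have s: "AE x in leb01. summable (\<lambda>n. norm (part n h x * \<psi> x))"
    using part_AE_summable[OF h] by eventually_elim (simp add: norm_mult summable_mult2)
  have le: "(LINT x|leb01. norm (part n h x * \<psi> x)) \<le> B * (LINT x|leb01. norm (part n h x))" for n
  proof -
    have "(LINT x|leb01. norm (part n h x * \<psi> x)) \<le> (LINT x|leb01. B * norm (part n h x))"
    proof (rule integral_mono[OF integrable_norm[OF part_integral(1)[OF h \<psi>]]])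
      show "integrable leb01 (\<lambda>x. B * norm (part n h x))" using part_integrable[OF h] by simp
      show "norm (part n h x * \<psi> x) \<le> B * norm (part n h x)" for x
        unfolding norm_mult mult.commute[of B] by (rule mult_left_mono[OF B(2)]) simp
    qed
    then show ?thesis by simp
  qed
  have a: "summable (\<lambda>n. LINT x|leb01. norm (part n h x * \<psi> x))"
    by (rule summable_comparison_test'[where N=0, OF summable_mult[OF sums_summable[OF part_norm_sums[OF h]], of B]])
       (use le in simp)
  have "(LINT x|leb01. Transfer h x * \<psi> x) = (LINT x|leb01. (\<Sum>n. part n h x * \<psi> x))"
  proof (rule Bochner_Integration.integral_cong_AE)
    show "AE x in leb01. Transfer h x * \<psi> x = (\<Sum>n. part n h x * \<psi> x)"
      using Transfer_AE[OF h] part_AE_summable[OF h]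
      by eventually_elim (simp add: suminf_mult2 summable_norm_cancel)
    show "(\<lambda>x. \<Sum>n. part n h x * \<psi> x) \<in> borel_measurable leb01" by measurable
  qed measurable
  also have "\<dots> = (\<Sum>n. LINT x|leb01. part n h x * \<psi> x)"
    by (rule integral_suminf[OF part_integral(1)[OF h \<psi>] s a])
  also have "\<dots> = (LINT x|leb01. h x * Koopman \<psi> x)"
    unfolding part_integral(2)[OF h \<psi>]
    by (rule sums_unique[symmetric], rule cell_integral_sums[OF weight_integrable[OF h \<psi>]]) (simp add: Koopman_def)
  finally show ?thesis .
qed

lemma Transfer_add:
  assumes "integrable leb01 g" "integrable leb01 h"
  shows "ae_eq (Transfer (\<lambda>x. g x + h x)) (\<lambda>x. Transfer g x + Transfer h x)"
  unfolding ae_eq_def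
  using part_AE_summable[OF assms(1)] part_AE_summable[OF assms(2)]
    part_AE_summable[OF Bochner_Integration.integrable_add[OF assms]]
proof eventually_elim
  case (elim x)
  have "Transfer (\<lambda>x. g x + h x) x = (\<Sum>n. part n (\<lambda>x. g x + h x) x)" by (rule Transfer_eq_series[OF elim(3)])
  also have "\<dots> = (\<Sum>n. part n g x + part n h x)"
    by (rule suminf_cong) (simp add: part_def distrib_left)
  also have "\<dots> = Transfer g x + Transfer h x"
    unfolding Transfer_eq_series[OF elim(1)] Transfer_eq_series[OF elim(2)]
    by (rule suminf_add[symmetric]) (rule summable_norm_cancel, rule elim)+
  finally show ?case .
qed

lemma Transfer_scale: "Transfer (\<lambda>x. k * h x) = (\<lambda>x. k * Transfer h x)"
  unfolding Transfer_def mult.left_commute[of _ k] infsum_cmult_right' ..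

end

section \<open>Neumann series for operators on integrable functions\<close>

lemma ae_eq_refl: "ae_eq g g" by (simp add: ae_eq_def)

lemma ae_eq_sym: "ae_eq g h \<Longrightarrow> ae_eq h g"
  unfolding ae_eq_def by (erule eventually_mono) simp

lemma ae_eq_trans: "ae_eq f g \<Longrightarrow> ae_eq g h \<Longrightarrow> ae_eq f h"
  unfolding ae_eq_def by (erule (1) eventually_elim2) simp

lemma ae_eq_add: "ae_eq f g \<Longrightarrow> ae_eq f' g' \<Longrightarrow> ae_eq (\<lambda>x. f x + f' x) (\<lambda>x. g x + g' x)"
  unfolding ae_eq_def by (erule (1) eventually_elim2) simp

lemma ae_eq_scale: "ae_eq f g \<Longrightarrow> ae_eq (\<lambda>x. k * f x) (\<lambda>x. k * g x)"
  unfolding ae_eq_def by (erule eventually_mono) simp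

lemma ae_eq_of_L1_zero:
  assumes "integrable leb01 g" "integrable leb01 h" "(LINT x|leb01. norm (g x - h x)) \<le> 0"
  shows "ae_eq g h"
proof -
  have "(LINT x|leb01. norm (g x - h x)) = 0" using assms(3) by (intro antisym) auto
  then have "AE x in leb01. norm (g x - h x) = 0"
    using assms by (subst (asm) integral_nonneg_eq_0_iff_AE) auto
  then show ?thesis unfolding ae_eq_def by (auto elim: eventually_mono)
qed

lemma ae_eq_L1_zero:
  assumes "ae_eq g h" shows "(LINT x|leb01. norm (g x - h x)) = 0"
proof -
  have "AE x in leb01. norm (g x - h x) = 0" using assms unfolding ae_eq_def by (auto elim: eventually_mono)
  then show ?thesis by (rule integral_eq_zero_AE)
qed

lemma L1_triangle:
  assumes "integrable leb01 g" "integrable leb01 (h :: real \<Rightarrow> complex)"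
  shows "(LINT x|leb01. norm (g x + h x)) \<le> (LINT x|leb01. norm (g x)) + (LINT x|leb01. norm (h x))"
proof -
  have "(LINT x|leb01. norm (g x + h x)) \<le> (LINT x|leb01. norm (g x) + norm (h x))"
    using assms by (intro integral_mono) (auto intro: norm_triangle_ineq)
  then show ?thesis using assms by simp
qed

lemma L1_ae_cong:
  assumes "ae_eq g h" "integrable leb01 g" "integrable leb01 h"
  shows "(LINT x|leb01. norm (g x)) = (LINT x|leb01. norm (h x))"
  using assms unfolding ae_eq_def
  by (intro Bochner_Integration.integral_cong_AE) (auto elim: eventually_mono)

text \<open>
  Bounded operators on L^1, given on representatives and linear almost everywhere.
\<close>

locale L1_operator =
  fixes A :: "(real \<Rightarrow> complex) \<Rightarrow> real \<Rightarrow> complex" and K :: real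
  assumes preserves_L1: "integrable leb01 h \<Longrightarrow> integrable leb01 (A h)"
    and L1_bound: "integrable leb01 h \<Longrightarrow> (LINT x|leb01. norm (A h x)) \<le> K * (LINT x|leb01. norm (h x))"
    and K0: "0 \<le> K"
    and add: "integrable leb01 g \<Longrightarrow> integrable leb01 h \<Longrightarrow> ae_eq (A (\<lambda>x. g x + h x)) (\<lambda>x. A g x + A h x)"
    and scale: "integrable leb01 h \<Longrightarrow> ae_eq (A (\<lambda>x. k * h x)) (\<lambda>x. k * A h x)"
begin

text \<open>
  Compatibility with equality almost everywhere follows from linearity and boundedness, applied to the
  difference.
\<close>

lemma cong:
  assumes g: "integrable leb01 g" and h: "integrable leb01 h" and e: "ae_eq g h"
  shows "ae_eq (A g) (A h)"
proof -
  have d: "integrable leb01 (\<lambda>x. g x - h x)" using g h by simp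
  have "(LINT x|leb01. norm (A (\<lambda>x. g x - h x) x - 0)) \<le> K * (LINT x|leb01. norm (g x - h x))"
    using L1_bound[OF d] by simp
  also have "\<dots> = 0" using ae_eq_L1_zero[OF e] by simp
  finally have "ae_eq (A (\<lambda>x. g x - h x)) (\<lambda>x. 0)" by (intro ae_eq_of_L1_zero preserves_L1 d) auto
  then have "ae_eq (\<lambda>x. A h x + A (\<lambda>x. g x - h x) x) (\<lambda>x. A h x + 0)" by (rule ae_eq_add[OF ae_eq_refl])
  then have "ae_eq (\<lambda>x. A h x + A (\<lambda>x. g x - h x) x) (A h)" by simp
  moreover have "ae_eq (A (\<lambda>x. h x + (g x - h x))) (\<lambda>x. A h x + A (\<lambda>x. g x - h x) x)" by (rule add[OF h d])
  ultimately show ?thesis by (auto intro: ae_eq_trans)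
qed

lemma diff:
  assumes g: "integrable leb01 g" and h: "integrable leb01 h"
  shows "ae_eq (A (\<lambda>x. g x - h x)) (\<lambda>x. A g x - A h x)"
proof -
  have h': "integrable leb01 (\<lambda>x. -1 * h x)" using h by simp
  have "ae_eq (A (\<lambda>x. g x + -1 * h x)) (\<lambda>x. A g x + -1 * A h x)"
    by (rule ae_eq_trans[OF add[OF g h'] ae_eq_add[OF ae_eq_refl scale[OF h]]])
  then show ?thesis by simp
qed

lemma zero: "ae_eq (A (\<lambda>x. 0)) (\<lambda>x. 0)"
  using scale[of "\<lambda>x. 0" 0] by simp

lemma sum:
  assumes "finite I" "\<And>i. i \<in> I \<Longrightarrow> integrable leb01 (g i)"
  shows "ae_eq (A (\<lambda>x. \<Sum>i\<in>I. k i * g i x)) (\<lambda>x. \<Sum>i\<in>I. k i * A (g i) x)"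
  using assms
proof (induction I rule: finite_induct)
  case empty
  then show ?case using zero by simp
next
  case (insert i I)
  have 1: "integrable leb01 (\<lambda>x. k i * g i x)" "integrable leb01 (\<lambda>x. \<Sum>i\<in>I. k i * g i x)"
    using insert.prems by auto
  have "ae_eq (A (\<lambda>x. \<Sum>i\<in>I. k i * g i x)) (\<lambda>x. \<Sum>i\<in>I. k i * A (g i) x)"
    by (rule insert.IH) (use insert.prems in auto)
  moreover have "ae_eq (A (\<lambda>x. k i * g i x)) (\<lambda>x. k i * A (g i) x)" by (rule scale) (use insert.prems in auto)
  ultimately have "ae_eq (A (\<lambda>x. k i * g i x + (\<Sum>i\<in>I. k i * g i x))) (\<lambda>x. k i * A (g i) x + (\<Sum>i\<in>I. k i * A (g i) x))"
    by (intro ae_eq_trans[OF add[OF 1]] ae_eq_add)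
  then show ?case using insert.hyps by simp
qed

lemma iter_integrable: "integrable leb01 h \<Longrightarrow> integrable leb01 ((A ^^ k) h)"
  by (induction k) (auto intro: preserves_L1)

lemma iter_L1: "integrable leb01 h \<Longrightarrow> (LINT x|leb01. norm ((A ^^ k) h x)) \<le> K ^ k * (LINT x|leb01. norm (h x))"
proof (induction k)
  case (Suc k)
  have "(LINT x|leb01. norm ((A ^^ Suc k) h x)) \<le> K * (LINT x|leb01. norm ((A ^^ k) h x))"
    using L1_bound[OF iter_integrable[OF Suc.prems]] by simp
  also have "\<dots> \<le> K * (K ^ k * (LINT x|leb01. norm (h x)))" by (intro mult_left_mono Suc K0)
  finally show ?case by (simp add: mult_ac)
qed simp

lemma iter_add:
  assumes "integrable leb01 g" "integrable leb01 h"
  shows "ae_eq ((A ^^ k) (\<lambda>x. g x + h x)) (\<lambda>x. (A ^^ k) g x + (A ^^ k) h x)"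
proof (induction k)
  case (Suc k)
  have "ae_eq (A ((A ^^ k) (\<lambda>x. g x + h x))) (A (\<lambda>x. (A ^^ k) g x + (A ^^ k) h x))"
    by (rule cong[OF _ _ Suc]) (use assms iter_integrable in auto)
  then show ?case using add[OF iter_integrable[OF assms(1)] iter_integrable[OF assms(2)]] by (auto intro: ae_eq_trans)
qed (simp add: ae_eq_refl)

lemma eigen_iter:
  assumes u: "integrable leb01 u" and e: "ae_eq (A u) (\<lambda>x. z * u x)"
  shows "ae_eq ((A ^^ k) u) (\<lambda>x. z ^ k * u x)"
proof (induction k)
  case (Suc k)
  have "ae_eq (A ((A ^^ k) u)) (A (\<lambda>x. z ^ k * u x))"
    by (rule cong[OF iter_integrable[OF u] _ Suc]) (use u in simp)
  then have "ae_eq (A ((A ^^ k) u)) (\<lambda>x. z ^ k * A u x)" using scale[OF u] by (rule ae_eq_trans)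
  then have "ae_eq (A ((A ^^ k) u)) (\<lambda>x. z ^ k * (z * u x))" using ae_eq_scale[OF e] by (rule ae_eq_trans)
  then show ?case by (simp add: mult_ac)
qed (simp add: ae_eq_refl)

text \<open>
  An eigenfunction u for z satisfies z^k u = A^k u, so its norm is at most C k / |z|^k times a constant,
  and the terms of a convergent series tend to 0.
\<close>

lemma resolvent_unique:
  assumes \<alpha>: "0 < \<alpha>" "\<alpha> < 1"
    and C: "\<And>k h N. bnorm_le \<alpha> h N \<Longrightarrow> bnorm_le \<alpha> ((A ^^ k) h) (C k * N)"
    and z: "z \<noteq> 0" and s: "summable (\<lambda>k. C k / norm z ^ k)"
    and u: "bnorm_le \<alpha> u N" and e: "ae_eq (shifted A z u) (\<lambda>x. 0)"
  shows "ae_eq u (\<lambda>x. 0)"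
proof -
  have ui: "integrable leb01 u" by (rule bnorm_le_integrable[OF u])
  have e': "ae_eq (A u) (\<lambda>x. z * u x)" using e unfolding ae_eq_def shifted_def by (auto elim: eventually_mono)
  have "(LINT x|leb01. norm (u x)) \<le> 2 * (C k / norm z ^ k * N)" for k
  proof -
    have "bnorm_le \<alpha> (\<lambda>x. z ^ k * u x) (C k * N)"
      by (rule bnorm_le_ae[OF C[OF u] _ eigen_iter[OF ui e']]) (use ui in simp)
    then have "bnorm_le \<alpha> (\<lambda>x. inverse (z ^ k) * (z ^ k * u x)) (norm (inverse (z ^ k)) * (C k * N))"
      by (rule bnorm_le_scale)
    moreover have "(\<lambda>x. inverse (z ^ k) * (z ^ k * u x)) = u" using z by (simp add: mult.assoc[symmetric])
    moreover have "norm (inverse (z ^ k)) * (C k * N) = C k / norm z ^ k * N"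
      by (simp add: norm_inverse norm_power divide_inverse)
    ultimately have "bnorm_le \<alpha> u (C k / norm z ^ k * N)" by simp
    then show ?thesis by (rule L1_le_bnorm[OF _ \<alpha>])
  qed
  moreover have "(\<lambda>k. 2 * (C k / norm z ^ k * N)) \<longlonglongrightarrow> 2 * (0 * N)"
    by (intro tendsto_mult tendsto_const summable_LIMSEQ_zero s)
  ultimately have "(LINT x|leb01. norm (u x - 0)) \<le> 0" using LIMSEQ_le_const by fastforce
  then show ?thesis by (intro ae_eq_of_L1_zero ui) auto
qed

text \<open>
  The Neumann series \<Sum> z^(-k-1) A^k v is summed in L^1, where it converges because the L^1 norm is
  dominated by the norm of the space. The bound on the norm of the sum is lower semicontinuity,
  and the resolvent equation passes to the limit since A is bounded on L^1.
\<close>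

lemma resolvent_exists:
  assumes \<alpha>: "0 < \<alpha>" "\<alpha> < 1"
    and C: "\<And>k h N. bnorm_le \<alpha> h N \<Longrightarrow> bnorm_le \<alpha> ((A ^^ k) h) (C k * N)"
    and z: "z \<noteq> 0" and s: "summable (\<lambda>k. C k / norm z ^ k)"
    and v: "bnorm_le \<alpha> v N"
  shows "\<exists>u. bnorm_le \<alpha> u ((\<Sum>k. C k / norm z ^ k) / norm z * N) \<and> ae_eq (shifted A z u) v"
proof -
  have vi: "integrable leb01 v" by (rule bnorm_le_integrable[OF v])
  have N: "0 \<le> N" by (rule bnorm_le_nonneg[OF v])
  have C0: "0 \<le> C k" for k
    using bnorm_le_nonneg[OF C[OF bnorm_le_mono[OF bnorm_le_zero], of 1 k]] by simp
  define w where "w k x = inverse z ^ Suc k * (A ^^ k) v x" for k x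
  define cc where "cc k = C k / norm z ^ k / norm z * N" for k
  have wb: "bnorm_le \<alpha> (w k) (cc k)" for k
  proof -
    have "bnorm_le \<alpha> (w k) (norm (inverse z ^ Suc k) * (C k * N))"
      unfolding w_def[abs_def] by (rule bnorm_le_scale[OF C[OF v]])
    moreover have "norm (inverse z ^ Suc k) * (C k * N) = cc k"
      by (simp add: cc_def norm_mult norm_power norm_inverse divide_inverse power_inverse mult_ac)
    ultimately show ?thesis by simp
  qed
  have wi: "integrable leb01 (w k)" for k by (rule bnorm_le_integrable[OF wb])
  have scc: "summable cc" unfolding cc_def[abs_def] by (intro summable_mult2 summable_divide s)
  define a where "a k = (LINT x|leb01. norm (w k x))" for k
  have a0: "0 \<le> a k" for k by (simp add: a_def)
  have sa: "summable a"
    by (rule summable_comparison_test'[where N=0, OF summable_mult[OF scc, of 2]])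
       (use L1_le_bnorm[OF wb \<alpha>] in \<open>simp add: a_def\<close>)
  define u where "u x = (\<Sum>k. w k x)" for x
  define p where "p n x = (\<Sum>k<n. w k x)" for n x
  have ui: "integrable leb01 u" unfolding u_def by (rule integral_norm_series_le(1)[OF wi sa[unfolded a_def]])
  have pI: "integrable leb01 (p n)" for n unfolding p_def by (intro Bochner_Integration.integrable_sum wi)
  define e where "e n = (LINT x|leb01. norm (p n x - u x))" for n
  have eb: "e n \<le> (\<Sum>k. a k) - (\<Sum>k<n. a k)" for n
  proof -
    have san: "summable (\<lambda>k. LINT x|leb01. norm (w (k + n) x))"
      using summable_ignore_initial_segment[OF sa, of n] by (simp add: a_def)
    have "AE x in leb01. norm (p n x - u x) = norm (\<Sum>k. w (k + n) x)"
      using AE_summable_of_summable_integrals[OF wi sa[unfolded a_def]]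
    proof eventually_elim
      case (elim x)
      have "u x = (\<Sum>k. w (k + n) x) + p n x" unfolding u_def p_def
        by (rule suminf_split_initial_segment[OF summable_norm_cancel[OF elim]])
      then show ?case by (simp add: norm_minus_commute)
    qed
    then have "e n = (LINT x|leb01. norm (\<Sum>k. w (k + n) x))" unfolding e_def
      using ui pI integral_norm_series_le(1)[OF wi san]
      by (intro Bochner_Integration.integral_cong_AE) auto
    also have "\<dots> \<le> (\<Sum>k. LINT x|leb01. norm (w (k + n) x))" by (rule integral_norm_series_le(2)[OF wi san])
    also have "\<dots> = (\<Sum>k. a k) - (\<Sum>k<n. a k)"
      using suminf_minus_initial_segment[OF sa, of n] by (simp add: a_def)
    finally show ?thesis .
  qed
  have e0: "e \<longlonglongrightarrow> 0"
  proof (rule tendsto_sandwich[OF _ _ tendsto_const])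
    show "\<forall>\<^sub>F n in sequentially. 0 \<le> e n" by (simp add: e_def)
    show "\<forall>\<^sub>F n in sequentially. e n \<le> (\<Sum>k. a k) - (\<Sum>k<n. a k)" using eb by (intro always_eventually) blast
    show "(\<lambda>n. (\<Sum>k. a k) - (\<Sum>k<n. a k)) \<longlonglongrightarrow> 0"
      using tendsto_diff[OF tendsto_const summable_LIMSEQ[OF sa], of "\<Sum>k. a k"] by simp
  qed
  have "bnorm_le \<alpha> u ((\<Sum>k. C k / norm z ^ k) / norm z * N)"
  proof (rule bnorm_le_L1_limit[OF _ ui])
    show "(\<lambda>n. LINT x|leb01. norm (p n x - u x)) \<longlonglongrightarrow> 0" using e0 by (simp add: e_def[abs_def])
    fix n
    have "bnorm_le \<alpha> (p n) (\<Sum>k<n. cc k)" unfolding p_def by (rule bnorm_le_sum) (auto intro: wb)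
    moreover have "(\<Sum>k<n. cc k) \<le> (\<Sum>k. cc k)"
      by (rule sum_le_suminf[OF scc]) (use C0 N in \<open>auto simp: cc_def\<close>)
    moreover have "(\<Sum>k. cc k) = (\<Sum>k. C k / norm z ^ k) / norm z * N"
      unfolding cc_def suminf_mult2[OF summable_divide[OF s], symmetric] suminf_divide[OF s] ..
    ultimately show "bnorm_le \<alpha> (p n) ((\<Sum>k. C k / norm z ^ k) / norm z * N)" by (auto intro: bnorm_le_mono)
  qed
  moreover have "ae_eq (shifted A z u) v"
  proof -
    have zw: "z * w 0 x = v x" for x using z by (simp add: w_def)
    have Aw: "ae_eq (A (w k)) (\<lambda>x. z * w (Suc k) x)" for k
    proof -
      have "ae_eq (A (w k)) (\<lambda>x. inverse z ^ Suc k * A ((A ^^ k) v) x)"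
        unfolding w_def[abs_def] by (rule scale[OF iter_integrable[OF vi]])
      moreover have "(\<lambda>x. inverse z ^ Suc k * A ((A ^^ k) v) x) = (\<lambda>x. z * w (Suc k) x)"
        using z by (auto simp: w_def)
      ultimately show ?thesis by simp
    qed
    have Ap: "ae_eq (A (p n)) (\<lambda>x. z * p (Suc n) x - v x)" for n
    proof (induction n)
      case 0
      have "(\<lambda>x. z * p (Suc 0) x - v x) = (\<lambda>x. 0)" using zw by (simp add: p_def)
      moreover have "p 0 = (\<lambda>x. 0)" by (auto simp: p_def)
      ultimately show ?case using zero by simp
    next
      case (Suc n)
      have "p (Suc n) = (\<lambda>x. p n x + w n x)" by (auto simp: p_def)
      then have "ae_eq (A (p (Suc n))) (\<lambda>x. A (p n) x + A (w n) x)" using add[OF pI wi] by simp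
      then have "ae_eq (A (p (Suc n))) (\<lambda>x. (z * p (Suc n) x - v x) + z * w (Suc n) x)"
        by (rule ae_eq_trans[OF _ ae_eq_add[OF Suc Aw]])
      moreover have "(\<lambda>x. (z * p (Suc n) x - v x) + z * w (Suc n) x) = (\<lambda>x. z * p (Suc (Suc n)) x - v x)"
        by (simp add: p_def algebra_simps)
      ultimately show ?case by simp
    qed
    have Aui: "integrable leb01 (A u)" by (rule preserves_L1[OF ui])
    have sI: "integrable leb01 (shifted A z u)" unfolding shifted_def using ui Aui by simp
    have "(LINT x|leb01. norm (shifted A z u x - v x)) \<le> norm z * e (Suc n) + K * e n" for n
    proof -
      have d1: "integrable leb01 (\<lambda>x. z * (u x - p (Suc n) x))" using ui pI by simp
      have d2: "integrable leb01 (A (\<lambda>x. p n x - u x))" by (rule preserves_L1) (use ui pI in simp)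
      have "ae_eq (\<lambda>x. A (p n) x - A u x) (A (\<lambda>x. p n x - u x))" by (rule ae_eq_sym[OF diff[OF pI ui]])
      then have "ae_eq (\<lambda>x. shifted A z u x - v x) (\<lambda>x. z * (u x - p (Suc n) x) + A (\<lambda>x. p n x - u x) x)"
        using Ap[of n] unfolding ae_eq_def shifted_def
        by eventually_elim (simp add: algebra_simps)
      then have "(LINT x|leb01. norm (shifted A z u x - v x))
          = (LINT x|leb01. norm (z * (u x - p (Suc n) x) + A (\<lambda>x. p n x - u x) x))"
        by (rule L1_ae_cong) (use sI vi d1 d2 in auto)
      also have "\<dots> \<le> (LINT x|leb01. norm (z * (u x - p (Suc n) x))) + (LINT x|leb01. norm (A (\<lambda>x. p n x - u x) x))"
        by (rule L1_triangle[OF d1 d2])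
      also have "(LINT x|leb01. norm (z * (u x - p (Suc n) x))) = norm z * e (Suc n)"
        by (simp add: norm_mult e_def norm_minus_commute)
      also have "(LINT x|leb01. norm (A (\<lambda>x. p n x - u x) x)) \<le> K * e n"
        unfolding e_def by (rule L1_bound) (use ui pI in simp)
      finally show ?thesis by simp
    qed
    moreover have "(\<lambda>n. norm z * e (Suc n) + K * e n) \<longlonglongrightarrow> norm z * 0 + K * 0"
      by (intro tendsto_intros LIMSEQ_Suc e0)
    ultimately have "(LINT x|leb01. norm (shifted A z u x - v x)) \<le> 0" using LIMSEQ_le_const by fastforce
    then show ?thesis by (rule ae_eq_of_L1_zero[OF sI vi])
  qed
  ultimately show ?thesis by blast
qed

text \<open>
  The solution operator is chosen pointwise among representatives; uniqueness up to null sets makes any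
  choice linear and compatible with equality almost everywhere.
\<close>

lemma resolvent:
  assumes \<alpha>: "0 < \<alpha>" "\<alpha> < 1"
    and C: "\<And>k h N. bnorm_le \<alpha> h N \<Longrightarrow> bnorm_le \<alpha> ((A ^^ k) h) (C k * N)"
    and z: "z \<noteq> 0" and s: "summable (\<lambda>k. C k / norm z ^ k)"
  obtains S where "bounded_operator_on (B_space \<alpha>) (B_norm \<alpha>) S"
    "\<And>h. h \<in> B_space \<alpha> \<Longrightarrow> ae_eq (S (shifted A z h)) h"
    "\<And>h. h \<in> B_space \<alpha> \<Longrightarrow> ae_eq (shifted A z (S h)) h"
proof -
  define Z where "Z = (\<Sum>k. C k / norm z ^ k) / norm z"
  define S where "S v = (SOME u. bnorm_le \<alpha> u (Z * enn2real (B_norm \<alpha> v)) \<and> ae_eq (shifted A z u) v)" for v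
  have S: "bnorm_le \<alpha> (S v) (Z * enn2real (B_norm \<alpha> v))" "ae_eq (shifted A z (S v)) v" if v: "v \<in> B_space \<alpha>" for v
    unfolding S_def
    using someI_ex[OF resolvent_exists[OF \<alpha> C z s bnorm_le_exact[OF v]], folded Z_def] by blast+
  have A1: "bnorm_le \<alpha> (A h) (C 1 * N)" if "bnorm_le \<alpha> h N" for h N using C[OF that, of 1] by simp
  have SB: "S v \<in> B_space \<alpha>" if "v \<in> B_space \<alpha>" for v using S(1)[OF that] B_space_iff by blast
  have AB: "A h \<in> B_space \<alpha>" if "h \<in> B_space \<alpha>" for h using that A1 unfolding B_space_iff by blast
  have diffB: "(\<lambda>x. g x - h x) \<in> B_space \<alpha>" if "g \<in> B_space \<alpha>" "h \<in> B_space \<alpha>" for g h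
    using that bnorm_le_diff unfolding B_space_iff by blast
  have addB: "(\<lambda>x. g x + h x) \<in> B_space \<alpha>" if "g \<in> B_space \<alpha>" "h \<in> B_space \<alpha>" for g h
    using that bnorm_le_add unfolding B_space_iff by blast
  have scaleB: "(\<lambda>x. k * h x) \<in> B_space \<alpha>" if "h \<in> B_space \<alpha>" for k h
    using that bnorm_le_scale unfolding B_space_iff by blast
  have shB: "shifted A z h \<in> B_space \<alpha>" if "h \<in> B_space \<alpha>" for h
    unfolding shifted_def by (intro diffB scaleB AB that)
  have I: "integrable leb01 h" if "h \<in> B_space \<alpha>" for h using that by (simp add: B_space_def)
  have inj: "ae_eq u u'" if uB: "u \<in> B_space \<alpha>" "u' \<in> B_space \<alpha>" and e: "ae_eq (shifted A z u) (shifted A z u')" for u u'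
  proof -
    have "ae_eq (shifted A z (\<lambda>x. u x - u' x)) (\<lambda>x. shifted A z u x - shifted A z u' x)"
      using diff[OF I[OF uB(1)] I[OF uB(2)]] unfolding ae_eq_def shifted_def
      by eventually_elim (simp add: algebra_simps)
    moreover have "ae_eq (\<lambda>x. shifted A z u x - shifted A z u' x) (\<lambda>x. 0)"
      using e unfolding ae_eq_def by eventually_elim simp
    ultimately have e0: "ae_eq (shifted A z (\<lambda>x. u x - u' x)) (\<lambda>x. 0)" by (rule ae_eq_trans)
    obtain N where N: "bnorm_le \<alpha> (\<lambda>x. u x - u' x) N" using diffB[OF uB] B_space_iff by blast
    have "ae_eq (\<lambda>x. u x - u' x) (\<lambda>x. 0)" by (rule resolvent_unique[OF \<alpha> C z s N e0])
    then show ?thesis unfolding ae_eq_def by eventually_elim simp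
  qed
  have Ssh: "ae_eq (S (shifted A z h)) h" if h: "h \<in> B_space \<alpha>" for h
    by (rule inj[OF SB[OF shB[OF h]] h S(2)[OF shB[OF h]]])
  have "bounded_operator_on (B_space \<alpha>) (B_norm \<alpha>) S" unfolding bounded_operator_on_def
  proof (intro conjI ballI allI impI)
    show "S h \<in> B_space \<alpha>" if "h \<in> B_space \<alpha>" for h by (rule SB[OF that])
    show "ae_eq (S g) (S h)" if g: "g \<in> B_space \<alpha>" and h: "h \<in> B_space \<alpha>" and e: "ae_eq g h" for g h
      by (rule inj[OF SB[OF g] SB[OF h]], rule ae_eq_trans[OF S(2)[OF g]], rule ae_eq_trans[OF e], rule ae_eq_sym[OF S(2)[OF h]])
    show "ae_eq (S (\<lambda>x. g x + h x)) (\<lambda>x. S g x + S h x)" if g: "g \<in> B_space \<alpha>" and h: "h \<in> B_space \<alpha>" for g h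
    proof (rule inj[OF SB[OF addB[OF g h]] addB[OF SB[OF g] SB[OF h]]])
      have "ae_eq (shifted A z (\<lambda>x. S g x + S h x)) (\<lambda>x. g x + h x)"
        using add[OF I[OF SB[OF g]] I[OF SB[OF h]]] S(2)[OF g] S(2)[OF h] unfolding ae_eq_def shifted_def
        by eventually_elim (simp add: algebra_simps)
      then show "ae_eq (shifted A z (S (\<lambda>x. g x + h x))) (shifted A z (\<lambda>x. S g x + S h x))"
        by (rule ae_eq_trans[OF S(2)[OF addB[OF g h]] ae_eq_sym])
    qed
    show "ae_eq (S (\<lambda>x. k * h x)) (\<lambda>x. k * S h x)" if h: "h \<in> B_space \<alpha>" for k h
    proof (rule inj[OF SB[OF scaleB[OF h]] scaleB[OF SB[OF h]]])
      have "ae_eq (\<lambda>x. k * (z * S h x - A (S h) x)) (\<lambda>x. k * h x)"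
        using ae_eq_scale[OF S(2)[OF h, unfolded shifted_def]] .
      then have "ae_eq (shifted A z (\<lambda>x. k * S h x)) (\<lambda>x. k * h x)"
        using scale[OF I[OF SB[OF h]], of k] unfolding ae_eq_def shifted_def
        by eventually_elim (simp add: algebra_simps)
      then show "ae_eq (shifted A z (S (\<lambda>x. k * h x))) (shifted A z (\<lambda>x. k * S h x))"
        by (rule ae_eq_trans[OF S(2)[OF scaleB[OF h]] ae_eq_sym])
    qed
    show "\<exists>C. \<forall>h\<in>B_space \<alpha>. B_norm \<alpha> (S h) \<le> ennreal C * B_norm \<alpha> h"
    proof (intro exI[of _ "max 0 Z"] ballI)
      fix h assume h: "h \<in> B_space \<alpha>"
      have fin: "B_norm \<alpha> h = ennreal (enn2real (B_norm \<alpha> h))" using h by (simp add: B_space_def)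
      have "B_norm \<alpha> (S h) \<le> ennreal (Z * enn2real (B_norm \<alpha> h))" using S(1)[OF h] bnorm_le_iff by blast
      also have "\<dots> \<le> ennreal (max 0 Z * enn2real (B_norm \<alpha> h))" by (intro ennreal_leI mult_right_mono) auto
      also have "\<dots> = ennreal (max 0 Z) * ennreal (enn2real (B_norm \<alpha> h))" by (rule ennreal_mult) auto
      also have "\<dots> = ennreal (max 0 Z) * B_norm \<alpha> h" using fin by simp
      finally show "B_norm \<alpha> (S h) \<le> ennreal (max 0 Z) * B_norm \<alpha> h" .
    qed
  qed
  then show thesis by (rule that[OF _ Ssh S(2)])
qed

end

section \<open>Spectral bounds for the transfer operator\<close>

text \<open>
  Several indices may give the same function, so coefficients are collected over the fibres.
\<close>

lemma finite_span_reindex: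
  assumes "finite I"
  obtains k' where "\<And>x. (\<Sum>i\<in>I. k i * g i x) = (\<Sum>u\<in>g ` I. k' u * (u x :: complex))"
proof
  fix x
  have "(\<Sum>i\<in>I. k i * g i x) = (\<Sum>u\<in>g ` I. \<Sum>i\<in>{i \<in> I. g i = u}. k i * g i x)"
    by (rule sum.image_gen[OF assms])
  also have "\<dots> = (\<Sum>u\<in>g ` I. (\<Sum>i\<in>{i \<in> I. g i = u}. k i) * u x)"
    unfolding sum_distrib_right by (intro sum.cong refl) auto
  finally show "(\<Sum>i\<in>I. k i * g i x) = (\<Sum>u\<in>g ` I. (\<Sum>i\<in>{i \<in> I. g i = u}. k i) * u x)" .
qed

text \<open>
  The derivative of a test function, cut off outside the unit interval, is a bounded Borel function whose
  primitive has Hoelder constant 1.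
\<close>

lemma test_function:
  assumes C1: "C1_on_01 \<phi> \<phi>'" and H: "Holder_norm \<alpha> \<phi> \<le> 1"
  defines "\<psi> \<equiv> \<lambda>x. if x \<in> {0..1} then \<phi>' x else 0"
  shows "bounded_borel \<psi>" "primitive_Holder \<alpha> 1 {0..1} \<psi>"
    "(LINT x|leb01. h x * \<phi>' x) = (LINT x|leb01. h x * \<psi> x)"
proof -
  obtain B where B: "0 \<le> B" "\<And>x. x \<in> {0..1} \<Longrightarrow> norm (\<phi>' x) \<le> B" using C1_bounded[OF C1] by metis
  have "(\<lambda>x. indicator {0..1} x *\<^sub>R \<phi>' x) \<in> borel_measurable borel"
    by (rule borel_measurable_continuous_on_indicator[OF _ C1_continuous[OF C1]]) simp
  moreover have "(\<lambda>x. indicator {0..1} x *\<^sub>R \<phi>' x) = \<psi>" by (auto simp: \<psi>_def indicator_def)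
  moreover have "norm (\<psi> x) \<le> B" for x using B by (simp add: \<psi>_def)
  ultimately show "bounded_borel \<psi>" unfolding bounded_borel_def by auto
  show "primitive_Holder \<alpha> 1 {0..1} \<psi>"
  proof (rule primitive_HolderI)
    fix u v :: real assume uv: "u \<le> v" "{u..v} \<subseteq> {0..1}"
    then have uv01: "u \<in> {0..1}" "v \<in> {0..1}" by auto
    have "(\<phi>' has_integral (\<phi> v - \<phi> u)) {u..v}"
    proof (rule fundamental_theorem_of_calculus[OF uv(1)])
      fix x assume "x \<in> {u..v}"
      then have "(\<phi> has_vector_derivative \<phi>' x) (at x within {0..1})" using C1 uv(2) unfolding C1_on_01_def by blast
      then show "(\<phi> has_vector_derivative \<phi>' x) (at x within {u..v})" by (rule has_vector_derivative_within_subset[OF _ uv(2)])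
    qed
    moreover have "integral {u..v} \<psi> = integral {u..v} \<phi>'"
      by (rule integral_cong) (use uv(2) in \<open>auto simp: \<psi>_def\<close>)
    ultimately have "integral {u..v} \<psi> = \<phi> v - \<phi> u" by (simp add: integral_unique)
    then show "norm (integral {u..v} \<psi>) \<le> 1 * (v - u) powr \<alpha>"
      using Holder_norm_le_1D[OF H uv01(2,1)] uv(1) by simp
  qed
  show "(LINT x|leb01. h x * \<phi>' x) = (LINT x|leb01. h x * \<psi> x)"
    by (rule Bochner_Integration.integral_cong[OF refl]) (auto simp: \<psi>_def)
qed

lemma pairing_bounded_borel:
  assumes h: "bnorm_le \<alpha> h N" and \<alpha>: "0 < \<alpha>" "\<alpha> < 1" and \<psi>: "bounded_borel \<psi>"
    and H: "0 \<le> H" "primitive_Holder \<alpha> H {0..1} \<psi>"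
  shows "norm (LINT x|leb01. h x * \<psi> x) \<le> 2 * H * N"
proof -
  obtain B where B: "0 < B" "\<And>x. norm (\<psi> x) \<le> B" by (rule bounded_borel_bound[OF \<psi>]) (rule that)
  show ?thesis by (rule pairing[OF h \<alpha> H(1) bounded_borel_leb01[OF \<psi>] B H(2)])
qed

lemma bnorm_le_indicator:
  assumes lr: "0 \<le> l" "l \<le> r" "r \<le> 1" and \<alpha>: "0 < \<alpha>"
  shows "bnorm_le \<alpha> (indicator {l<..<r}) 1"
proof (rule bnorm_leI)
  have one: "integrable leb01 (\<lambda>_. 1 :: complex)" by (rule integrable_leb01_bounded[where B=1]) auto
  show "integrable leb01 (indicator {l<..<r} :: real \<Rightarrow> complex)" using indicator_mult_integrable(1)[OF one] by simp
  fix \<phi> \<phi>' assume a: "C1_on_01 \<phi> \<phi>'" "Holder_norm \<alpha> \<phi> \<le> 1"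
  define \<psi> where "\<psi> x = (if x \<in> {0..1} then \<phi>' x else 0)" for x
  note t = test_function[OF a, folded \<psi>_def]
  obtain B where B: "0 < B" "\<And>x. norm (\<psi> x) \<le> B" by (rule bounded_borel_bound[OF t(1)]) (rule that)
  have \<psi>i: "integrable leb01 \<psi>" by (rule integrable_leb01_bounded[OF bounded_borel_leb01[OF t(1)] B(2)])
  have "(LINT x|leb01. indicator {l<..<r} x * \<phi>' x) = integral {l..r} \<psi>"
    unfolding t(3) by (rule LINT_indicator[OF \<psi>i lr(1,3)])
  also have "norm \<dots> \<le> 1 * (r - l) powr \<alpha>" by (rule primitive_HolderD[OF t(2) lr(2)]) (use lr in auto)
  also have "\<dots> \<le> 1" using lr \<alpha> by (simp add: powr_le1)
  finally show "norm (LINT x|leb01. indicator {l<..<r} x * \<phi>' x) \<le> 1" .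
qed simp

lemma cell_avg_L1:
  assumes J: "cells \<J>" "J \<in> \<J>" and h: "integrable leb01 h"
  shows "norm (cell_avg J h) \<le> (LINT x|leb01. norm (h x)) / measure lborel J"
proof -
  obtain l r where J: "J = {l<..<r}" by (rule cells_obtain[OF J]) (rule that)
  have "norm (LINT x|leb01. indicator J x * h x) \<le> (LINT x|leb01. norm (indicator J x * h x))" by (rule integral_norm_bound)
  also have "\<dots> \<le> (LINT x|leb01. norm (h x))"
    using indicator_mult_integrable(1)[OF h] h unfolding J
    by (intro integral_mono integrable_norm) (auto simp: norm_mult indicator_def)
  finally show ?thesis unfolding cell_avg_def norm_divide by (simp add: divide_right_mono)
qed

lemma cell_avg_add:
  assumes J: "cells \<J>" "J \<in> \<J>" and gh: "integrable leb01 g" "integrable leb01 h"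
  shows "cell_avg J (\<lambda>x. g x + h x) = cell_avg J g + cell_avg J h"
proof -
  obtain l r where J: "J = {l<..<r}" by (rule cells_obtain[OF J]) (rule that)
  have "(LINT x|leb01. indicator J x * (g x + h x)) = (LINT x|leb01. indicator J x * g x) + (LINT x|leb01. indicator J x * h x)"
    unfolding distrib_left J by (rule Bochner_Integration.integral_add; rule indicator_mult_integrable(1)[OF gh(1)] indicator_mult_integrable(1)[OF gh(2)])
  then show ?thesis by (simp add: cell_avg_def add_divide_distrib)
qed

lemma cell_avg_scale: "cell_avg J (\<lambda>x. k * h x) = k * cell_avg J h"
  unfolding cell_avg_def mult.left_commute[of _ k] by simp

text \<open>
  The norm of the averaging operator from L^1 to the space is at most this number, since the indicator of an interval
  has norm at most 1.
\<close>

definition cells_weight :: "real set set \<Rightarrow> real" where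
  "cells_weight \<J> = (\<Sum>J\<in>\<J>. 1 / measure lborel J)"

lemma cells_weight_nonneg: "0 \<le> cells_weight \<J>" unfolding cells_weight_def by (intro sum_nonneg) simp

lemma averaging_bnorm:
  assumes J: "cells \<J>" and h: "integrable leb01 h" and \<alpha>: "0 < \<alpha>"
  shows "bnorm_le \<alpha> (averaging \<J> h) (cells_weight \<J> * (LINT x|leb01. norm (h x)))"
proof -
  have "bnorm_le \<alpha> (\<lambda>x. cell_avg K h * indicator K x) (1 / measure lborel K * (LINT x|leb01. norm (h x)))"
    if K: "K \<in> \<J>" for K
  proof -
    obtain l r where lr: "0 \<le> l" "l \<le> r" "r \<le> 1" "K = {l<..<r}" by (rule cells_obtain[OF J K]) (rule that)
    have "bnorm_le \<alpha> (\<lambda>x. cell_avg K h * indicator K x) (norm (cell_avg K h) * 1)"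
      unfolding lr(4) by (intro bnorm_le_scale bnorm_le_indicator lr \<alpha>)
    then show ?thesis by (rule bnorm_le_mono) (use cell_avg_L1[OF J K h] in simp)
  qed
  then have "bnorm_le \<alpha> (\<lambda>x. \<Sum>K\<in>\<J>. cell_avg K h * indicator K x) (\<Sum>K\<in>\<J>. 1 / measure lborel K * (LINT x|leb01. norm (h x)))"
    by (intro bnorm_le_sum cells_finite[OF J])
  then show ?thesis unfolding averaging_def[abs_def] cells_weight_def sum_distrib_right .
qed

context branches
begin

lemma L1_operator_Top: "L1_operator Transfer M"
  by unfold_locales (auto intro: Transfer_integrable Transfer_L1 M Transfer_add simp: Transfer_scale ae_eq_refl)

sublocale T: L1_operator Transfer M by (rule L1_operator_Top)

lemma Transfer_iter_duality:
  assumes h: "integrable leb01 h" and \<psi>: "bounded_borel \<psi>"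
  shows "(LINT x|leb01. (Transfer ^^ n) h x * \<psi> x) = (LINT x|leb01. h x * (Koopman ^^ n) \<psi> x)"
  using \<psi>
proof (induction n arbitrary: \<psi>)
  case (Suc n)
  have "(LINT x|leb01. (Transfer ^^ Suc n) h x * \<psi> x) = (LINT x|leb01. (Transfer ^^ n) h x * Koopman \<psi> x)"
    using Transfer_duality[OF T.iter_integrable[OF h] Suc.prems] by simp
  also have "\<dots> = (LINT x|leb01. h x * (Koopman ^^ n) (Koopman \<psi>) x)" by (rule Suc.IH[OF Koopman_bounded_borel[OF Suc.prems]])
  finally show ?case by (simp add: funpow_swap1)
qed simp

lemma Transfer_bnorm:
  assumes h: "bnorm_le \<alpha> h N" shows "bnorm_le \<alpha> (Transfer h) (2 * growth * N)"
proof (rule bnorm_leI)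
  have hi: "integrable leb01 h" by (rule bnorm_le_integrable[OF h])
  show "integrable leb01 (Transfer h)" by (rule Transfer_integrable[OF hi])
  show "0 \<le> 2 * growth * N" using growth_nonneg bnorm_le_nonneg[OF h] by simp
  fix \<phi> \<phi>' assume a: "C1_on_01 \<phi> \<phi>'" "Holder_norm \<alpha> \<phi> \<le> 1"
  define \<psi> where "\<psi> x = (if x \<in> {0..1} then \<phi>' x else 0)" for x
  note t = test_function[OF a, folded \<psi>_def]
  have "norm (LINT x|leb01. h x * Koopman \<psi> x) \<le> 2 * (growth * 1) * N"
    by (rule pairing_bounded_borel[OF h \<alpha> Koopman_bounded_borel[OF t(1)] _ Koopman_Holder[OF t(1) _ t(2)]]) (use growth_nonneg in auto)
  then show "norm (LINT x|leb01. Transfer h x * \<phi>' x) \<le> 2 * growth * N"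
    unfolding t(3) Transfer_duality[OF hi t(1)] by simp
qed

lemma Transfer_iter_bnorm: "bnorm_le \<alpha> h N \<Longrightarrow> bnorm_le \<alpha> ((Transfer ^^ k) h) ((2 * growth) ^ k * N)"
proof (induction k)
  case (Suc k)
  then show ?case using Transfer_bnorm[OF Suc.IH[OF Suc.prems]] by (simp add: mult_ac)
qed simp

text \<open>
  By duality and symmetry of averaging, testing L^n (1 - E) h against \<psi> is pairing h with
  (1 - E) K^n \<psi>, whose Hoelder constant is 4 \<kappa>^n plus a small number.
\<close>

lemma Lasota_Yorke_decomposition:
  assumes \<kappa>: "Q < \<kappa>" and \<epsilon>: "0 < \<epsilon>"
  obtains \<J> where "cells \<J>"
    "\<And>h N. bnorm_le \<alpha> h N \<Longrightarrow> bnorm_le \<alpha> ((Transfer ^^ n) (\<lambda>x. h x - averaging \<J> h x)) ((8 * \<kappa> ^ n + \<epsilon>) * N)"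
proof -
  have \<kappa>0: "0 < \<kappa>" using \<kappa> Q by linarith
  obtain \<J> where J: "cells \<J>" and dec: "\<And>\<psi>. bounded_borel \<psi> \<Longrightarrow> primitive_Holder \<alpha> 1 {0..1} \<psi> \<Longrightarrow>
    (\<forall>J\<in>\<J>. primitive_Holder \<alpha> (\<kappa> ^ n) J ((Koopman ^^ n) \<psi>)) \<and>
    primitive_Holder \<alpha> (\<epsilon> / 2) {0..1} (\<lambda>x. if x \<in> \<Union>\<J> then 0 else (Koopman ^^ n) \<psi> x)"
    using iterate_decomposition[OF \<kappa>, of "\<epsilon> / 2" n] \<epsilon> by auto
  show thesis
  proof (rule that[OF J])
    fix h N assume h: "bnorm_le \<alpha> h N"
    have hi: "integrable leb01 h" by (rule bnorm_le_integrable[OF h])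
    have di: "integrable leb01 (\<lambda>x. h x - averaging \<J> h x)" using hi averaging_integrable[OF J] by simp
    show "bnorm_le \<alpha> ((Transfer ^^ n) (\<lambda>x. h x - averaging \<J> h x)) ((8 * \<kappa> ^ n + \<epsilon>) * N)"
    proof (rule bnorm_leI[OF T.iter_integrable[OF di]])
      show "0 \<le> (8 * \<kappa> ^ n + \<epsilon>) * N" using \<kappa>0 \<epsilon> bnorm_le_nonneg[OF h] by simp
      fix \<phi> \<phi>' assume a: "C1_on_01 \<phi> \<phi>'" "Holder_norm \<alpha> \<phi> \<le> 1"
      define \<psi> where "\<psi> x = (if x \<in> {0..1} then \<phi>' x else 0)" for x
      note t = test_function[OF a, folded \<psi>_def]
      define g where "g = (Koopman ^^ n) \<psi>"
      have bg: "bounded_borel g" unfolding g_def by (rule Koopman_iter_bounded_borel[OF t(1)])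
      have ba: "bounded_borel (averaging \<J> g)" by (rule averaging_bounded_borel[OF J])
      have H: "primitive_Holder \<alpha> (4 * \<kappa> ^ n + \<epsilon> / 2) {0..1} (\<lambda>x. g x - averaging \<J> g x)"
        using dec[OF t(1,2), folded g_def] \<kappa>0 by (intro averaging_Holder[OF J bg \<alpha>]) auto
      have bd: "bounded_borel (\<lambda>x. g x - averaging \<J> g x)"
        using bounded_borel_add[OF bg, of "\<lambda>x. - averaging \<J> g x"] ba by (simp add: bounded_borel_def)
      have i1: "integrable leb01 (\<lambda>x. k x * q x)" if k: "integrable leb01 k" and q: "bounded_borel q" for k q :: "real \<Rightarrow> complex"
      proof -
        obtain B where B: "0 < B" "\<And>x. norm (q x) \<le> B" by (rule bounded_borel_bound[OF q]) (rule that)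
        show ?thesis by (rule integrable_mult_bounded[OF k bounded_borel_leb01[OF q] B(2)])
      qed
      have "(LINT x|leb01. (Transfer ^^ n) (\<lambda>x. h x - averaging \<J> h x) x * \<phi>' x) = (LINT x|leb01. (h x - averaging \<J> h x) * g x)"
        unfolding t(3) g_def by (rule Transfer_iter_duality[OF di t(1)])
      also have "\<dots> = (LINT x|leb01. h x * g x) - (LINT x|leb01. averaging \<J> h x * g x)"
        unfolding left_diff_distrib
        by (rule Bochner_Integration.integral_diff[OF i1[OF hi bg] i1[OF averaging_integrable[OF J] bg]])
      also have "\<dots> = (LINT x|leb01. h x * g x) - (LINT x|leb01. h x * averaging \<J> g x)"
        by (simp only: averaging_symmetric[OF J hi bg])
      also have "\<dots> = (LINT x|leb01. h x * (g x - averaging \<J> g x))"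
        unfolding right_diff_distrib by (rule Bochner_Integration.integral_diff[OF i1[OF hi bg] i1[OF hi ba], symmetric])
      also have "norm \<dots> \<le> 2 * (4 * \<kappa> ^ n + \<epsilon> / 2) * N"
        by (rule pairing_bounded_borel[OF h \<alpha> bd _ H]) (use \<kappa>0 \<epsilon> in auto)
      finally show "norm (LINT x|leb01. (Transfer ^^ n) (\<lambda>x. h x - averaging \<J> h x) x * \<phi>' x) \<le> (8 * \<kappa> ^ n + \<epsilon>) * N"
        by (simp add: algebra_simps)
    qed
  qed
qed

text \<open>
  Choose \<kappa> between Q and \<rho> and n so large that 8 \<kappa>^n < \<rho>^n / 2. Then
  ||L^n h|| \<le> \<theta> ||h|| + C1 |h|_1 with \<theta> < \<rho>^n, and as |L^k h|_1 \<le> M^k |h|_1 with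
  M < \<rho>, a strong induction in steps of n gives growth at most \<rho>^k.
\<close>

lemma Transfer_power_growth:
  assumes \<rho>: "Q < \<rho>" "M < \<rho>"
  obtains K where "\<And>k h N. bnorm_le \<alpha> h N \<Longrightarrow> bnorm_le \<alpha> ((Transfer ^^ k) h) (K * \<rho> ^ k * N)"
proof -
  have \<rho>0: "0 < \<rho>" using \<rho> M by linarith
  define \<kappa> where "\<kappa> = (Q + \<rho>) / 2"
  have \<kappa>: "Q < \<kappa>" "0 < \<kappa>" "\<kappa> < \<rho>" using \<rho> Q by (auto simp: \<kappa>_def)
  have "(\<lambda>n. (\<kappa> / \<rho>) ^ n) \<longlonglongrightarrow> 0" using \<kappa> \<rho>0 by (intro LIMSEQ_realpow_zero) auto
  then have "eventually (\<lambda>n. (\<kappa> / \<rho>) ^ n < 1 / 16) sequentially" by (rule order_tendstoD(2)) simp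
  then obtain n where n: "(\<kappa> / \<rho>) ^ n < 1 / 16" using eventually_happens'[OF sequentially_bot] by blast
  have n0: "0 < n" using n by (cases n) auto
  have \<rho>n: "0 < \<rho> ^ n" using \<rho>0 by simp
  have \<kappa>n: "8 * \<kappa> ^ n < \<rho> ^ n / 2" using n \<rho>n by (simp add: power_divide field_simps)
  define \<theta> where "\<theta> = 8 * \<kappa> ^ n + \<rho> ^ n / 4"
  have \<theta>: "0 \<le> \<theta>" "\<theta> < \<rho> ^ n"
    unfolding \<theta>_def using \<kappa>n \<rho>n zero_le_power[of \<kappa> n] \<kappa>(2) by linarith+
  obtain \<J> where J: "cells \<J>"
    and LY: "\<And>h N. bnorm_le \<alpha> h N \<Longrightarrow> bnorm_le \<alpha> ((Transfer ^^ n) (\<lambda>x. h x - averaging \<J> h x)) (\<theta> * N)"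
    by (rule Lasota_Yorke_decomposition[OF \<kappa>(1), of "\<rho> ^ n / 4" n]) (use \<rho>n in \<open>auto simp: \<theta>_def\<close>)
  define C1 where "C1 = (2 * growth) ^ n * cells_weight \<J>"
  have C1: "0 \<le> C1" unfolding C1_def using growth_nonneg cells_weight_nonneg by simp
  have step: "bnorm_le \<alpha> ((Transfer ^^ n) h) (\<theta> * N + C1 * (LINT x|leb01. norm (h x)))" if h: "bnorm_le \<alpha> h N" for h N
  proof -
    have hi: "integrable leb01 h" by (rule bnorm_le_integrable[OF h])
    have ai: "integrable leb01 (averaging \<J> h)" by (rule averaging_integrable[OF J])
    have "bnorm_le \<alpha> ((Transfer ^^ n) (averaging \<J> h)) (C1 * (LINT x|leb01. norm (h x)))"
      using Transfer_iter_bnorm[OF averaging_bnorm[OF J hi \<alpha>(1)], of n] by (simp add: C1_def mult.assoc)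
    then have "bnorm_le \<alpha> (\<lambda>x. (Transfer ^^ n) (\<lambda>x. h x - averaging \<J> h x) x + (Transfer ^^ n) (averaging \<J> h) x)
       (\<theta> * N + C1 * (LINT x|leb01. norm (h x)))"
      by (rule bnorm_le_add[OF LY[OF h]])
    moreover have "ae_eq (\<lambda>x. (Transfer ^^ n) (\<lambda>x. h x - averaging \<J> h x) x + (Transfer ^^ n) (averaging \<J> h) x) ((Transfer ^^ n) h)"
      using T.iter_add[of "\<lambda>x. h x - averaging \<J> h x" "averaging \<J> h" n] hi ai by (simp add: ae_eq_sym)
    ultimately show ?thesis by (rule bnorm_le_ae[OF _ T.iter_integrable[OF hi]])
  qed
  \<comment> \<open>the first part starts the induction for exponents below n, the second carries the induction step\<close>
  define K where "K = (\<Sum>i<n. (2 * growth / \<rho>) ^ i) + 2 * C1 / (\<rho> ^ n - \<theta>)"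
  have K1: "(2 * growth / \<rho>) ^ i \<le> K" if "i < n" for i
  proof -
    have "(2 * growth / \<rho>) ^ i \<le> (\<Sum>i<n. (2 * growth / \<rho>) ^ i)"
      by (rule member_le_sum) (use that growth_nonneg \<rho>0 in auto)
    moreover have "0 \<le> 2 * C1 / (\<rho> ^ n - \<theta>)" using C1 \<theta> by simp
    ultimately show ?thesis by (simp add: K_def)
  qed
  have K2: "\<theta> * K + 2 * C1 \<le> K * \<rho> ^ n"
  proof -
    have "2 * C1 / (\<rho> ^ n - \<theta>) \<le> K" unfolding K_def using growth_nonneg \<rho>0 by (simp add: sum_nonneg)
    then have "2 * C1 \<le> K * (\<rho> ^ n - \<theta>)" using \<theta> by (simp add: pos_divide_le_eq)
    then show ?thesis by (simp add: algebra_simps)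
  qed
  show thesis
  proof (rule that)
    fix k h N assume h: "bnorm_le \<alpha> h N"
    have N: "0 \<le> N" by (rule bnorm_le_nonneg[OF h])
    show "bnorm_le \<alpha> ((Transfer ^^ k) h) (K * \<rho> ^ k * N)"
    proof (induction k rule: less_induct)
      case (less k)
      show ?case
      proof (cases "k < n")
        case True
        have "(2 * growth) ^ k = (2 * growth / \<rho>) ^ k * \<rho> ^ k" using \<rho>0 by (simp add: power_divide)
        also have "\<dots> \<le> K * \<rho> ^ k" using \<rho>0 by (intro mult_right_mono K1[OF True]) simp
        finally show ?thesis by (intro bnorm_le_mono[OF Transfer_iter_bnorm[OF h]] mult_right_mono N)
      next
        case False
        define j where "j = k - n"
        have j: "k = n + j" "j < k" using False n0 by (auto simp: j_def)
        have hi: "integrable leb01 h" by (rule bnorm_le_integrable[OF h])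
        have "(LINT x|leb01. norm ((Transfer ^^ j) h x)) \<le> M ^ j * (LINT x|leb01. norm (h x))" by (rule T.iter_L1[OF hi])
        also have "\<dots> \<le> \<rho> ^ j * (2 * N)"
          using \<rho> M N by (intro mult_mono power_mono L1_le_bnorm[OF h \<alpha>]) auto
        finally have l: "(LINT x|leb01. norm ((Transfer ^^ j) h x)) \<le> \<rho> ^ j * (2 * N)" .
        have "\<theta> * (K * \<rho> ^ j * N) + C1 * (LINT x|leb01. norm ((Transfer ^^ j) h x))
            \<le> \<theta> * (K * \<rho> ^ j * N) + C1 * (\<rho> ^ j * (2 * N))"
          by (intro add_left_mono mult_left_mono l C1)
        also have "\<dots> = (\<theta> * K + 2 * C1) * (\<rho> ^ j * N)" by (simp add: algebra_simps)
        also have "\<dots> \<le> K * \<rho> ^ n * (\<rho> ^ j * N)" using \<rho>0 N by (intro mult_right_mono K2) auto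
        also have "\<dots> = K * \<rho> ^ k * N" by (simp add: j(1) power_add)
        finally have "\<theta> * (K * \<rho> ^ j * N) + C1 * (LINT x|leb01. norm ((Transfer ^^ j) h x)) \<le> K * \<rho> ^ k * N" .
        then have "bnorm_le \<alpha> ((Transfer ^^ n) ((Transfer ^^ j) h)) (K * \<rho> ^ k * N)"
          by (rule bnorm_le_mono[OF step[OF less.IH[OF j(2)]]])
        then show ?thesis by (simp add: j(1) funpow_add)
      qed
    qed
  qed
qed

lemma Transfer_resolvent:
  assumes z: "Q < norm z" "M < norm z"
  obtains S where "bounded_operator_on (B_space \<alpha>) (B_norm \<alpha>) S"
    "\<And>h. h \<in> B_space \<alpha> \<Longrightarrow> ae_eq (S (shifted Transfer z h)) h"
    "\<And>h. h \<in> B_space \<alpha> \<Longrightarrow> ae_eq (shifted Transfer z (S h)) h"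
proof -
  define \<rho> where "\<rho> = (max Q M + norm z) / 2"
  have \<rho>: "Q < \<rho>" "M < \<rho>" "\<rho> < norm z" using z by (auto simp: \<rho>_def max_def)
  have z0: "z \<noteq> 0" using z M by auto
  obtain K where K: "\<And>k h N. bnorm_le \<alpha> h N \<Longrightarrow> bnorm_le \<alpha> ((Transfer ^^ k) h) (K * \<rho> ^ k * N)"
    by (rule Transfer_power_growth[OF \<rho>(1,2)]) (rule that)
  have "summable (\<lambda>k. K * (\<rho> / norm z) ^ k)" using \<rho> M z0 by (intro summable_mult summable_geometric) (auto simp: divide_less_eq)
  then have s: "summable (\<lambda>k. K * \<rho> ^ k / norm z ^ k)" by (simp add: power_divide)
  show thesis by (rule T.resolvent[OF \<alpha> K z0 s]) (assumption, rule that)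
qed

text \<open>
  With A = L (1 - E), the operator z - L is z - A minus the finite-rank operator L E, and z - A has a
  bounded inverse S. An element of the kernel equals S L E h, hence lies in the span of the functions
  S L 1_J over the cells J; and g = (z - L) S g + L E S g, so the functions L 1_J span a complement of the
  range.
\<close>

lemma Transfer_Fredholm:
  assumes z: "8 * Q < norm z" shows "Fredholm_on (B_space \<alpha>) (shifted Transfer z)"
proof -
  define \<kappa> where "\<kappa> = (Q + norm z / 8) / 2"
  define \<epsilon> where "\<epsilon> = (norm z - 8 * \<kappa>) / 2"
  have \<kappa>: "Q < \<kappa>" "8 * \<kappa> < norm z" "0 < \<kappa>" using z Q by (auto simp: \<kappa>_def)
  have \<epsilon>: "0 < \<epsilon>" "8 * \<kappa> + \<epsilon> < norm z" unfolding \<epsilon>_def using \<kappa>(2) by (simp_all add: field_simps)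
  have z0: "z \<noteq> 0" using z Q by auto
  obtain \<J> where J: "cells \<J>"
    and LY: "\<And>h N. bnorm_le \<alpha> h N \<Longrightarrow> bnorm_le \<alpha> (Transfer (\<lambda>x. h x - averaging \<J> h x)) ((8 * \<kappa> + \<epsilon>) * N)"
    by (rule Lasota_Yorke_decomposition[OF \<kappa>(1) \<epsilon>(1), of 1]) (use that in auto)
  note fin = cells_finite[OF J]
  define A where "A h = Transfer (\<lambda>x. h x - averaging \<J> h x)" for h
  define W where "W = 2 * cells_weight \<J>"
  have W0: "0 \<le> W" using cells_weight_nonneg by (simp add: W_def)
  have ai: "integrable leb01 (averaging \<J> h)" for h by (rule averaging_integrable[OF J])
  have di: "integrable leb01 (\<lambda>x. h x - averaging \<J> h x)" if "integrable leb01 h" for h using that ai by simp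
  have avgL1: "(LINT x|leb01. norm (averaging \<J> h x)) \<le> W * (LINT x|leb01. norm (h x))" if "integrable leb01 h" for h
    using L1_le_bnorm[OF averaging_bnorm[OF J that \<alpha>(1)] \<alpha>] by (simp add: W_def)
  have avg_add: "averaging \<J> (\<lambda>x. g x + h x) x = averaging \<J> g x + averaging \<J> h x"
    if "integrable leb01 g" "integrable leb01 h" for g h x
    unfolding averaging_def sum.distrib[symmetric]
    by (rule sum.cong[OF refl]) (use cell_avg_add[OF J _ that] in \<open>simp add: distrib_right\<close>)
  have avg_scale: "averaging \<J> (\<lambda>x. k * h x) x = k * averaging \<J> h x" for k h x
    unfolding averaging_def cell_avg_scale sum_distrib_left by (simp add: mult.assoc)
  interpret A: L1_operator A "M * (1 + W)"
  proof
    fix h :: "real \<Rightarrow> complex" assume h: "integrable leb01 h"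
    show "integrable leb01 (A h)" unfolding A_def by (rule Transfer_integrable[OF di[OF h]])
    have "(LINT x|leb01. norm (h x + - averaging \<J> h x)) \<le> (LINT x|leb01. norm (h x)) + (LINT x|leb01. norm (- averaging \<J> h x))"
      by (rule L1_triangle[OF h]) (use ai in simp)
    also have "\<dots> \<le> (1 + W) * (LINT x|leb01. norm (h x))" using avgL1[OF h] by (simp add: algebra_simps)
    finally have "(LINT x|leb01. norm (h x - averaging \<J> h x)) \<le> (1 + W) * (LINT x|leb01. norm (h x))" by simp
    then have "M * (LINT x|leb01. norm (h x - averaging \<J> h x)) \<le> M * ((1 + W) * (LINT x|leb01. norm (h x)))"
      by (rule mult_left_mono[OF _ M])
    then show "(LINT x|leb01. norm (A h x)) \<le> M * (1 + W) * (LINT x|leb01. norm (h x))"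
      using Transfer_L1[OF di[OF h]] unfolding A_def by simp
    show "ae_eq (A (\<lambda>x. k * h x)) (\<lambda>x. k * A h x)" for k
    proof -
      have "(\<lambda>x. k * h x - averaging \<J> (\<lambda>x. k * h x) x) = (\<lambda>x. k * (h x - averaging \<J> h x))"
        by (simp add: avg_scale right_diff_distrib)
      then show ?thesis unfolding A_def by (simp add: Transfer_scale ae_eq_refl)
    qed
    fix g :: "real \<Rightarrow> complex" assume g: "integrable leb01 g"
    have "(\<lambda>x. g x + h x - averaging \<J> (\<lambda>x. g x + h x) x) = (\<lambda>x. (g x - averaging \<J> g x) + (h x - averaging \<J> h x))"
      by (simp add: avg_add[OF g h] algebra_simps)
    then show "ae_eq (A (\<lambda>x. g x + h x)) (\<lambda>x. A g x + A h x)"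
      unfolding A_def using Transfer_add[OF di[OF g] di[OF h]] by simp
  next
    show "0 \<le> M * (1 + W)" using M W0 by simp
  qed
  have An: "bnorm_le \<alpha> ((A ^^ k) h) ((8 * \<kappa> + \<epsilon>) ^ k * N)" if h: "bnorm_le \<alpha> h N" for k h N
  proof (induction k)
    case (Suc k)
    then show ?case using LY[OF Suc] by (simp add: A_def mult_ac)
  qed (use h in simp)
  have "summable (\<lambda>k. ((8 * \<kappa> + \<epsilon>) / norm z) ^ k)" using \<kappa> \<epsilon> z0 by (intro summable_geometric) (auto simp: divide_less_eq)
  then have s: "summable (\<lambda>k. (8 * \<kappa> + \<epsilon>) ^ k / norm z ^ k)" by (simp add: power_divide)
  obtain S where S: "bounded_operator_on (B_space \<alpha>) (B_norm \<alpha>) S"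
    and S1: "\<And>h. h \<in> B_space \<alpha> \<Longrightarrow> ae_eq (S (shifted A z h)) h"
    and S2: "\<And>h. h \<in> B_space \<alpha> \<Longrightarrow> ae_eq (shifted A z (S h)) h"
    by (rule A.resolvent[OF \<alpha> An z0 s]) (assumption, rule that)
  have SB: "S h \<in> B_space \<alpha>" if "h \<in> B_space \<alpha>" for h using S that unfolding bounded_operator_on_def by blast
  have S_cong: "ae_eq (S g) (S h)" if "g \<in> B_space \<alpha>" "h \<in> B_space \<alpha>" "ae_eq g h" for g h
    using S that unfolding bounded_operator_on_def by blast
  have S_add: "ae_eq (S (\<lambda>x. g x + h x)) (\<lambda>x. S g x + S h x)" if "g \<in> B_space \<alpha>" "h \<in> B_space \<alpha>" for g h
    using S that unfolding bounded_operator_on_def by blast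
  have S_scale: "ae_eq (S (\<lambda>x. k * h x)) (\<lambda>x. k * S h x)" if "h \<in> B_space \<alpha>" for k h
    using S that unfolding bounded_operator_on_def by blast
  have I: "integrable leb01 h" if "h \<in> B_space \<alpha>" for h using that by (simp add: B_space_def)
  define v where "v K = Transfer (indicator K)" for K :: "real set"
  have indB: "indicator K \<in> B_space \<alpha>" if "K \<in> \<J>" for K
    using cells_obtain[OF J that] bnorm_le_indicator[OF _ _ _ \<alpha>(1)] B_space_iff by metis
  have vB: "v K \<in> B_space \<alpha>" if K: "K \<in> \<J>" for K
    using indB[OF K] Transfer_bnorm unfolding v_def B_space_iff by blast
  have sumB: "(\<lambda>x. \<Sum>K\<in>F. k K * g K x) \<in> B_space \<alpha>" if F: "finite F" "\<And>K. K \<in> F \<Longrightarrow> g K \<in> B_space \<alpha>"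
    for F :: "real set set" and k g
  proof -
    have "bnorm_le \<alpha> (\<lambda>x. \<Sum>K\<in>F. k K * g K x) (\<Sum>K\<in>F. norm (k K) * enn2real (B_norm \<alpha> (g K)))"
      by (intro bnorm_le_sum F(1) bnorm_le_scale bnorm_le_exact F(2))
    then show ?thesis using B_space_iff by blast
  qed
  have split: "ae_eq (Transfer h) (\<lambda>x. A h x + (\<Sum>K\<in>\<J>. cell_avg K h * v K x))" if h: "h \<in> B_space \<alpha>" for h
  proof -
    have "ae_eq (Transfer (\<lambda>x. (h x - averaging \<J> h x) + averaging \<J> h x)) (\<lambda>x. A h x + Transfer (averaging \<J> h) x)"
      unfolding A_def by (rule Transfer_add[OF di[OF I[OF h]] ai])
    moreover have "ae_eq (Transfer (averaging \<J> h)) (\<lambda>x. \<Sum>K\<in>\<J>. cell_avg K h * v K x)"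
      unfolding averaging_def[abs_def] v_def by (rule T.sum[OF fin I[OF indB]])
    ultimately show ?thesis by (auto intro: ae_eq_trans[OF _ ae_eq_add[OF ae_eq_refl]])
  qed
  have S_sum: "ae_eq (S (\<lambda>x. \<Sum>K\<in>F. k K * v K x)) (\<lambda>x. \<Sum>K\<in>F. k K * S (v K) x)"
    if "finite F" "F \<subseteq> \<J>" for F k
    using that
  proof (induction F rule: finite_induct)
    case empty
    have "(\<lambda>x. 0) \<in> B_space \<alpha>" using bnorm_le_zero B_space_iff by blast
    from S_scale[OF this, of 0] show ?case by simp
  next
    case (insert L F)
    have 1: "v L \<in> B_space \<alpha>" "(\<lambda>x. \<Sum>K\<in>F. k K * v K x) \<in> B_space \<alpha>" using insert by (auto intro!: vB sumB)
    have 2: "(\<lambda>x. k L * v L x) \<in> B_space \<alpha>" using sumB[of "{L}" v k] 1 by simp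
    have "ae_eq (S (\<lambda>x. k L * v L x + (\<Sum>K\<in>F. k K * v K x))) (\<lambda>x. S (\<lambda>x. k L * v L x) x + S (\<lambda>x. \<Sum>K\<in>F. k K * v K x) x)"
      by (rule S_add[OF 2 1(2)])
    then have "ae_eq (S (\<lambda>x. k L * v L x + (\<Sum>K\<in>F. k K * v K x))) (\<lambda>x. k L * S (v L) x + (\<Sum>K\<in>F. k K * S (v K) x))"
      by (rule ae_eq_trans[OF _ ae_eq_add[OF S_scale[OF 1(1)] insert.IH]]) (use insert in auto)
    then show ?case using insert.hyps by simp
  qed
  show ?thesis unfolding Fredholm_on_def
  proof
    show "finite_dim_mod_ae (B_space \<alpha>) {h \<in> B_space \<alpha>. ae_eq (shifted Transfer z h) (\<lambda>x. 0)}"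
      unfolding finite_dim_mod_ae_def
    proof (intro exI[of _ "(\<lambda>K. S (v K)) ` \<J>"] conjI ballI)
      show "(\<lambda>K. S (v K)) ` \<J> \<subseteq> B_space \<alpha>" using SB vB by auto
      show "finite ((\<lambda>K. S (v K)) ` \<J>)" using fin by simp
      fix h assume "h \<in> {h \<in> B_space \<alpha>. ae_eq (shifted Transfer z h) (\<lambda>x. 0)}"
      then have h: "h \<in> B_space \<alpha>" and e: "ae_eq (shifted Transfer z h) (\<lambda>x. 0)" by auto
      have e': "ae_eq (shifted A z h) (\<lambda>x. \<Sum>K\<in>\<J>. cell_avg K h * v K x)"
        using e split[OF h] unfolding ae_eq_def shifted_def by eventually_elim (simp add: algebra_simps)
      have shB: "shifted A z h \<in> B_space \<alpha>"
        using bnorm_le_diff[OF bnorm_le_scale[OF bnorm_le_exact[OF h]] An[OF bnorm_le_exact[OF h], of 1]]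
        unfolding shifted_def B_space_iff by auto
      have "ae_eq h (\<lambda>x. \<Sum>K\<in>\<J>. cell_avg K h * S (v K) x)"
        by (rule ae_eq_trans[OF ae_eq_sym[OF S1[OF h]]], rule ae_eq_trans[OF S_cong[OF shB sumB[OF fin vB] e']],
            assumption, rule S_sum[OF fin order_refl])
      moreover obtain k' where "\<And>x. (\<Sum>K\<in>\<J>. cell_avg K h * S (v K) x) = (\<Sum>u\<in>(\<lambda>K. S (v K)) ` \<J>. k' u * u x)"
        by (rule finite_span_reindex[OF fin, of "\<lambda>K. cell_avg K h" "\<lambda>K. S (v K)"]) (rule that)
      ultimately show "\<exists>k. ae_eq h (\<lambda>x. \<Sum>u\<in>(\<lambda>K. S (v K)) ` \<J>. k u * u x)" by auto
    qed
    show "finite_codim_mod_ae (B_space \<alpha>) (shifted Transfer z ` B_space \<alpha>)"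
      unfolding finite_codim_mod_ae_def
    proof (intro exI[of _ "v ` \<J>"] conjI ballI)
      show "v ` \<J> \<subseteq> B_space \<alpha>" using vB by auto
      show "finite (v ` \<J>)" using fin by simp
      fix g assume g: "g \<in> B_space \<alpha>"
      have "ae_eq g (\<lambda>x. shifted Transfer z (S g) x + (\<Sum>K\<in>\<J>. cell_avg K (S g) * v K x))"
        using S2[OF g] split[OF SB[OF g]] unfolding ae_eq_def shifted_def by eventually_elim (simp add: algebra_simps)
      moreover obtain k' where "\<And>x. (\<Sum>K\<in>\<J>. cell_avg K (S g) * v K x) = (\<Sum>u\<in>v ` \<J>. k' u * u x)"
        by (rule finite_span_reindex[OF fin, of "\<lambda>K. cell_avg K (S g)" v]) (rule that)
      ultimately have "ae_eq g (\<lambda>x. shifted Transfer z (S g) x + (\<Sum>u\<in>v ` \<J>. k' u * u x))" by simp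
      then show "\<exists>h\<in>shifted Transfer z ` B_space \<alpha>. \<exists>k. ae_eq g (\<lambda>x. h x + (\<Sum>u\<in>v ` \<J>. k u * u x))"
        using SB[OF g] by blast
    qed
  qed
qed

lemma Transfer_bounded_operator: "bounded_operator_on (B_space \<alpha>) (B_norm \<alpha>) Transfer"
  unfolding bounded_operator_on_def
proof (intro conjI ballI allI impI)
  have I: "integrable leb01 h" if "h \<in> B_space \<alpha>" for h using that by (simp add: B_space_def)
  show "Transfer h \<in> B_space \<alpha>" if "h \<in> B_space \<alpha>" for h using that Transfer_bnorm unfolding B_space_iff by blast
  show "ae_eq (Transfer g) (Transfer h)" if "g \<in> B_space \<alpha>" "h \<in> B_space \<alpha>" "ae_eq g h" for g h
    by (rule T.cong[OF I I]) (use that in auto)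
  show "ae_eq (Transfer (\<lambda>x. g x + h x)) (\<lambda>x. Transfer g x + Transfer h x)" if "g \<in> B_space \<alpha>" "h \<in> B_space \<alpha>" for g h
    by (rule Transfer_add[OF I I]) (use that in auto)
  show "ae_eq (Transfer (\<lambda>x. k * h x)) (\<lambda>x. k * Transfer h x)" for k h by (simp add: Transfer_scale ae_eq_refl)
  show "\<exists>C. \<forall>h\<in>B_space \<alpha>. B_norm \<alpha> (Transfer h) \<le> ennreal C * B_norm \<alpha> h"
  proof (intro exI[of _ "2 * growth"] ballI)
    fix h assume h: "h \<in> B_space \<alpha>"
    have fin: "B_norm \<alpha> h = ennreal (enn2real (B_norm \<alpha> h))" using h by (simp add: B_space_def)
    have "B_norm \<alpha> (Transfer h) \<le> ennreal (2 * growth * enn2real (B_norm \<alpha> h))"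
      using Transfer_bnorm[OF bnorm_le_exact[OF h]] bnorm_le_iff by blast
    also have "\<dots> = ennreal (2 * growth) * ennreal (enn2real (B_norm \<alpha> h))"
      by (rule ennreal_mult) (use growth_nonneg in auto)
    also have "\<dots> = ennreal (2 * growth) * B_norm \<alpha> h" using fin by simp
    finally show "B_norm \<alpha> (Transfer h) \<le> ennreal (2 * growth) * B_norm \<alpha> h" .
  qed
qed

lemma Transfer_Fredholm_resolvent:
  assumes z: "Q < norm z" "M < norm z" shows "Fredholm_on (B_space \<alpha>) (shifted Transfer z)"
proof -
  obtain S where S: "bounded_operator_on (B_space \<alpha>) (B_norm \<alpha>) S"
    and S1: "\<And>h. h \<in> B_space \<alpha> \<Longrightarrow> ae_eq (S (shifted Transfer z h)) h"
    and S2: "\<And>h. h \<in> B_space \<alpha> \<Longrightarrow> ae_eq (shifted Transfer z (S h)) h"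
    by (rule Transfer_resolvent[OF z]) (rule that)
  have zB: "(\<lambda>x. 0) \<in> B_space \<alpha>" using bnorm_le_zero B_space_iff by blast
  have S0: "ae_eq (S (\<lambda>x. 0)) (\<lambda>x. 0)"
  proof -
    have "\<forall>k. \<forall>h\<in>B_space \<alpha>. ae_eq (S (\<lambda>x. k * h x)) (\<lambda>x. k * S h x)"
      using S unfolding bounded_operator_on_def by blast
    from bspec[OF spec[OF this, of 0] zB] show ?thesis by simp
  qed
  have "ae_eq h (\<lambda>x. 0)" if h: "h \<in> B_space \<alpha>" and e: "ae_eq (shifted Transfer z h) (\<lambda>x. 0)" for h
  proof -
    have shB: "shifted Transfer z h \<in> B_space \<alpha>"
      using bnorm_le_diff[OF bnorm_le_scale[OF bnorm_le_exact[OF h]] Transfer_bnorm[OF bnorm_le_exact[OF h]]]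
      unfolding shifted_def B_space_iff by blast
    have "ae_eq (S (shifted Transfer z h)) (S (\<lambda>x. 0))" using S shB zB e unfolding bounded_operator_on_def by blast
    then show ?thesis by (intro ae_eq_trans[OF ae_eq_sym[OF S1[OF h]] ae_eq_trans[OF _ S0]])
  qed
  then have "finite_dim_mod_ae (B_space \<alpha>) {h \<in> B_space \<alpha>. ae_eq (shifted Transfer z h) (\<lambda>x. 0)}"
    unfolding finite_dim_mod_ae_def by (intro exI[of _ "{}"]) auto
  moreover have "finite_codim_mod_ae (B_space \<alpha>) (shifted Transfer z ` B_space \<alpha>)"
    unfolding finite_codim_mod_ae_def
  proof (intro exI[of _ "{}"] conjI ballI)
    fix g assume g: "g \<in> B_space \<alpha>"
    have "S g \<in> B_space \<alpha>" using S g unfolding bounded_operator_on_def by blast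
    moreover have "ae_eq g (\<lambda>x. shifted Transfer z (S g) x + (\<Sum>u\<in>{}. 0 * u x))" using ae_eq_sym[OF S2[OF g]] by simp
    ultimately show "\<exists>h\<in>shifted Transfer z ` B_space \<alpha>. \<exists>k. ae_eq g (\<lambda>x. h x + (\<Sum>u\<in>{}. k u * u x))" by auto
  qed auto
  ultimately show ?thesis unfolding Fredholm_on_def by blast
qed

end

section \<open>Passage from a partition to an enumerated family of branches\<close>

text \<open>
  A nonempty open set is not negligible, so an essential bound on a continuous function is a bound
  everywhere.
\<close>

lemma AE_le_imp_le_on_open:
  fixes g :: "real \<Rightarrow> real"
  assumes S: "open S" "S \<subseteq> {0..1}" and g: "continuous_on S g" and ae: "AE x in leb01. g x \<le> B"
    and x: "x \<in> S"
  shows "g x \<le> B"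
proof (rule ccontr)
  assume "\<not> g x \<le> B"
  define V where "V = S \<inter> g -` {B<..}"
  have V: "open V" "x \<in> V" unfolding V_def
    using continuous_open_preimage[OF g S(1) open_greaterThan] x \<open>\<not> g x \<le> B\<close> by auto
  have S01: "{0..1} \<inter> space lebesgue \<in> sets (lebesgue :: real measure)" by simp
  have "AE x in lebesgue. x \<in> {0..1} \<longrightarrow> g x \<le> B"
    using ae by (simp only: AE_restrict_space_iff[OF S01])
  then have "AE x in lebesgue. x \<notin> V" by eventually_elim (use S(2) in \<open>auto simp: V_def\<close>)
  moreover have "V \<in> sets lebesgue" using borel_open[OF V(1)] by (auto intro: sets_completionI_sets)
  ultimately have "negligible V" by (simp add: AE_iff_null_sets negligible_iff_null_sets)
  then show False using open_not_negligible[OF V(1)] V(2) by blast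
qed

lemma Linf_norm_AE:
  assumes "Linf_norm g < \<infinity>" shows "AE x in leb01. norm (g x) \<le> enn2real (Linf_norm g)"
proof -
  have "AE x in leb01. ennreal (norm (g x)) \<le> Linf_norm g" unfolding Linf_norm_def by (rule esssup_AE)
  then show ?thesis
  proof eventually_elim
    case (elim x)
    have "ennreal (norm (g x)) \<le> ennreal (enn2real (Linf_norm g))" using elim assms by simp
    then show ?case by (simp add: ennreal_le_iff)
  qed
qed

lemma sum_le_infsum_ennreal:
  fixes g :: "'a \<Rightarrow> ennreal"
  assumes "finite F" "F \<subseteq> A" shows "sum g F \<le> infsum g A"
  unfolding nonneg_infsum_complete[of A g, OF zero_le] using assms by (intro SUP_upper) auto

text \<open>
  The intervals are countable in number; X is the set of indices in use, and for the others the interval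
  is empty.
\<close>

lemma enumerate_intervals:
  assumes P: "\<And>p. p \<in> P \<Longrightarrow> \<exists>a b. 0 \<le> a \<and> a < b \<and> b \<le> (1::real) \<and> p = {a<..<b}" and dis: "disjoint P"
  obtains c d :: "nat \<Rightarrow> real" and X :: "nat set" and q :: "nat \<Rightarrow> real set"
  where "\<And>n. 0 \<le> c n" "\<And>n. c n \<le> d n" "\<And>n. d n \<le> 1" "disjoint_family (\<lambda>n. {c n<..<d n})"
    "(\<Union>n. {c n<..<d n}) = \<Union>P" "inj_on q X" "q ` X = P"
    "\<And>n. n \<in> X \<Longrightarrow> {c n<..<d n} = q n" "\<And>n. n \<notin> X \<Longrightarrow> {c n<..<d n} = {}"
proof -
  have "countable P"
  proof (rule countable_disjoint_open_subsets[OF _ dis])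
    fix p assume "p \<in> P" then show "open p" using P by (metis open_greaterThanLessThan)
  qed
  define X where "X = to_nat_on P ` P"
  define q where "q = from_nat_into P"
  have qX: "bij_betw q X P"
    unfolding X_def q_def using \<open>countable P\<close> by (intro bij_betwI[of _ _ _ "to_nat_on P"]) auto
  obtain lo hi where lh: "\<And>p. p \<in> P \<Longrightarrow> 0 \<le> lo p \<and> lo p < hi p \<and> hi p \<le> (1::real) \<and> p = {lo p<..<hi p}"
    using P by metis
  define c where "c n = (if n \<in> X then lo (q n) else 0)" for n
  define d where "d n = (if n \<in> X then hi (q n) else 0)" for n
  have qP: "q n \<in> P" if "n \<in> X" for n using qX that by (auto simp: bij_betw_def)
  have on: "{c n<..<d n} = q n" if "n \<in> X" for n using lh[OF qP[OF that]] that by (simp add: c_def d_def)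
  have off: "{c n<..<d n} = {}" if "n \<notin> X" for n using that by (simp add: c_def d_def)
  have bds: "0 \<le> c n \<and> c n \<le> d n \<and> d n \<le> 1" for n
  proof (cases "n \<in> X")
    case True
    then show ?thesis using lh[OF qP[OF True]] by (auto simp: c_def d_def less_imp_le)
  qed (simp add: c_def d_def)
  have "disjoint_family (\<lambda>n. {c n<..<d n})" unfolding disjoint_family_on_def
  proof (intro ballI impI)
    fix i j :: nat assume ij: "i \<noteq> j"
    show "{c i<..<d i} \<inter> {c j<..<d j} = {}"
    proof (cases "i \<in> X \<and> j \<in> X")
      case True
      then have "q i \<noteq> q j" using qX ij by (auto simp: bij_betw_def inj_on_def)
      then have "q i \<inter> q j = {}" using dis True qP unfolding disjoint_def by blast
      then show ?thesis using on True by simp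
    next
      case False
      then show ?thesis using off by blast
    qed
  qed
  moreover have "(\<Union>n. {c n<..<d n}) = \<Union>P"
  proof -
    have "(\<Union>n. {c n<..<d n}) = (\<Union>n\<in>X. {c n<..<d n})" using off by blast
    also have "\<dots> = (\<Union>n\<in>X. q n)" using on by simp
    also have "\<dots> = \<Union>P" using qX by (auto simp: bij_betw_def)
    finally show ?thesis .
  qed
  ultimately show thesis using that[of c d q X] bds on off qX by (simp add: bij_betw_def)
qed

theorem theorem3p1:
  fixes P :: "real set set" and f :: "real \<Rightarrow> real" and \<xi> :: "real \<Rightarrow> complex"
    and \<beta> r \<gamma> \<alpha> :: real
  assumes map: "piecewise_expanding P f"
    and \<beta>: "0 < \<beta>" "\<beta> \<le> 1"
    and \<xi>_Holder: "piecewise_Holder P \<beta> \<xi>"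
    and r: "r \<ge> 0" "integrable leb01 (\<lambda>x. \<bar>deriv f x\<bar> powr r)"
    and \<xi>_bounded: "Linf_norm (\<lambda>x. \<xi> x * complex_of_real (deriv f x)) < \<infinity>"
    and \<gamma>: "0 \<le> \<gamma>" "\<gamma> < 1"
    and \<xi>_summable:
      "(\<Sum>\<^sub>\<infinity>p\<in>P. SUP z\<in>p.
          ennreal (norm (\<xi> z * complex_of_real (deriv f z) powr complex_of_real \<gamma>)
                     powr (1 / (1 - \<gamma>)))) < \<infinity>"
    and \<beta>_r: "\<beta> > 1 / (r + 1)"
    and \<alpha>: "\<alpha> < 1" "\<alpha> > Max {\<gamma>, 1 - \<beta>, (1 - \<beta>) / (1 - \<beta> * (1 - r))}"
  shows "bounded_operator_on (B_space \<alpha>) (B_norm \<alpha>) (transfer_op P f \<xi>) \<and>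
    spectral_radius_on (B_space \<alpha>) (B_norm \<alpha>) (transfer_op P f \<xi>)
      \<le> Linf_norm (\<lambda>x. \<xi> x * complex_of_real (deriv f x)) \<and>
    essential_spectral_radius_on (B_space \<alpha>) (transfer_op P f \<xi>)
      \<le> min (Linf_norm (\<lambda>x. \<xi> x * complex_of_real (deriv f x)))
            (8 * Linf_norm (\<lambda>x. \<xi> x * complex_of_real (deriv f x) powr complex_of_real \<alpha>))"
proof -
  define D where "D x = \<bar>deriv f x\<bar>" for x
  define M where "M = enn2real (Linf_norm (\<lambda>x. \<xi> x * complex_of_real (deriv f x)))"
  have M0: "0 \<le> M" by (simp add: M_def)
  have LM: "Linf_norm (\<lambda>x. \<xi> x * complex_of_real (deriv f x)) = ennreal M" using \<xi>_bounded by (simp add: M_def)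
  have \<alpha>': "\<gamma> < \<alpha>" "1 - \<beta> < \<alpha>" "(1 - \<beta>) / (1 - \<beta> * (1 - r)) < \<alpha>" using \<alpha>(2) by auto
  have \<alpha>0: "0 < \<alpha>" using \<alpha>'(1) \<gamma> by linarith
  have \<beta>r: "1 < \<beta> * (r + 1)" using \<beta>_r r by (simp add: pos_divide_less_eq)
  have den: "0 < 1 - \<beta> * (1 - r)" using \<beta>r \<beta> by (simp add: algebra_simps)
  have \<alpha>r: "1 - \<beta> \<le> \<alpha> * (1 - \<beta> * (1 - r))" using \<alpha>'(3) den by (simp add: pos_divide_less_eq)
  have nP: "norm (\<xi> x * complex_of_real (deriv f x) powr complex_of_real s) = norm (\<xi> x) * D x powr s" for x s
    by (simp add: norm_mult norm_powr_real_powr' D_def)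
  have n1: "norm (\<xi> x * complex_of_real (deriv f x)) = norm (\<xi> x) * D x" for x by (simp add: norm_mult D_def)
  have iv: "\<And>p. p \<in> P \<Longrightarrow> \<exists>a b. 0 \<le> a \<and> a < b \<and> b \<le> 1 \<and> p = {a<..<b}" and dP: "disjoint P"
    and fr: "f ` \<Union>P \<subseteq> {0..1}"
    and C1: "\<And>p. p \<in> P \<Longrightarrow> f C1_differentiable_on p"
    and inf: "(INF p\<in>P. INF x\<in>p. ereal \<bar>deriv f x\<bar>) > 1"
    using map unfolding piecewise_expanding_def by auto
  have opn: "open p" if "p \<in> P" for p using iv[OF that] by auto
  have P01: "\<Union>P \<subseteq> {0..1}" using iv by fastforce
  have der: "(f has_real_derivative deriv f x) (at x)" if x: "x \<in> p" "p \<in> P" for x p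
  proof -
    obtain f' where "(f has_vector_derivative f' x) (at x)"
      using C1[OF x(2)] x(1) unfolding C1_differentiable_on_def by blast
    then have "(f has_real_derivative f' x) (at x)" by (simp add: has_real_derivative_iff_has_vector_derivative)
    then show ?thesis using DERIV_imp_deriv by fastforce
  qed
  have contp: "continuous_on p (deriv f)" if p: "p \<in> P" for p
  proof -
    obtain f' where f': "\<forall>x\<in>p. (f has_vector_derivative f' x) (at x)" "continuous_on p f'"
      using C1[OF p] unfolding C1_differentiable_on_def by blast
    have "deriv f x = f' x" if "x \<in> p" for x
      using f'(1) that by (intro DERIV_imp_deriv) (simp add: has_real_derivative_iff_has_vector_derivative)
    then show ?thesis using f'(2) by (simp cong: continuous_on_cong)
  qed
  have contD: "continuous_on (\<Union>P) (deriv f)" by (rule continuous_on_open_Union) (use opn contp in auto)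
  have D1: "1 \<le> D x" if x: "x \<in> p" "p \<in> P" for x p
  proof -
    have "(INF p\<in>P. INF x\<in>p. ereal \<bar>deriv f x\<bar>) \<le> (INF x\<in>p. ereal \<bar>deriv f x\<bar>)" by (rule INF_lower[OF x(2)])
    also have "\<dots> \<le> ereal \<bar>deriv f x\<bar>" by (rule INF_lower[OF x(1)])
    finally have "1 < ereal \<bar>deriv f x\<bar>" using inf by (rule less_le_trans[rotated])
    then show ?thesis by (simp add: D_def)
  qed
  obtain C0 where C0: "\<And>p. p \<in> P \<Longrightarrow> \<exists>g. (\<forall>x\<in>p. g x = \<xi> x) \<and>
        (\<forall>x\<in>closure p. \<forall>y\<in>closure p. norm (g x - g y) \<le> C0 * \<bar>x - y\<bar> powr \<beta>)"
    using \<xi>_Holder unfolding piecewise_Holder_def by blast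
  \<comment> \<open>the Hoelder constant may be enlarged, and a positive one is needed below\<close>
  define C where "C = max 1 C0"
  have C: "0 < C" by (simp add: C_def)
  have Hol: "norm (\<xi> x - \<xi> y) \<le> C * \<bar>x - y\<bar> powr \<beta>" if xy: "x \<in> p" "y \<in> p" "p \<in> P" for x y p
  proof -
    obtain g where g: "\<forall>x\<in>p. g x = \<xi> x" "\<forall>x\<in>closure p. \<forall>y\<in>closure p. norm (g x - g y) \<le> C0 * \<bar>x - y\<bar> powr \<beta>"
      using C0[OF xy(3)] by blast
    have "norm (\<xi> x - \<xi> y) \<le> C0 * \<bar>x - y\<bar> powr \<beta>" using g xy closure_subset[of p] by (metis subsetD)
    also have "\<dots> \<le> C * \<bar>x - y\<bar> powr \<beta>" by (intro mult_right_mono) (auto simp: C_def)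
    finally show ?thesis .
  qed
  have cont\<xi>: "continuous_on (\<Union>P) \<xi>"
    by (rule continuous_on_open_Union) (use opn Holder_continuous_on[OF \<beta>(1)] Hol in blast)+
  have opnU: "open (\<Union>P)" using opn by blast
  have D_nz: "D x \<noteq> 0" if "x \<in> \<Union>P" for x using that D1 by force
  have cont_weight: "continuous_on (\<Union>P) (\<lambda>x. norm (\<xi> x) * D x powr s)" for s
    unfolding D_def using D_nz by (intro continuous_intros cont\<xi> contD) (auto simp: D_def)
  have \<xi>M: "norm (\<xi> x) * D x \<le> M" if x: "x \<in> \<Union>P" for x
  proof (rule AE_le_imp_le_on_open[OF opnU P01 _ _ x])
    show "continuous_on (\<Union>P) (\<lambda>x. norm (\<xi> x) * D x)" unfolding D_def by (intro continuous_intros cont\<xi> contD)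
    show "AE x in leb01. norm (\<xi> x) * D x \<le> M"
      using Linf_norm_AE[OF \<xi>_bounded] by (simp add: n1 M_def)
  qed
  obtain c d :: "nat \<Rightarrow> real" and X :: "nat set" and q :: "nat \<Rightarrow> real set"
  where cd: "\<And>n. 0 \<le> c n" "\<And>n. c n \<le> d n" "\<And>n. d n \<le> 1" and dcd: "disjoint_family (\<lambda>n. {c n<..<d n})"
    and Un: "(\<Union>n. {c n<..<d n}) = \<Union>P" and q: "inj_on q X" "q ` X = P"
    and on: "\<And>n. n \<in> X \<Longrightarrow> {c n<..<d n} = q n" and off: "\<And>n. n \<notin> X \<Longrightarrow> {c n<..<d n} = {}"
    by (rule enumerate_intervals[OF iv dP]) (assumption, rule that)
  have cellP: "\<exists>p\<in>P. {c n<..<d n} = p" if "x \<in> {c n<..<d n}" for x n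
    using that on[of n] off[of n] q(2) by blast
  define S where "S p = (SUP z\<in>p. ennreal (norm (\<xi> z * complex_of_real (deriv f z) powr complex_of_real \<gamma>)
                     powr (1 / (1 - \<gamma>))))" for p
  have Stot: "infsum S P < \<infinity>" using \<xi>_summable by (simp add: S_def[abs_def])
  have Sfin: "S p < \<infinity>" if "p \<in> P" for p
    using sum_le_infsum_ennreal[of "{p}" P S] that Stot by (auto intro: le_less_trans)
  define s where "s n = (if n \<in> X then enn2real (S (q n)) else 0)" for n
  have s0: "0 \<le> s n" for n by (simp add: s_def)
  have s_sum: "summable s"
  proof (rule summableI_nonneg_bounded[where x="enn2real (infsum S P)", OF s0])
    fix N
    define F where "F = {n \<in> X. n < N}"
    have F: "finite F" "F \<subseteq> X" by (auto simp: F_def)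
    have qF: "finite (q ` F)" "q ` F \<subseteq> P" "inj_on q F" using F q by (auto intro: inj_on_subset)
    have "ennreal (\<Sum>n<N. s n) = (\<Sum>n<N. ennreal (s n))" by (rule sum_ennreal[symmetric]) (rule s0)
    also have "\<dots> = (\<Sum>n\<in>F. ennreal (s n))"
      by (rule sum.mono_neutral_right) (auto simp: F_def s_def)
    also have "\<dots> = (\<Sum>n\<in>F. S (q n))"
    proof (rule sum.cong[OF refl])
      fix n assume "n \<in> F"
      then have "n \<in> X" "q n \<in> P" using F q by auto
      then show "ennreal (s n) = S (q n)" using Sfin by (simp add: s_def)
    qed
    also have "\<dots> = sum S (q ` F)" by (simp add: sum.reindex[OF qF(3)])
    also have "\<dots> \<le> infsum S P" by (rule sum_le_infsum_ennreal[OF qF(1,2)])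
    also have "\<dots> = ennreal (enn2real (infsum S P))" using Stot by simp
    finally show "(\<Sum>n<N. s n) \<le> enn2real (infsum S P)" by (simp add: ennreal_le_iff)
  qed
  \<comment> \<open>interpolation between the exponents \<gamma> and 1 of |f'|, which is possible as \<gamma> < \<alpha> < 1\<close>
  define Qn where "Qn n = M powr ((\<alpha> - \<gamma>) / (1 - \<gamma>)) * s n powr (1 - \<alpha>)" for n
  have g1: "0 < 1 - \<gamma>" using \<gamma> by simp
  have Qn_bound: "norm (\<xi> x) * D x powr \<alpha> \<le> Qn n" if x: "x \<in> {c n<..<d n}" for n x
  proof -
    have nX: "n \<in> X" using x off by blast
    then have xq: "x \<in> q n" "q n \<in> P" using x on q by auto
    define Y where "Y = norm (\<xi> x) * D x powr \<gamma>"
    have Y0: "0 \<le> Y" by (simp add: Y_def)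
    have "ennreal (Y powr (1 / (1 - \<gamma>))) \<le> S (q n)"
      unfolding S_def nP Y_def by (rule SUP_upper[OF xq(1)])
    also have "\<dots> = ennreal (s n)" using nX Sfin[OF xq(2)] by (simp add: s_def)
    finally have Ys: "Y powr (1 / (1 - \<gamma>)) \<le> s n" using s0 by (simp add: ennreal_le_iff)
    have D0: "0 \<le> D x" by (simp add: D_def)
    have e: "(1 - \<alpha>) / (1 - \<gamma>) + (\<alpha> - \<gamma>) / (1 - \<gamma>) = 1"
      "\<gamma> * ((1 - \<alpha>) / (1 - \<gamma>)) + (\<alpha> - \<gamma>) / (1 - \<gamma>) = \<alpha>"
      using g1 by (simp_all add: add_divide_distrib[symmetric] field_simps)
    have "Y powr ((1 - \<alpha>) / (1 - \<gamma>)) * (norm (\<xi> x) * D x) powr ((\<alpha> - \<gamma>) / (1 - \<gamma>))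
       = (norm (\<xi> x) powr ((1 - \<alpha>) / (1 - \<gamma>)) * norm (\<xi> x) powr ((\<alpha> - \<gamma>) / (1 - \<gamma>)))
         * (D x powr (\<gamma> * ((1 - \<alpha>) / (1 - \<gamma>))) * D x powr ((\<alpha> - \<gamma>) / (1 - \<gamma>)))"
      unfolding Y_def using D0 by (simp add: powr_mult powr_powr)
    also have "\<dots> = norm (\<xi> x) * D x powr \<alpha>"
      unfolding powr_add[symmetric] e by simp
    finally have "norm (\<xi> x) * D x powr \<alpha>
      = (Y powr (1 / (1 - \<gamma>))) powr (1 - \<alpha>) * (norm (\<xi> x) * D x) powr ((\<alpha> - \<gamma>) / (1 - \<gamma>))"
      by (simp add: powr_powr)
    also have "\<dots> \<le> s n powr (1 - \<alpha>) * M powr ((\<alpha> - \<gamma>) / (1 - \<gamma>))"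
      using Ys \<xi>M[of x] xq \<alpha> \<alpha>' g1 D0 by (intro mult_mono powr_mono2) auto
    finally show ?thesis by (simp add: Qn_def mult.commute)
  qed
  have Qn_pow: "Qn n powr (1 / (1 - \<alpha>)) = (M powr ((\<alpha> - \<gamma>) / (1 - \<gamma>))) powr (1 / (1 - \<alpha>)) * s n" for n
    unfolding Qn_def using s0[of n] \<alpha> by (simp add: powr_mult powr_powr)
  have Qn_sum: "summable (\<lambda>n. Qn n powr (1 / (1 - \<alpha>)))"
    unfolding Qn_pow by (rule summable_mult[OF s_sum])
  have br: "branches c d Qn f \<xi> \<alpha> \<beta> r C M Q"
    if Q: "0 \<le> Q" "\<And>x. x \<in> \<Union>P \<Longrightarrow> norm (\<xi> x) * D x powr \<alpha> \<le> Q" for Q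
  proof
    show "continuous_on (\<Union>n. {c n<..<d n}) (deriv f)" unfolding Un by (rule contD)
    show "(f has_real_derivative deriv f x) (at x)" "1 \<le> \<bar>deriv f x\<bar>" "f x \<in> {0..1}"
      "norm (\<xi> x) * \<bar>deriv f x\<bar> \<le> M" "norm (\<xi> x) * \<bar>deriv f x\<bar> powr \<alpha> \<le> Q"
      if "x \<in> (\<Union>n. {c n<..<d n})" for x
      using that der D1 fr \<xi>M[of x] Q(2)[of x] unfolding Un D_def by blast+
    show "norm (\<xi> x - \<xi> y) \<le> C * \<bar>x - y\<bar> powr \<beta>" if "x \<in> {c n<..<d n}" "y \<in> {c n<..<d n}" for n x y
      using cellP[OF that(1)] Hol that by blast
    show "norm (\<xi> x) * \<bar>deriv f x\<bar> powr \<alpha> \<le> Qn n" if "x \<in> {c n<..<d n}" for n x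
      using Qn_bound[OF that] by (simp add: D_def)
  qed (use \<alpha> \<alpha>0 \<alpha>' \<beta> r \<beta>r \<alpha>r C M0 Q cd dcd Qn_sum in \<open>auto simp: Qn_def\<close>)
  have \<alpha>M: "norm (\<xi> x) * D x powr \<alpha> \<le> M" if x: "x \<in> \<Union>P" for x
  proof -
    have "D x powr \<alpha> \<le> D x powr 1" using x D1 \<alpha> by (intro powr_mono) auto
    also have "\<dots> = D x" by (simp add: D_def)
    finally have "norm (\<xi> x) * D x powr \<alpha> \<le> norm (\<xi> x) * D x" by (rule mult_left_mono) simp
    then show ?thesis using \<xi>M[OF x] by linarith
  qed
  interpret BM: branches c d Qn f \<xi> \<alpha> \<beta> r C M M by (rule br[OF M0 \<alpha>M])
  have T: "transfer_op P f \<xi> = BM.Transfer"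
    by (rule ext, rule ext) (simp add: transfer_op_def BM.Transfer_def BM.\<Omega>_def Un)
  have "ennreal (norm z) \<le> ennreal M" if z: "z \<in> spectrum_on (B_space \<alpha>) (B_norm \<alpha>) BM.Transfer" for z
  proof (rule ccontr)
    assume "\<not> ennreal (norm z) \<le> ennreal M"
    then have zM: "M < norm z" using M0 by (simp add: ennreal_le_iff not_le)
    obtain S where "bounded_operator_on (B_space \<alpha>) (B_norm \<alpha>) S"
      "\<And>h. h \<in> B_space \<alpha> \<Longrightarrow> ae_eq (S (shifted BM.Transfer z h)) h"
      "\<And>h. h \<in> B_space \<alpha> \<Longrightarrow> ae_eq (shifted BM.Transfer z (S h)) h"
      by (rule BM.Transfer_resolvent[OF zM zM]) (rule that)
    then show False using z unfolding spectrum_on_def by blast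
  qed
  then have "spectral_radius_on (B_space \<alpha>) (B_norm \<alpha>) BM.Transfer \<le> ennreal M"
    unfolding spectral_radius_on_def by (rule SUP_least)
  moreover have "essential_spectral_radius_on (B_space \<alpha>) BM.Transfer
     \<le> min (ennreal M) (8 * Linf_norm (\<lambda>x. \<xi> x * complex_of_real (deriv f x) powr complex_of_real \<alpha>))"
    unfolding essential_spectral_radius_on_def
  proof (rule SUP_least)
    fix z assume "z \<in> essential_spectrum_on (B_space \<alpha>) BM.Transfer"
    then have nF: "\<not> Fredholm_on (B_space \<alpha>) (shifted BM.Transfer z)" by (simp add: essential_spectrum_on_def)
    have "norm z \<le> M" using nF BM.Transfer_Fredholm_resolvent[of z] by (meson not_le)
    then have 1: "ennreal (norm z) \<le> ennreal M" by (rule ennreal_leI)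
    define L where "L = Linf_norm (\<lambda>x. \<xi> x * complex_of_real (deriv f x) powr complex_of_real \<alpha>)"
    have "ennreal (norm z) \<le> 8 * L"
    proof (cases "L < \<infinity>")
      case False
      then have "L = \<infinity>" by (simp add: not_less top_unique)
      then show ?thesis by (simp add: ennreal_mult_top)
    next
      case True
      define Q where "Q = enn2real L"
      have Q0: "0 \<le> Q" by (simp add: Q_def)
      have LQ: "L = ennreal Q" using True by (simp add: Q_def)
      have Qb: "norm (\<xi> x) * D x powr \<alpha> \<le> Q" if x: "x \<in> \<Union>P" for x
      proof (rule AE_le_imp_le_on_open[OF opnU P01 cont_weight _ x])
        show "AE x in leb01. norm (\<xi> x) * D x powr \<alpha> \<le> Q"
          using Linf_norm_AE[OF True[unfolded L_def]] by (simp add: nP Q_def L_def)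
      qed
      interpret BQ: branches c d Qn f \<xi> \<alpha> \<beta> r C M Q by (rule br[OF Q0 Qb])
      have "norm z \<le> 8 * Q" using nF BQ.Transfer_Fredholm[of z] by (meson not_le)
      then have "ennreal (norm z) \<le> ennreal (8 * Q)" by (rule ennreal_leI)
      also have "\<dots> = 8 * L" unfolding LQ using Q0 by (simp add: ennreal_mult)
      finally show ?thesis .
    qed
    then show "ennreal (norm z) \<le> min (ennreal M) (8 * Linf_norm (\<lambda>x. \<xi> x * complex_of_real (deriv f x) powr complex_of_real \<alpha>))"
      using 1 by (simp add: L_def)
  qed
  ultimately show ?thesis unfolding T LM using BM.Transfer_bounded_operator by blast
qed

end
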